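(* Let $G$ be a Lie group with Lie algebra $\mathfrak{g}$, let $a>0$, and let $\ell:2\mathfrak{g}\to\mathbb{R}$ be the hyper-regular reduced Lagrangian of a left-invariant second-order Lagrangian $L:T^{(2)}G\to\mathbb{R}$. Assume that the HOHP equations $$\dot\mu=\operatorname{ad}^*_\xi\mu,\qquad \mu=\frac{\delta\ell}{\delta\xi}-\dot\nu,\qquad \nu=\frac{\delta\ell}{\delta u},\qquad \dot g=g\xi,\qquad \dot\xi=u$$ induce flow maps $F_t:T^*(TG)\to T^*(TG)$ for all $t\in[0,a]$. Then for every $t\in[0,a]$ the map $F_t$ preserves the canonical symplectic form $\omega$ on $T^*(TG)$, i.e. $F_t^*\omega=\omega$.
   Context: $T^{(2)}G$ is the second-order tangent bundle, left-trivialised as $G\times2\mathfrak{g}$ by sending the class of a curve $g(t)$ to $(g(0),\xi(0),\dot\xi(0))$ with $\xi=g^{-1}\dot g$ (left translation to the identity). $L$ is left-invariant if in this trivialisation it does not depend on the $G$-entry; $\ell:2\mathfrak{g}=\mathfrak{g}\times\mathfrak{g}\to\mathbb{R}$, $(\xi,u)\mapsto\ell(\xi,u)$ is the induced function. $T^*(TG)$ is left-trivialised as $G\times\mathfrak{g}\times2\mathfrak{g}^*$ with elements $(g,\xi,\mu,\nu)$, and the second-order Pontryagin bundle $P^{(2)}G=T^{(2)}G\times_{TG}T^*(TG)$ as $G\times2\mathfrak{g}\times2\mathfrak{g}^*$ with elements $(g,\xi,u,\mu,\nu)$. Let $W_c\subset P^{(2)}G$ be the subset defined by $\nu=\frac{\delta\ell}{\delta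 u}(\xi,u)$ and $\phi:W_c\to T^*(TG)$, $(g,\xi,u,\mu,\nu)\mapsto(g,\xi,\mu,\nu)$. Hyper-regularity of $\ell$ means that $\frac{\delta^2\ell}{\delta u^2}$ is non-degenerate and $\phi$ is a diffeomorphism. The flow map is defined by $F_t(x)=\phi(\gamma(t))$, where $\gamma$ is the solution $(g,\xi,u,\mu,\nu)(t)$ of the HOHP equations with $\gamma(0)=\phi^{-1}(x)$. $\operatorname{ad}^*_\xi$ is the dual of $\operatorname{ad}_\xi$. For $y=(g,\xi,\mu,\nu)$ and tangent vectors $v_i=(\delta g_i,\delta\xi_i,\delta\mu_i,\delta\nu_i)$ at $y$, with $\eta_i=g^{-1}\delta g_i$, the canonical one-form is $\theta(y)(v_1)=\langle\mu,\eta_1\rangle+\langle\nu,\delta\xi_1\rangle$ and the canonical symplectic form is $$\omega(y)(v_1,v_2)=-\langle\delta\mu_1,\eta_2\rangle-\langle\delta\nu_1,\delta\xi_2\rangle+\langle\delta\mu_2,\eta_1\rangle+\langle\delta\nu_2,\delta\xi_1\rangle+\langle\mu,[\eta_1,\eta_2]\rangle.$$ *)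

theory Defs
  imports "HOL-Analysis.Analysis" "HOL-Algebra.Group"
begin

section \<open>Smooth maps between normed spaces\<close>

text \<open>Only used for open sets \<open>S\<close> and finite-dimensional domains, where continuity of all iterated
  directional derivatives of order at most \<open>k\<close> (together with differentiability) is the usual
  notion of being \<open>k\<close> times continuously differentiable.\<close>

primrec Ck_on :: "nat \<Rightarrow> 'a::real_normed_vector set \<Rightarrow> ('a \<Rightarrow> 'b::real_normed_vector) \<Rightarrow> bool" where
  "Ck_on 0 S f \<longleftrightarrow> continuous_on S f"
| "Ck_on (Suc k) S f \<longleftrightarrow>
     (\<forall>x\<in>S. f differentiable (at x)) \<and> (\<forall>v. Ck_on k S (\<lambda>x. frechet_derivative f (at x) v))"

definition smooth_on :: "'a::real_normed_vector set \<Rightarrow> ('a \<Rightarrow> 'b::real_normed_vector) \<Rightarrow> bool" where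
  "smooth_on S f \<longleftrightarrow> (\<forall>k. Ck_on k S f)"


section \<open>Smooth manifolds\<close>

text \<open>A smooth structure is given by an atlas indexed by the points of the manifold, the chart
  \<open>C x\<close> being defined around \<open>x\<close>.  The tangent space at \<open>x\<close> is the model space \<open>'e\<close>: the vector
  \<open>v\<close> stands for the tangent vector with coordinates \<open>v\<close> in the chart \<open>C x\<close>.\<close>

type_synonym ('m, 'e) chart = "'m set \<times> ('m \<Rightarrow> 'e)"
type_synonym ('m, 'e) atlas = "'m \<Rightarrow> ('m, 'e) chart"

definition chart_inv :: "('m, 'e) chart \<Rightarrow> 'e \<Rightarrow> 'm" where
  "chart_inv c = inv_into (fst c) (snd c)"

definition smooth_manifold ::
  "('m::topological_space, 'e::real_normed_vector) atlas \<Rightarrow> bool" where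
  "smooth_manifold C \<longleftrightarrow>
     (\<forall>x. x \<in> fst (C x) \<and> open (fst (C x)) \<and> open (snd (C x) ` fst (C x)) \<and>
        homeomorphism (fst (C x)) (snd (C x) ` fst (C x)) (snd (C x)) (chart_inv (C x))) \<and>
     (\<forall>x y. smooth_on (snd (C x) ` (fst (C x) \<inter> fst (C y))) (snd (C y) \<circ> chart_inv (C x)))"

definition smooth_map ::
  "('m::topological_space, 'e::real_normed_vector) atlas \<Rightarrow>
   ('n::topological_space, 'f::real_normed_vector) atlas \<Rightarrow> ('m \<Rightarrow> 'n) \<Rightarrow> bool" where
  "smooth_map C D f \<longleftrightarrow> continuous_on UNIV f \<and>
     (\<forall>x y. smooth_on (snd (C x) ` (fst (C x) \<inter> f -` fst (D y)))
              (snd (D y) \<circ> f \<circ> chart_inv (C x)))"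

definition manifold_differentiable_at ::
  "('m::t2_space, 'e::real_normed_vector) atlas \<Rightarrow>
   ('n::topological_space, 'f::real_normed_vector) atlas \<Rightarrow> ('m \<Rightarrow> 'n) \<Rightarrow> 'm \<Rightarrow> bool" where
  "manifold_differentiable_at C D f x \<longleftrightarrow> isCont f x \<and>
     (snd (D (f x)) \<circ> f \<circ> chart_inv (C x)) differentiable (at (snd (C x) x))"

definition tangent_map ::
  "('m, 'e::real_normed_vector) atlas \<Rightarrow> ('n, 'f::real_normed_vector) atlas \<Rightarrow>
   ('m \<Rightarrow> 'n) \<Rightarrow> 'm \<Rightarrow> 'e \<Rightarrow> 'f" where
  "tangent_map C D f x =
     frechet_derivative (snd (D (f x)) \<circ> f \<circ> chart_inv (C x)) (at (snd (C x) x))"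

definition prod_charts :: "('m, 'e) atlas \<Rightarrow> ('n, 'f) atlas \<Rightarrow> ('m \<times> 'n, 'e \<times> 'f) atlas" where
  "prod_charts C D =
     (\<lambda>(x, y). (fst (C x) \<times> fst (D y), map_prod (snd (C x)) (snd (D y))))"

definition vector_space_charts :: "('v, 'v) atlas" where
  "vector_space_charts = (\<lambda>x. (UNIV, \<lambda>y. y))"

definition has_velocity ::
  "('m::topological_space, 'e::real_normed_vector) atlas \<Rightarrow> (real \<Rightarrow> 'm) \<Rightarrow> 'e \<Rightarrow>
   real \<Rightarrow> real set \<Rightarrow> bool" where
  "has_velocity C c v t T \<longleftrightarrow> continuous (at t within T) c \<and>
     ((snd (C (c t)) \<circ> c) has_vector_derivative v) (at t within T)"

definition velocity :: "('m, 'e::real_normed_vector) atlas \<Rightarrow> (real \<Rightarrow> 'm) \<Rightarrow> real \<Rightarrow> 'e" where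
  "velocity C c t = vector_derivative (snd (C (c t)) \<circ> c) (at t)"

definition pullback_2form ::
  "('m, 'e::real_normed_vector) atlas \<Rightarrow> ('n, 'f::real_normed_vector) atlas \<Rightarrow> ('m \<Rightarrow> 'n) \<Rightarrow>
   ('n \<Rightarrow> 'f \<Rightarrow> 'f \<Rightarrow> real) \<Rightarrow> 'm \<Rightarrow> 'e \<Rightarrow> 'e \<Rightarrow> real" where
  "pullback_2form C D f \<omega> =
     (\<lambda>x v w. \<omega> (f x) (tangent_map C D f x v) (tangent_map C D f x w))"

text \<open>Vector fields send a point \<open>x\<close> to a tangent vector at \<open>x\<close>, written in the chart \<open>C x\<close>;
  \<open>local_field C p X\<close> is the coordinate expression of \<open>X\<close> in the single chart \<open>C p\<close>.\<close>

definition local_field ::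
  "('m, 'e::real_normed_vector) atlas \<Rightarrow> 'm \<Rightarrow> ('m \<Rightarrow> 'e) \<Rightarrow> 'e \<Rightarrow> 'e" where
  "local_field C p X y =
     (let x = chart_inv (C p) y
      in frechet_derivative (snd (C p) \<circ> chart_inv (C x)) (at (snd (C x) x)) (X x))"

definition field_bracket ::
  "('m, 'e::real_normed_vector) atlas \<Rightarrow> ('m \<Rightarrow> 'e) \<Rightarrow> ('m \<Rightarrow> 'e) \<Rightarrow> 'm \<Rightarrow> 'e" where
  "field_bracket C X Y p =
     frechet_derivative (local_field C p Y) (at (snd (C p) p)) (X p) -
     frechet_derivative (local_field C p X) (at (snd (C p) p)) (Y p)"


section \<open>Lie groups\<close>

record ('g, 'e) lie_group_data = "'g monoid" +
  charts :: "('g, 'e) atlas"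

locale lie_group = group G
  for G :: "('g::{t2_space,second_countable_topology}, 'e::euclidean_space) lie_group_data"
    (structure) +
  assumes carrier_UNIV: "carrier G = UNIV"
    and smooth_manifold_charts: "smooth_manifold (charts G)"
    and smooth_mult:
      "smooth_map (prod_charts (charts G) (charts G)) (charts G) (\<lambda>(x, y). x \<otimes> y)"
    and smooth_inv: "smooth_map (charts G) (charts G) (\<lambda>x. inv x)"

text \<open>The Lie algebra is the tangent space at the identity, that is, \<open>'e\<close> in the chart
  \<open>charts G \<one>\<close>.  Its dual is \<open>'e \<Rightarrow>\<^sub>L real\<close>.\<close>

text \<open>\<open>left_mult G g \<xi>\<close> is the tangent vector \<open>g\<xi>\<close> at \<open>g\<close>, and \<open>left_triv G g \<delta>g\<close> is \<open>g\<^sup>-\<^sup>1\<delta>g\<close>.\<close>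

definition left_mult ::
  "('g, 'e::real_normed_vector) lie_group_data \<Rightarrow> 'g \<Rightarrow> 'e \<Rightarrow> 'e" where
  "left_mult G g = tangent_map (charts G) (charts G) (\<lambda>h. g \<otimes>\<^bsub>G\<^esub> h) \<one>\<^bsub>G\<^esub>"

definition left_triv ::
  "('g, 'e::real_normed_vector) lie_group_data \<Rightarrow> 'g \<Rightarrow> 'e \<Rightarrow> 'e" where
  "left_triv G g = tangent_map (charts G) (charts G) (\<lambda>h. inv\<^bsub>G\<^esub> g \<otimes>\<^bsub>G\<^esub> h) g"

definition lie_bracket ::
  "('g, 'e::real_normed_vector) lie_group_data \<Rightarrow> 'e \<Rightarrow> 'e \<Rightarrow> 'e" where
  "lie_bracket G \<xi> \<eta> =
     field_bracket (charts G) (\<lambda>g. left_mult G g \<xi>) (\<lambda>g. left_mult G g \<eta>) \<one>\<^bsub>G\<^esub>"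

definition ad_star ::
  "('g, 'e::real_normed_vector) lie_group_data \<Rightarrow> 'e \<Rightarrow> ('e \<Rightarrow>\<^sub>L real) \<Rightarrow> ('e \<Rightarrow>\<^sub>L real)" where
  "ad_star G \<xi> \<mu> = Blinfun (\<lambda>\<eta>. blinfun_apply \<mu> (lie_bracket G \<xi> \<eta>))"


section \<open>Second-order Lagrangians\<close>

text \<open>The second-order tangent bundle: smooth curves modulo agreement at time 0 up to second
  order.\<close>

definition second_tangent_bundle ::
  "('m::topological_space, 'e::real_normed_vector) atlas \<Rightarrow> (real \<Rightarrow> 'm) set set" where
  "second_tangent_bundle C =
     {c. smooth_map vector_space_charts C c} //
     {(c, d). smooth_map vector_space_charts C c \<and> smooth_map vector_space_charts C d \<and>
        c 0 = d 0 \<and>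
        (let \<phi> = snd (C (c 0)) in
           vector_derivative (\<phi> \<circ> c) (at 0) = vector_derivative (\<phi> \<circ> d) (at 0) \<and>
           vector_derivative (\<lambda>t. vector_derivative (\<phi> \<circ> c) (at t)) (at 0) =
           vector_derivative (\<lambda>t. vector_derivative (\<phi> \<circ> d) (at t)) (at 0))}"

definition body_velocity ::
  "('g, 'e::real_normed_vector) lie_group_data \<Rightarrow> (real \<Rightarrow> 'g) \<Rightarrow> real \<Rightarrow> 'e" where
  "body_velocity G c t = left_triv G (c t) (velocity (charts G) c t)"

definition second_left_triv ::
  "('g, 'e::real_normed_vector) lie_group_data \<Rightarrow> (real \<Rightarrow> 'g) set \<Rightarrow> 'g \<times> 'e \<times> 'e" where
  "second_left_triv G q =
     (let c = (SOME c. c \<in> q)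
      in (c 0, body_velocity G c 0, vector_derivative (body_velocity G c) (at 0)))"

definition trivialised_lagrangian ::
  "('g::topological_space, 'e::real_normed_vector) lie_group_data \<Rightarrow>
   ((real \<Rightarrow> 'g) set \<Rightarrow> real) \<Rightarrow> 'g \<times> 'e \<times> 'e \<Rightarrow> real" where
  "trivialised_lagrangian G L p =
     L (inv_into (second_tangent_bundle (charts G)) (second_left_triv G) p)"

text \<open>The smooth structure of the second-order tangent bundle is the one transported by the left
  trivialisation.\<close>

definition smooth_lagrangian ::
  "('g::topological_space, 'e::real_normed_vector) lie_group_data \<Rightarrow>
   ((real \<Rightarrow> 'g) set \<Rightarrow> real) \<Rightarrow> bool" where
  "smooth_lagrangian G L \<longleftrightarrow>
     smooth_map (prod_charts (charts G) vector_space_charts) vector_space_charts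
       (trivialised_lagrangian G L)"

definition left_invariant_lagrangian ::
  "('g::topological_space, 'e::real_normed_vector) lie_group_data \<Rightarrow>
   ((real \<Rightarrow> 'g) set \<Rightarrow> real) \<Rightarrow> bool" where
  "left_invariant_lagrangian G L \<longleftrightarrow>
     (\<forall>g h \<xi> u. trivialised_lagrangian G L (g, \<xi>, u) = trivialised_lagrangian G L (h, \<xi>, u))"

definition reduced_lagrangian ::
  "('g::topological_space, 'e::real_normed_vector) lie_group_data \<Rightarrow>
   ((real \<Rightarrow> 'g) set \<Rightarrow> real) \<Rightarrow> 'e \<times> 'e \<Rightarrow> real" where
  "reduced_lagrangian G L = (\<lambda>(\<xi>, u). trivialised_lagrangian G L (\<one>\<^bsub>G\<^esub>, \<xi>, u))"

definition d_xi :: "('e \<times> 'e \<Rightarrow> real) \<Rightarrow> 'e::real_normed_vector \<Rightarrow> 'e \<Rightarrow> ('e \<Rightarrow>\<^sub>L real)" where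
  "d_xi l \<xi> u = Blinfun (frechet_derivative (\<lambda>x. l (x, u)) (at \<xi>))"

definition d_u :: "('e \<times> 'e \<Rightarrow> real) \<Rightarrow> 'e::real_normed_vector \<Rightarrow> 'e \<Rightarrow> ('e \<Rightarrow>\<^sub>L real)" where
  "d_u l \<xi> u = Blinfun (frechet_derivative (\<lambda>w. l (\<xi>, w)) (at u))"

definition d2_u ::
  "('e \<times> 'e \<Rightarrow> real) \<Rightarrow> 'e::real_normed_vector \<Rightarrow> 'e \<Rightarrow> 'e \<Rightarrow> 'e \<Rightarrow> real" where
  "d2_u l \<xi> u v w = blinfun_apply (frechet_derivative (\<lambda>z. d_u l \<xi> z) (at u) v) w"


section \<open>Pontryagin bundle, hyper-regularity and the HOHP flow\<close>

text \<open>Left-trivialised \<open>T\<^sup>*(TG)\<close> with elements \<open>(g, \<xi>, \<mu>, \<nu>)\<close>, and left-trivialised second-order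
  Pontryagin bundle with elements \<open>(g, \<xi>, u, \<mu>, \<nu>)\<close>.\<close>

type_synonym ('g, 'e) cotangent_TG = "'g \<times> 'e \<times> ('e \<Rightarrow>\<^sub>L real) \<times> ('e \<Rightarrow>\<^sub>L real)"
type_synonym ('g, 'e) pontryagin2 = "'g \<times> 'e \<times> 'e \<times> ('e \<Rightarrow>\<^sub>L real) \<times> ('e \<Rightarrow>\<^sub>L real)"

abbreviation cotangent_TG_charts ::
  "('g, 'e::real_normed_vector) lie_group_data \<Rightarrow>
   (('g, 'e) cotangent_TG, ('e, 'e) cotangent_TG) atlas" where
  "cotangent_TG_charts G \<equiv> prod_charts (charts G) vector_space_charts"

abbreviation pontryagin2_charts ::
  "('g, 'e::real_normed_vector) lie_group_data \<Rightarrow>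
   (('g, 'e) pontryagin2, ('e, 'e) pontryagin2) atlas" where
  "pontryagin2_charts G \<equiv> prod_charts (charts G) vector_space_charts"

definition W_c :: "('e \<times> 'e \<Rightarrow> real) \<Rightarrow> ('g, 'e::real_normed_vector) pontryagin2 set" where
  "W_c l = {(g, \<xi>, u, \<mu>, \<nu>). \<nu> = d_u l \<xi> u}"

definition phi :: "('g, 'e::real_normed_vector) pontryagin2 \<Rightarrow> ('g, 'e) cotangent_TG" where
  "phi = (\<lambda>(g, \<xi>, u, \<mu>, \<nu>). (g, \<xi>, \<mu>, \<nu>))"

definition phi_inv ::
  "('e \<times> 'e \<Rightarrow> real) \<Rightarrow> ('g, 'e::real_normed_vector) cotangent_TG \<Rightarrow> ('g, 'e) pontryagin2" where
  "phi_inv l = inv_into (W_c l) phi"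

text \<open>\<open>W_c l\<close> is an embedded submanifold (a graph over \<open>(g, \<xi>, u, \<mu>)\<close>), so smoothness of maps out
  of it (respectively into it) is smoothness of an extension to (respectively as a map into) the
  Pontryagin bundle.\<close>

definition hyper_regular ::
  "('g::topological_space, 'e::real_normed_vector) lie_group_data \<Rightarrow> ('e \<times> 'e \<Rightarrow> real) \<Rightarrow> bool" where
  "hyper_regular G l \<longleftrightarrow>
     (\<forall>\<xi> u v. (\<forall>w. d2_u l \<xi> u v w = 0) \<longrightarrow> v = 0) \<and>
     bij_betw (phi :: ('g, 'e) pontryagin2 \<Rightarrow> _) (W_c l) UNIV \<and>
     smooth_map (pontryagin2_charts G) (cotangent_TG_charts G) phi \<and>
     smooth_map (cotangent_TG_charts G) (pontryagin2_charts G) (phi_inv l)"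

definition hohp_solution ::
  "('g::topological_space, 'e::real_normed_vector) lie_group_data \<Rightarrow> ('e \<times> 'e \<Rightarrow> real) \<Rightarrow> real \<Rightarrow>
   (real \<Rightarrow> ('g, 'e) pontryagin2) \<Rightarrow> bool" where
  "hohp_solution G l a \<gamma> \<longleftrightarrow> (\<exists>g \<xi> u \<mu> \<nu> \<nu>'.
     \<gamma> = (\<lambda>t. (g t, \<xi> t, u t, \<mu> t, \<nu> t)) \<and>
     (\<forall>t\<in>{0..a}.
        (\<mu> has_vector_derivative ad_star G (\<xi> t) (\<mu> t)) (at t within {0..a}) \<and>
        (\<nu> has_vector_derivative \<nu>' t) (at t within {0..a}) \<and>
        \<mu> t = d_xi l (\<xi> t) (u t) - \<nu>' t \<and>
        \<nu> t = d_u l (\<xi> t) (u t) \<and>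
        has_velocity (charts G) g (left_mult G (g t) (\<xi> t)) t {0..a} \<and>
        (\<xi> has_vector_derivative u t) (at t within {0..a})))"

definition hohp_flow ::
  "('g::topological_space, 'e::real_normed_vector) lie_group_data \<Rightarrow> ('e \<times> 'e \<Rightarrow> real) \<Rightarrow> real \<Rightarrow>
   real \<Rightarrow> ('g, 'e) cotangent_TG \<Rightarrow> ('g, 'e) cotangent_TG" where
  "hohp_flow G l a t x =
     (THE y. \<exists>\<gamma>. hohp_solution G l a \<gamma> \<and> \<gamma> 0 = phi_inv l x \<and> y = phi (\<gamma> t))"

text \<open>Tangent vectors \<open>(\<delta>g, \<delta>\<xi>, \<delta>\<mu>, \<delta>\<nu>)\<close> at \<open>(g, \<xi>, \<mu>, \<nu>)\<close> have \<open>\<delta>g\<close> in the tangent space at \<open>g\<close>.\<close>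

definition canonical_symplectic_form ::
  "('g, 'e::real_normed_vector) lie_group_data \<Rightarrow> ('g, 'e) cotangent_TG \<Rightarrow>
   ('e, 'e) cotangent_TG \<Rightarrow> ('e, 'e) cotangent_TG \<Rightarrow> real" where
  "canonical_symplectic_form G =
     (\<lambda>(g, \<xi>, \<mu>, \<nu>) (\<delta>g1, \<delta>\<xi>1, \<delta>\<mu>1, \<delta>\<nu>1) (\<delta>g2, \<delta>\<xi>2, \<delta>\<mu>2, \<delta>\<nu>2).
       let \<eta>1 = left_triv G g \<delta>g1; \<eta>2 = left_triv G g \<delta>g2
       in - blinfun_apply \<delta>\<mu>1 \<eta>2 - blinfun_apply \<delta>\<nu>1 \<delta>\<xi>2
          + blinfun_apply \<delta>\<mu>2 \<eta>1 + blinfun_apply \<delta>\<nu>2 \<delta>\<xi>1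
          + blinfun_apply \<mu> (lie_bracket G \<eta>1 \<eta>2))"

end

theory Submission
  imports Defs
begin

text \<open>
  The HOHP equations are the Hamiltonian equations of \<open>\<omega>\<close> for the energy
  \<open>\<langle>\<mu>, \<xi>\<rangle> + \<langle>\<nu>, u\<rangle> - \<ell>(\<xi>, u)\<close>, with \<open>u\<close> eliminated by the Legendre relation
  \<open>\<nu> = \<delta>\<ell>/\<delta>u\<close>, and a Hamiltonian flow preserves its symplectic form.  Concretely, let
  \<open>(\<eta>, \<delta>\<xi>, \<delta>\<mu>, \<delta>\<nu>)\<close> be the left-trivialised derivative of the flow in some direction.  It solves the
  linearised equations
  \<open>d\<eta>/dt = \<delta>\<xi> - [\<xi>, \<eta>]\<close>, \<open>d\<delta>\<xi>/dt = \<delta>u\<close>,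
  \<open>d\<delta>\<mu>/dt = ad*\<^sub>\<xi> \<delta>\<mu> + ad*\<^sub>\<delta>\<^sub>\<xi> \<mu>\<close>, \<open>d\<delta>\<nu>/dt = \<delta>(\<delta>\<ell>/\<delta>\<xi>) - \<delta>\<mu>\<close>,
  and the time derivative of \<open>\<omega>\<close> on two solutions vanishes: the terms in \<open>\<mu>\<close> cancel by the Jacobi
  identity, those in \<open>\<ell>\<close> by the symmetry of its second derivative (\<open>triv_form_invariant\<close>).

  Three ingredients make this rigorous.

  Differentiability of the flow.  All solutions are assumed to exist, so that only continuous and
  differentiable dependence on parameters are needed.  Both follow from Gronwall's inequality:
  \<open>ode_curve_tube\<close> keeps nearby solutions on the manifold inside a chart, and
  \<open>ode_curve_differentiable\<close> compares differences of solutions with the fundamental solution of the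
  linearised equation, which the Picard series provides (\<open>linear_ode\<close>).

  The equation for \<open>\<eta>\<close>.  In the chart at the identity let \<open>left_field y \<eta>\<close> be the left-invariant vector
  field with value \<open>\<eta>\<close> at the identity.  A variation \<open>\<delta>y\<close> is related to \<open>\<eta>\<close> by \<open>\<delta>y = left_field y \<eta>\<close>, and
  the equation for \<open>\<eta>\<close> is the linearisation of \<open>dy/dt = left_field y \<xi>\<close> combined with the fact that
  the commutator of two left-invariant fields is the field of the bracket
  (\<open>left_field_commutator\<close>), a consequence of associativity.  Differentiating that identity once more
  gives the Jacobi identity.

  Globalisation.  Left translation commutes with the flow and with the trivialisation, so that
  near each time \<open>t0\<close> the trajectory can be moved into the chart at the identity.  There the statement
  at one time implies the statement at slightly later times (\<open>preserved_at_step\<close>), and the compactness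
  of the time interval, in the form of the Bolzano bisection principle, carries it from time \<open>0\<close> to any time.
\<close>

section \<open>Smooth maps\<close>

lemma Ck_on_cong:
  assumes "open S" "\<And>x. x \<in> S \<Longrightarrow> f x = g x" "Ck_on k S f"
  shows "Ck_on k S g"
  using assms(2,3)
proof (induction k arbitrary: f g)
  case 0
  then show ?case by (simp add: continuous_on_eq)
next
  case (Suc k)
  have d: "(g has_derivative frechet_derivative f (at x)) (at x)" if "x \<in> S" for x
    using Suc.prems that frechet_derivative_works
    by (metis Ck_on.simps(2) assms(1) has_derivative_transform_within_open)
  have fr: "frechet_derivative f (at x) = frechet_derivative g (at x)" if "x \<in> S" for x
    using d[OF that] frechet_derivative_at by blast
  show ?case
    unfolding Ck_on.simps
  proof (intro conjI ballI allI)
    fix x assume "x \<in> S" then show "g differentiable at x" using d differentiable_def by blast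
  next
    fix v show "Ck_on k S (\<lambda>x. frechet_derivative g (at x) v)"
      by (rule Suc.IH[of "\<lambda>x. frechet_derivative f (at x) v"]) (use Suc.prems fr in auto)
  qed
qed

lemma Ck_on_SucI:
  assumes "open S" "\<And>x. x \<in> S \<Longrightarrow> (f has_derivative f' x) (at x)"
    and "\<And>v. Ck_on k S (\<lambda>x. f' x v)"
  shows "Ck_on (Suc k) S f"
  unfolding Ck_on.simps
proof (intro conjI ballI allI)
  fix x assume "x \<in> S" then show "f differentiable at x" using assms(2) differentiable_def by blast
next
  fix v show "Ck_on k S (\<lambda>x. frechet_derivative f (at x) v)"
    by (rule Ck_on_cong[OF assms(1) _ assms(3)]) (simp add: frechet_derivative_at[OF assms(2), symmetric])
qed

lemma Ck_on_SucD:
  assumes "Ck_on (Suc k) S f"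
  shows "x \<in> S \<Longrightarrow> (f has_derivative frechet_derivative f (at x)) (at x)"
    and "Ck_on k S (\<lambda>x. frechet_derivative f (at x) v)"
  using assms frechet_derivative_works by auto

lemma Ck_on_linear:
  assumes "open S" "bounded_linear T" "Ck_on k S f"
  shows "Ck_on k S (\<lambda>x. T (f x))"
  using assms(3)
proof (induction k arbitrary: f)
  case 0
  then show ?case by (simp add: bounded_linear.continuous_on[OF assms(2)])
next
  case (Suc k)
  show ?case
    by (rule Ck_on_SucI[OF assms(1)])
      (rule bounded_linear.has_derivative[OF assms(2)] Ck_on_SucD[OF Suc.prems] Suc.IH | assumption)+
qed

lemma Ck_on_add:
  assumes "open S" "Ck_on k S f" "Ck_on k S g"
  shows "Ck_on k S (\<lambda>x. f x + g x)"
  using assms(2,3)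
proof (induction k arbitrary: f g)
  case 0
  then show ?case by (simp add: continuous_on_add)
next
  case (Suc k)
  show ?case
    by (rule Ck_on_SucI[OF assms(1)])
      (rule has_derivative_add Ck_on_SucD[OF Suc.prems(1)] Ck_on_SucD[OF Suc.prems(2)] Suc.IH
        | assumption)+
qed

lemma Ck_on_const: "open S \<Longrightarrow> Ck_on k S (\<lambda>x. c)"
proof (induction k arbitrary: c)
  case (Suc k)
  show ?case by (rule Ck_on_SucI[OF Suc.prems has_derivative_const Suc.IH[OF Suc.prems]])
qed auto

lemma Ck_on_sum:
  assumes "open S" "finite B" "\<And>b. b \<in> B \<Longrightarrow> Ck_on k S (f b)"
  shows "Ck_on k S (\<lambda>x. \<Sum>b\<in>B. f b x)"
  using assms(2,3)
  by (induction B rule: finite_induct) (auto intro: Ck_on_add[OF assms(1)] Ck_on_const[OF assms(1)])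

lemma Ck_on_affine:
  assumes "open S" "bounded_linear H" "\<And>x. x \<in> T \<Longrightarrow> c + H x \<in> S" "open T" "Ck_on k S f"
  shows "Ck_on k T (\<lambda>x. f (c + H x))"
  using assms(5)
proof (induction k arbitrary: f)
  case 0
  then show ?case
    using assms(3) by (auto intro!: continuous_on_compose2[of S f] continuous_intros
        bounded_linear.continuous_on[OF assms(2)])
next
  case (Suc k)
  have h: "((\<lambda>x. c + H x) has_derivative H) (at x)" for x
    using has_derivative_add[OF has_derivative_const bounded_linear_imp_has_derivative[OF assms(2)]]
    by simp
  show ?case
  proof (rule Ck_on_SucI[OF assms(4)])
    fix x assume "x \<in> T"
    then show "((\<lambda>x. f (c + H x)) has_derivative
        (\<lambda>v. frechet_derivative f (at (c + H x)) (H v))) (at x)"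
      using has_derivative_compose[OF h Ck_on_SucD(1)[OF Suc.prems assms(3)]] by simp
  next
    fix v
    show "Ck_on k T (\<lambda>x. frechet_derivative f (at (c + H x)) (H v))"
      by (rule Suc.IH) (use Suc.prems in simp)
  qed
qed

lemma smooth_on_cong:
  "open S \<Longrightarrow> (\<And>x. x \<in> S \<Longrightarrow> f x = g x) \<Longrightarrow> smooth_on S f \<Longrightarrow> smooth_on S g"
  unfolding smooth_on_def by (blast intro: Ck_on_cong)

lemma smooth_on_linear:
  "open S \<Longrightarrow> bounded_linear T \<Longrightarrow> smooth_on S f \<Longrightarrow> smooth_on S (\<lambda>x. T (f x))"
  by (auto simp: smooth_on_def intro: Ck_on_linear)

lemma smooth_on_affine:
  assumes "open S" "bounded_linear H" "\<And>x. x \<in> T \<Longrightarrow> c + H x \<in> S" "open T" "smooth_on S f"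
  shows "smooth_on T (\<lambda>x. f (c + H x))"
  using assms by (auto simp: smooth_on_def intro: Ck_on_affine)

lemma smooth_on_differentiable:
  "smooth_on S f \<Longrightarrow> x \<in> S \<Longrightarrow> (f has_derivative frechet_derivative f (at x)) (at x)"
  by (meson Ck_on_SucD(1) smooth_on_def)

text \<open>On a finite-dimensional domain the total derivative is the finite sum of the partial ones, so
  it is again a smooth map, now into the normed space of linear maps.\<close>

lemma smooth_on_derivative:
  fixes f :: "'a::euclidean_space \<Rightarrow> 'b::real_normed_vector"
  assumes "open S" "smooth_on S f"
  obtains f' :: "'a \<Rightarrow> 'a \<Rightarrow>\<^sub>L 'b"
  where "\<And>x. x \<in> S \<Longrightarrow> (f has_derivative f' x) (at x)" "smooth_on S f'"
proof -
  define T :: "'a \<Rightarrow> 'b \<Rightarrow> 'a \<Rightarrow>\<^sub>L 'b"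
    where "T b u = blinfun_scaleR_left u o\<^sub>L blinfun_inner_left b" for b u
  have T: "T b u v = (v \<bullet> b) *\<^sub>R u" for b u v
    by (simp add: T_def)
  have Tl: "bounded_linear (T b)" for b
    unfolding T_def by (intro bounded_linear_intros)
  define f' where "f' x = (\<Sum>b\<in>Basis. T b (frechet_derivative f (at x) b))" for x
  have "blinfun_apply (f' x) = frechet_derivative f (at x)" if "x \<in> S" for x
  proof
    fix v
    interpret linear "frechet_derivative f (at x)"
      using smooth_on_differentiable[OF assms(2) that]
      by (rule has_derivative_linear)
    have "frechet_derivative f (at x) v =
        frechet_derivative f (at x) (\<Sum>b\<in>Basis. (v \<bullet> b) *\<^sub>R b)"
      by (simp add: euclidean_representation)
    also have "\<dots> = f' x v"
      by (simp add: sum scaleR f'_def blinfun.sum_left T)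
    finally show "f' x v = frechet_derivative f (at x) v" by simp
  qed
  then have 1: "\<And>x. x \<in> S \<Longrightarrow> (f has_derivative f' x) (at x)"
    using smooth_on_differentiable[OF assms(2)] by simp
  have 2: "smooth_on S f'"
    unfolding smooth_on_def f'_def
    by (intro allI Ck_on_sum[OF assms(1)] finite_Basis Ck_on_linear[OF assms(1) Tl]
        Ck_on_SucD(2)[of _ S]) (use assms(2) smooth_on_def in blast)
  show thesis by (rule that[OF 1 2])
qed

text \<open>The derivative as an operator-valued map, which can be differentiated again.\<close>

definition total_derivative ::
  "('a::real_normed_vector \<Rightarrow> 'b::real_normed_vector) \<Rightarrow> 'a \<Rightarrow> ('a \<Rightarrow>\<^sub>L 'b)" where
  "total_derivative f x = Blinfun (frechet_derivative f (at x))"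

lemma smooth_total_derivative:
  fixes f :: "'a::euclidean_space \<Rightarrow> 'b::real_normed_vector"
  assumes "open S" "smooth_on S f"
  shows "x \<in> S \<Longrightarrow> (f has_derivative total_derivative f x) (at x)"
    and "smooth_on S (total_derivative f)"
proof -
  obtain f' :: "'a \<Rightarrow> ('a \<Rightarrow>\<^sub>L 'b)"
    where f': "\<And>x. x \<in> S \<Longrightarrow> (f has_derivative blinfun_apply (f' x)) (at x)" "smooth_on S f'"
    using smooth_on_derivative[OF assms] by metis
  have eq: "f' x = total_derivative f x" if "x \<in> S" for x
    unfolding total_derivative_def frechet_derivative_at[OF f'(1)[OF that], symmetric]
    by (rule blinfun_apply_inverse[symmetric])
  show "x \<in> S \<Longrightarrow> (f has_derivative total_derivative f x) (at x)"
    using f'(1) eq by metis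
  show "smooth_on S (total_derivative f)"
    by (rule smooth_on_cong[OF assms(1) eq f'(2)])
qed

lemma smooth_on_continuous: "smooth_on S f \<Longrightarrow> continuous_on S f"
  unfolding smooth_on_def by (metis Ck_on.simps(1))

text \<open>Both orders of differentiation are limits of the same second difference
  \<open>f (x + hv + hw) - f (x + hv) - f (x + hw) + f x\<close> divided by \<open>h\<^sup>2\<close>.\<close>

lemma second_derivative_symmetric:
  fixes f :: "'a::real_normed_vector \<Rightarrow> 'b::real_normed_vector"
    and f' :: "'a \<Rightarrow> 'a \<Rightarrow>\<^sub>L 'b" and f'' :: "'a \<Rightarrow>\<^sub>L 'a \<Rightarrow>\<^sub>L 'b"
  assumes S: "open S" "x \<in> S"
    and f': "\<And>y. y \<in> S \<Longrightarrow> (f has_derivative f' y) (at y)"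
    and f'': "(f' has_derivative f'') (at x)"
  shows "f'' v w = f'' w v"
proof -
  define \<Delta> where "\<Delta> v w h = f (x + h *\<^sub>R v + h *\<^sub>R w) - f (x + h *\<^sub>R v) - f (x + h *\<^sub>R w) + f x"
    for v w and h :: real
  have main: "\<forall>\<^sub>F h in at_right 0. norm (\<Delta> v w h - (h^2) *\<^sub>R f'' w v) \<le> e * h^2"
    if "e > 0" for e v w
  proof -
    define C where "C = (2 * norm v + norm w) * norm v + norm v * norm v + 1"
    have C: "C > 0" unfolding C_def by (smt (verit) mult_nonneg_nonneg norm_ge_zero)
    obtain d1 where d1: "d1 > 0" "ball x d1 \<subseteq> S"
      using S open_contains_ball by blast
    obtain d2 where d2: "d2 > 0"
      "\<And>z. norm (z - x) < d2 \<Longrightarrow> norm (f' z - f' x - f'' (z - x)) \<le> (e / C) * norm (z - x)"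
      using f''[unfolded has_derivative_at_alt] \<open>e > 0\<close> C by (meson divide_pos_pos)
    define d where "d = min d1 d2 / (norm v + norm w + 1)"
    have d: "d > 0" using d1 d2 by (simp add: d_def add_nonneg_pos)
    have "norm (\<Delta> v w h - (h^2) *\<^sub>R f'' w v) \<le> e * h^2" if h: "0 < h" "h < d" for h
    proof -
      have small: "norm (s *\<^sub>R v + r *\<^sub>R w) < min d1 d2"
        if "0 \<le> s" "s \<le> h" "0 \<le> r" "r \<le> h" for s r
      proof -
        have "norm (s *\<^sub>R v + r *\<^sub>R w) \<le> s * norm v + r * norm w"
          using norm_triangle_ineq[of "s *\<^sub>R v" "r *\<^sub>R w"] that by simp
        also have "\<dots> \<le> h * norm v + h * norm w"
          using that by (intro add_mono mult_right_mono) auto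
        also have "\<dots> \<le> h * (norm v + norm w + 1)"
          using h by (simp add: algebra_simps)
        also have "\<dots> < d * (norm v + norm w + 1)"
          using h mult_strict_right_mono[of h d "norm v + norm w + 1"]
          by (smt (verit) norm_ge_zero)
        also have "\<dots> = min d1 d2"
          by (simp add: d_def add_nonneg_eq_0_iff)
        finally show ?thesis .
      qed
      define \<phi> where "\<phi> s = f (x + s *\<^sub>R v + h *\<^sub>R w) - f (x + s *\<^sub>R v) - (s * h) *\<^sub>R f'' w v" for s
      have inS: "x + s *\<^sub>R v + r *\<^sub>R w \<in> S" if "0 \<le> s" "s \<le> h" "0 \<le> r" "r \<le> h" for s r
      proof -
        have "dist x (x + (s *\<^sub>R v + r *\<^sub>R w)) < d1"
          using small[OF that] by (metis add_diff_cancel_left' dist_commute dist_norm min_less_iff_conj)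
        then show ?thesis using d1(2) by (metis add.assoc mem_ball subsetD)
      qed
      have der: "(\<phi> has_derivative
          (\<lambda>k. k *\<^sub>R (f' (x + s *\<^sub>R v + h *\<^sub>R w) v - f' (x + s *\<^sub>R v) v - h *\<^sub>R f'' w v)))
          (at s within {0..h})" if "s \<in> {0..h}" for s
      proof -
        have a: "(f has_derivative f' (x + s *\<^sub>R v + h *\<^sub>R w)) (at (x + s *\<^sub>R v + h *\<^sub>R w))"
          using f' inS[of s h] that h by auto
        have b: "(f has_derivative f' (x + s *\<^sub>R v)) (at (x + s *\<^sub>R v))"
          using f' inS[of s 0] that h by auto
        have a': "((\<lambda>s. f (x + s *\<^sub>R v + h *\<^sub>R w)) has_derivative
            (\<lambda>k. f' (x + s *\<^sub>R v + h *\<^sub>R w) (k *\<^sub>R v))) (at s within {0..h})"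
          by (rule has_derivative_compose[where g = f and f = "\<lambda>s. x + s *\<^sub>R v + h *\<^sub>R w"
                and f' = "\<lambda>k. k *\<^sub>R v", OF _ a]) (auto intro!: derivative_eq_intros)
        have b': "((\<lambda>s. f (x + s *\<^sub>R v)) has_derivative (\<lambda>k. f' (x + s *\<^sub>R v) (k *\<^sub>R v)))
            (at s within {0..h})"
          by (rule has_derivative_compose[where g = f and f = "\<lambda>s. x + s *\<^sub>R v"
                and f' = "\<lambda>k. k *\<^sub>R v", OF _ b]) (auto intro!: derivative_eq_intros)
        show ?thesis
          unfolding \<phi>_def
          by (rule derivative_eq_intros a' b' refl)+ (simp add: algebra_simps blinfun.bilinear_simps)
      qed
      have bd: "norm (f' (x + s *\<^sub>R v + h *\<^sub>R w) v - f' (x + s *\<^sub>R v) v - h *\<^sub>R f'' w v) \<le> e * h"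
        if "s \<in> {0..h}" for s
      proof -
        let ?z1 = "x + s *\<^sub>R v + h *\<^sub>R w" and ?z2 = "x + s *\<^sub>R v"
        have s: "0 \<le> s" "s \<le> h" using that by auto
        have n1: "norm (f' ?z1 - f' x - f'' (?z1 - x)) \<le> (e / C) * (h * (norm v + norm w))"
        proof -
          have "norm (?z1 - x) \<le> h * (norm v + norm w)"
            using norm_triangle_ineq[of "s *\<^sub>R v" "h *\<^sub>R w"] s h mult_right_mono[of s h "norm v"]
            by (simp add: algebra_simps)
          moreover have "norm (?z1 - x) < d2" using small[of s h] s h by (simp add: algebra_simps)
          ultimately show ?thesis
            using d2(2)[of ?z1] \<open>e > 0\<close> C
            by (meson divide_pos_pos less_imp_le mult_left_mono order_trans)
        qed
        have n2: "norm (f' ?z2 - f' x - f'' (?z2 - x)) \<le> (e / C) * (h * norm v)"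
        proof -
          have "norm (?z2 - x) \<le> h * norm v"
            using s h mult_right_mono[of s h "norm v"] by simp
          moreover have "norm (?z2 - x) < d2" using small[of s 0] s h by simp
          ultimately show ?thesis
            using d2(2)[of ?z2] \<open>e > 0\<close> C
            by (meson divide_pos_pos less_imp_le mult_left_mono order_trans)
        qed
        have "f' ?z1 v - f' ?z2 v - h *\<^sub>R f'' w v =
            (f' ?z1 - f' x - f'' (?z1 - x)) v - (f' ?z2 - f' x - f'' (?z2 - x)) v"
          by (simp add: blinfun.bilinear_simps algebra_simps)
        also have "norm \<dots> \<le> norm (f' ?z1 - f' x - f'' (?z1 - x)) * norm v +
            norm (f' ?z2 - f' x - f'' (?z2 - x)) * norm v"
          using norm_triangle_ineq4 norm_blinfun by (smt (verit, best))
        also have "\<dots> \<le> (e / C) * (h * (norm v + norm w)) * norm v + (e / C) * (h * norm v) * norm v"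
          using n1 n2 by (intro add_mono mult_right_mono) auto
        also have "\<dots> = (e / C) * h * ((norm v + norm w) * norm v + norm v * norm v)"
          by (simp add: algebra_simps)
        also have "\<dots> \<le> (e / C) * h * C"
          using \<open>e > 0\<close> C h by (intro mult_left_mono) (auto simp: C_def algebra_simps)
        also have "\<dots> = e * h" using C by simp
        finally show ?thesis .
      qed
      have "norm (\<phi> h - \<phi> 0) \<le> e * h * norm (h - 0)"
      proof (rule differentiable_bound[of "{0..h}" \<phi>, OF _ der])
        show "onorm (\<lambda>k. k *\<^sub>R (f' (x + s *\<^sub>R v + h *\<^sub>R w) v - f' (x + s *\<^sub>R v) v - h *\<^sub>R f'' w v)) \<le> e * h"
          if "s \<in> {0..h}" for s
          using bd[OF that] h \<open>e > 0\<close>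
          by (intro onorm_bound) (auto simp: mult.commute mult_left_mono)
      qed (use h in auto)
      moreover have "\<phi> h - \<phi> 0 = \<Delta> v w h - (h^2) *\<^sub>R f'' w v"
        by (simp add: \<phi>_def \<Delta>_def power2_eq_square algebra_simps)
      ultimately show ?thesis using h by (simp add: power2_eq_square)
    qed
    then show ?thesis
      using d eventually_at_right_less eventually_at_right by blast
  qed
  have "norm (f'' v w - f'' w v) \<le> 0 + e" if "e > 0" for e
  proof -
    have "\<forall>\<^sub>F h in at_right (0::real). norm (\<Delta> v w h - (h^2) *\<^sub>R f'' w v) \<le> (e/2) * h^2 \<and>
        norm (\<Delta> w v h - (h^2) *\<^sub>R f'' v w) \<le> (e/2) * h^2 \<and> h > 0"
      using main[of "e/2"] that by (intro eventually_conj) (auto simp: eventually_at_right_less)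
    then obtain h where h: "norm (\<Delta> v w h - (h^2) *\<^sub>R f'' w v) \<le> (e/2) * h^2"
      "norm (\<Delta> w v h - (h^2) *\<^sub>R f'' v w) \<le> (e/2) * h^2" "h > 0"
      using eventually_happens'[OF trivial_limit_at_right_real] by blast
    have "\<Delta> w v h = \<Delta> v w h" by (simp add: \<Delta>_def algebra_simps)
    then have eq: "(h^2) *\<^sub>R (f'' v w - f'' w v) =
        (\<Delta> v w h - (h^2) *\<^sub>R f'' w v) - (\<Delta> w v h - (h^2) *\<^sub>R f'' v w)"
      by (simp add: algebra_simps)
    have "norm ((h^2) *\<^sub>R (f'' v w - f'' w v)) \<le> (e/2) * h^2 + (e/2) * h^2"
      using norm_triangle_ineq4[of "\<Delta> v w h - (h^2) *\<^sub>R f'' w v" "\<Delta> w v h - (h^2) *\<^sub>R f'' v w"] h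
      unfolding eq by linarith
    then have "h^2 * norm (f'' v w - f'' w v) \<le> h^2 * e" by (simp add: mult.commute)
    then show ?thesis using h(3) by simp
  qed
  then have "norm (f'' v w - f'' w v) \<le> 0" by (rule field_le_epsilon)
  then show ?thesis by simp
qed

section \<open>Differentiable dependence of solutions on parameters\<close>

text \<open>Squaring the norm keeps everything differentiable at zeros of \<open>u\<close>; the mixed term is absorbed
  by \<open>2b\<bar>u\<bar> \<le> b\<^sup>2 + \<bar>u\<bar>\<^sup>2\<close>.\<close>

lemma gronwall:
  fixes u :: "real \<Rightarrow> 'a::real_inner"
  assumes "s \<le> t" "K \<ge> 0" "b \<ge> 0"
    and u: "\<And>\<tau>. \<tau> \<in> {s..t} \<Longrightarrow> (u has_vector_derivative u' \<tau>) (at \<tau> within {s..t})"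
    and bd: "\<And>\<tau>. \<tau> \<in> {s..t} \<Longrightarrow> norm (u' \<tau>) \<le> K * norm (u \<tau>) + b"
  shows "(norm (u t))\<^sup>2 \<le> ((norm (u s))\<^sup>2 + b\<^sup>2) * exp ((2 * K + 1) * (t - s))"
proof -
  define h where "h \<tau> = (u \<tau> \<bullet> u \<tau> + b\<^sup>2) * exp (- (2 * K + 1) * (\<tau> - s))" for \<tau>
  have "h t \<le> h s"
  proof (rule DERIV_nonpos_imp_decreasing_open[OF assms(1)])
    fix \<tau> assume \<tau>: "s < \<tau>" "\<tau> < t"
    then have "(u has_vector_derivative u' \<tau>) (at \<tau>)"
      using u[of \<tau>] at_within_Icc_at[OF \<tau>] by simp
    then have d: "(u has_derivative (\<lambda>x. x *\<^sub>R u' \<tau>)) (at \<tau>)"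
      by (simp add: has_vector_derivative_def)
    have "(h has_real_derivative (2 * (u \<tau> \<bullet> u' \<tau>) - (2 * K + 1) * (u \<tau> \<bullet> u \<tau> + b\<^sup>2)) *
        exp (- (2 * K + 1) * (\<tau> - s))) (at \<tau>)"
      unfolding has_field_derivative_def h_def
      by (rule derivative_eq_intros d refl)+ (simp add: fun_eq_iff algebra_simps inner_commute)
    moreover have "2 * (u \<tau> \<bullet> u' \<tau>) - (2 * K + 1) * (u \<tau> \<bullet> u \<tau> + b\<^sup>2) \<le> 0"
    proof -
      have "u \<tau> \<bullet> u' \<tau> \<le> norm (u \<tau>) * norm (u' \<tau>)" by (rule norm_cauchy_schwarz)
      also have "\<dots> \<le> norm (u \<tau>) * (K * norm (u \<tau>) + b)"
        using bd[of \<tau>] \<tau> by (intro mult_left_mono) auto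
      finally have "2 * (u \<tau> \<bullet> u' \<tau>) \<le> 2 * K * (norm (u \<tau>))\<^sup>2 + 2 * b * norm (u \<tau>)"
        by (simp add: algebra_simps power2_eq_square)
      moreover have "2 * b * norm (u \<tau>) \<le> b\<^sup>2 + (norm (u \<tau>))\<^sup>2"
        using sum_squares_bound[of b "norm (u \<tau>)"] by simp
      moreover have "0 \<le> K * b\<^sup>2" using assms by simp
      ultimately show ?thesis by (simp add: algebra_simps power2_norm_eq_inner)
    qed
    ultimately show "\<exists>y. (h has_real_derivative y) (at \<tau>) \<and> y \<le> 0"
      by (meson exp_ge_zero mult_nonpos_nonneg)
  next
    have "continuous_on {s..t} u"
      using u by (meson has_vector_derivative_continuous continuous_on_eq_continuous_within)
    then show "continuous_on {s..t} h" unfolding h_def by (intro continuous_intros)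
  qed
  then have "h t * exp ((2 * K + 1) * (t - s)) \<le> h s * exp ((2 * K + 1) * (t - s))"
    by (intro mult_right_mono) auto
  moreover have "exp (- (2 * K + 1) * (t - s)) * exp ((2 * K + 1) * (t - s)) = 1"
    by (simp add: algebra_simps flip: exp_add)
  then have "h t * exp ((2 * K + 1) * (t - s)) = u t \<bullet> u t + b\<^sup>2"
    by (simp add: h_def mult.assoc)
  moreover have "h s = u s \<bullet> u s + b\<^sup>2" by (simp add: h_def)
  ultimately have "u t \<bullet> u t + b\<^sup>2 \<le> (u s \<bullet> u s + b\<^sup>2) * exp ((2 * K + 1) * (t - s))"
    by metis
  then show ?thesis
    unfolding power2_norm_eq_inner by (smt (verit) zero_le_power2)
qed

lemma gronwall_norm:
  fixes u :: "real \<Rightarrow> 'a::real_inner"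
  assumes "s \<le> t" "t \<le> t1" "K \<ge> 0" "b \<ge> 0"
    and "\<And>\<tau>. \<tau> \<in> {s..t} \<Longrightarrow> (u has_vector_derivative u' \<tau>) (at \<tau> within {s..t})"
    and "\<And>\<tau>. \<tau> \<in> {s..t} \<Longrightarrow> norm (u' \<tau>) \<le> K * norm (u \<tau>) + b"
  shows "norm (u t) \<le> (norm (u s) + b) * exp ((K + 1/2) * (t1 - s))"
proof (rule power2_le_imp_le)
  have "(norm (u t))\<^sup>2 \<le> ((norm (u s))\<^sup>2 + b\<^sup>2) * exp ((2 * K + 1) * (t - s))"
    by (rule gronwall[OF assms(1,3-)])
  also have "\<dots> \<le> (norm (u s) + b)\<^sup>2 * exp ((2 * K + 1) * (t1 - s))"
    using assms by (intro mult_mono) (auto simp: power2_sum mult_left_mono)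
  also have "exp ((2 * K + 1) * (t1 - s)) = (exp ((K + 1/2) * (t1 - s)))\<^sup>2"
    by (simp add: power2_eq_square algebra_simps flip: exp_add)
  finally show "(norm (u t))\<^sup>2 \<le> ((norm (u s) + b) * exp ((K + 1/2) * (t1 - s)))\<^sup>2"
    by (simp add: power_mult_distrib)
qed (use assms in auto)

text \<open>The Picard iterates \<open>P n\<close> are bounded by \<open>(K(\<tau> - s))\<^sup>n/n!\<close>, so that their series converges
  uniformly and may be differentiated term by term.\<close>

lemma linear_ode:
  fixes A :: "real \<Rightarrow> 'z::banach \<Rightarrow>\<^sub>L 'z"
  assumes "s \<le> t" and A: "continuous_on {s..t} A"
  obtains M :: "real \<Rightarrow> 'z \<Rightarrow>\<^sub>L 'z" where "M s = id_blinfun"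
    "\<And>\<tau>. \<tau> \<in> {s..t} \<Longrightarrow> (M has_vector_derivative (A \<tau> o\<^sub>L M \<tau>)) (at \<tau> within {s..t})"
proof -
  define P :: "nat \<Rightarrow> real \<Rightarrow> 'z \<Rightarrow>\<^sub>L 'z"
    where "P = rec_nat (\<lambda>\<tau>. id_blinfun) (\<lambda>n p \<tau>. integral {s..\<tau>} (\<lambda>\<sigma>. A \<sigma> o\<^sub>L p \<sigma>))"
  have P0: "P 0 = (\<lambda>\<tau>. id_blinfun)"
    and PSuc: "\<And>n. P (Suc n) = (\<lambda>\<tau>. integral {s..\<tau>} (\<lambda>\<sigma>. A \<sigma> o\<^sub>L P n \<sigma>))"
    by (simp_all add: P_def)
  have Ps: "P (Suc n) s = 0" for n
    unfolding PSuc by (rule integral_refl[of s, unfolded box_real])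
  have dc: "continuous_on {s..t} (P n) \<and>
      (\<forall>\<tau>\<in>{s..t}. (P (Suc n) has_vector_derivative (A \<tau> o\<^sub>L P n \<tau>)) (at \<tau> within {s..t}))" for n
  proof (induction n)
    case 0
    show ?case
      unfolding PSuc P0
      by (intro conjI ballI continuous_intros integral_has_vector_derivative A) auto
  next
    case (Suc n)
    have "continuous_on {s..t} (P (Suc n))"
      using Suc by (meson has_vector_derivative_continuous continuous_on_eq_continuous_within)
    then show ?case
      unfolding PSuc[of "Suc n"]
      by (intro conjI ballI integral_has_vector_derivative
          bounded_bilinear.continuous_on[OF bounded_bilinear_blinfun_compose] A) auto
  qed
  obtain K where K0: "K > 0" "\<forall>a\<in>A ` {s..t}. norm a \<le> K"
    using compact_imp_bounded[OF compact_continuous_image[OF A compact_Icc]]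
    unfolding bounded_pos by blast
  then have K: "\<And>\<tau>. \<tau> \<in> {s..t} \<Longrightarrow> norm (A \<tau>) \<le> K" "K > 0" by blast+
  have bd: "norm (P n \<tau>) \<le> (K * (\<tau> - s)) ^ n / fact n" if "\<tau> \<in> {s..t}" for n \<tau>
    using that
  proof (induction n arbitrary: \<tau>)
    case 0
    then show ?case by (simp add: P0 norm_blinfun_id_le)
  next
    case (Suc n)
    show ?case
    proof (cases "\<tau> = s")
      case True
      then show ?thesis by (simp add: Ps)
    next
      case False
      then have st: "s < \<tau>" using Suc by auto
      have ap: "at x within {s..t} = at x" if "s < x" "x < \<tau>" for x
        using that Suc.prems by (intro at_within_Icc_at) auto
      have "norm (P (Suc n) \<tau> - P (Suc n) s) \<le>
          (K * (\<tau> - s)) ^ Suc n / fact (Suc n) - (K * (s - s)) ^ Suc n / fact (Suc n)"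
      proof (rule differentiable_bound_general[OF st])
        show "continuous_on {s..\<tau>} (P (Suc n))"
          using dc[of "Suc n"] Suc.prems continuous_on_subset[of "{s..t}" "P (Suc n)" "{s..\<tau>}"]
          by simp
        show "continuous_on {s..\<tau>} (\<lambda>x. (K * (x - s)) ^ Suc n / fact (Suc n))"
          by (intro continuous_intros) auto
        fix x assume x: "s < x" "x < \<tau>"
        then have xm: "x \<in> {s..t}" using Suc.prems by auto
        show "(P (Suc n) has_vector_derivative (A x o\<^sub>L P n x)) (at x)"
          using dc[of n] ap[OF x] xm by metis
        show "((\<lambda>x. (K * (x - s)) ^ Suc n / fact (Suc n)) has_vector_derivative
            K * ((K * (x - s)) ^ n / fact n)) (at x)"
          unfolding has_real_derivative_iff_has_vector_derivative[symmetric]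
          by (rule derivative_eq_intros refl | simp)+
        have "norm (A x o\<^sub>L P n x) \<le> norm (A x) * norm (P n x)" by (rule norm_blinfun_compose)
        also have "\<dots> \<le> K * ((K * (x - s)) ^ n / fact n)"
          using K xm Suc.IH[OF xm] by (intro mult_mono) auto
        finally show "norm (A x o\<^sub>L P n x) \<le> K * ((K * (x - s)) ^ n / fact n)" .
      qed
      then show ?thesis by (simp add: Ps)
    qed
  qed
  define S where "S \<tau> = (\<Sum>n. P n \<tau>)" for \<tau>
  have bd2: "norm (P n \<tau>) \<le> (K * (t - s)) ^ n / fact n" if "\<tau> \<in> {s..t}" for n \<tau>
    using bd[OF that, of n] K that
    by (smt (verit, best) atLeastAtMost_iff divide_right_mono fact_ge_zero mult_left_mono
        mult_nonneg_nonneg power_mono)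
  have summ: "summable (\<lambda>n. (K * (t - s)) ^ n / fact n)"
    using summable_exp[of "K * (t - s)"] by (simp add: field_simps)
  have unif: "uniform_limit {s..t} (\<lambda>n \<tau>. \<Sum>i<n. P i \<tau>) S sequentially"
    unfolding S_def by (rule Weierstrass_m_test[OF bd2 summ])
  have sums: "(\<lambda>n. P n \<tau>) sums S \<tau>" if "\<tau> \<in> {s..t}" for \<tau>
    unfolding S_def
    by (intro summable_sums summable_comparison_test[OF _ summ]) (use bd2[OF that] in auto)
  have sums': "(\<lambda>n. P (Suc n) \<tau>) sums (S \<tau> - id_blinfun)" if "\<tau> \<in> {s..t}" for \<tau>
    using sums[OF that] by (subst sums_Suc_iff) (simp add: P0)
  have "\<exists>g. \<forall>\<tau>\<in>{s..t}. (\<lambda>n. P (Suc n) \<tau>) sums g \<tau> \<and>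
      (g has_derivative (\<lambda>h. h *\<^sub>R (A \<tau> o\<^sub>L S \<tau>))) (at \<tau> within {s..t})"
  proof (rule has_derivative_series[where x = s and l = "S s - id_blinfun"])
    show "(\<lambda>n. P (Suc n) s) sums (S s - id_blinfun)" using sums' assms(1) by simp
    show "(P (Suc n) has_derivative (\<lambda>h. h *\<^sub>R (A \<tau> o\<^sub>L P n \<tau>))) (at \<tau> within {s..t})"
      if "\<tau> \<in> {s..t}" for n \<tau>
      using dc[of n] that by (simp add: has_vector_derivative_def)
    fix e :: real assume "e > 0"
    then have "\<forall>\<^sub>F n in sequentially. \<forall>\<tau>\<in>{s..t}. norm ((\<Sum>i<n. P i \<tau>) - S \<tau>) < e / K"
      using unif K(2) unfolding uniform_limit_iff dist_norm by simp
    then show "\<forall>\<^sub>F n in sequentially. \<forall>\<tau>\<in>{s..t}. \<forall>h.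
        norm ((\<Sum>i<n. h *\<^sub>R (A \<tau> o\<^sub>L P i \<tau>)) - h *\<^sub>R (A \<tau> o\<^sub>L S \<tau>)) \<le> e * norm h"
    proof (rule eventually_mono, intro ballI allI)
      fix n \<tau> h
      assume n: "\<forall>\<tau>\<in>{s..t}. norm ((\<Sum>i<n. P i \<tau>) - S \<tau>) < e / K" and \<tau>: "\<tau> \<in> {s..t}"
      have "(\<Sum>i<n. h *\<^sub>R (A \<tau> o\<^sub>L P i \<tau>)) - h *\<^sub>R (A \<tau> o\<^sub>L S \<tau>) =
          h *\<^sub>R (A \<tau> o\<^sub>L ((\<Sum>i<n. P i \<tau>) - S \<tau>))"
        by (simp add: bounded_bilinear.sum_right[OF bounded_bilinear_blinfun_compose]
            bounded_bilinear.diff_right[OF bounded_bilinear_blinfun_compose]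
            scaleR_sum_right scaleR_diff_right)
      also have "norm \<dots> \<le> \<bar>h\<bar> * (norm (A \<tau>) * norm ((\<Sum>i<n. P i \<tau>) - S \<tau>))"
        by (simp add: mult_left_mono norm_blinfun_compose)
      also have "\<dots> \<le> \<bar>h\<bar> * (K * (e / K))"
        using n \<tau> K by (intro mult_left_mono mult_mono) (auto intro: less_imp_le)
      finally show "norm ((\<Sum>i<n. h *\<^sub>R (A \<tau> o\<^sub>L P i \<tau>)) - h *\<^sub>R (A \<tau> o\<^sub>L S \<tau>)) \<le> e * norm h"
        using K(2) by (simp add: mult.commute)
    qed
  qed (use assms(1) in simp_all)
  then obtain g where g: "\<And>\<tau>. \<tau> \<in> {s..t} \<Longrightarrow> (\<lambda>n. P (Suc n) \<tau>) sums g \<tau>"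
    "\<And>\<tau>. \<tau> \<in> {s..t} \<Longrightarrow> (g has_derivative (\<lambda>h. h *\<^sub>R (A \<tau> o\<^sub>L S \<tau>))) (at \<tau> within {s..t})"
    by blast
  have gS: "S \<tau> = id_blinfun + g \<tau>" if "\<tau> \<in> {s..t}" for \<tau>
    using sums_unique2[OF g(1)[OF that] sums'[OF that]] by simp
  show thesis
  proof (rule that[of "\<lambda>\<tau>. id_blinfun + g \<tau>"])
    have "(\<lambda>n. P (Suc n) s) sums 0" unfolding Ps by (rule sums_zero)
    moreover have "(\<lambda>n. P (Suc n) s) sums g s" using g(1)[of s] assms(1) by simp
    ultimately have "g s = 0" using sums_unique2 by blast
    then show "id_blinfun + g s = id_blinfun" by simp
    show "((\<lambda>\<tau>. id_blinfun + g \<tau>) has_vector_derivative (A \<tau> o\<^sub>L (id_blinfun + g \<tau>))) (at \<tau> within {s..t})"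
      if "\<tau> \<in> {s..t}" for \<tau>
      using has_derivative_add[OF has_derivative_const g(2)[OF that]]
      unfolding has_vector_derivative_def gS[OF that] add_0_left .
  qed
qed

text \<open>Continuity is uniform along \<open>C\<close> even towards points outside \<open>C\<close>: take a Lebesgue number of a cover
  by sets on which \<open>f\<close> oscillates by less than \<open>e\<close>.\<close>

lemma continuous_near_compact:
  fixes f :: "'a::metric_space \<Rightarrow> 'b::metric_space"
  assumes "compact C" "open X" "C \<subseteq> X" "continuous_on X f" "e > 0"
  obtains d where "d > 0" "\<And>x y. x \<in> C \<Longrightarrow> dist x y < d \<Longrightarrow> y \<in> X \<and> dist (f y) (f x) < e"
proof -
  define T where "T = {b. open b \<and> b \<subseteq> X \<and> (\<forall>y\<in>b. \<forall>z\<in>b. dist (f y) (f z) < e)}"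
  have "x \<in> \<Union>T" if "x \<in> C" for x
  proof -
    have "isCont f x" using assms(2-4) that by (auto simp: continuous_on_eq_continuous_at)
    then have "\<forall>\<^sub>F y in nhds x. dist (f y) (f x) < e / 2"
      using \<open>e > 0\<close> unfolding isCont_def tendsto_at_iff_tendsto_nhds
      by (auto dest: tendstoD[of _ _ _ "e / 2"])
    moreover have "\<forall>\<^sub>F y in nhds x. y \<in> X"
      using assms that by (intro eventually_nhds_in_open) auto
    ultimately have "\<forall>\<^sub>F y in nhds x. dist (f y) (f x) < e / 2 \<and> y \<in> X"
      by (rule eventually_conj)
    then obtain b where b: "open b" "x \<in> b" "\<And>y. y \<in> b \<Longrightarrow> dist (f y) (f x) < e / 2 \<and> y \<in> X"
      unfolding eventually_nhds by blast
    have "dist (f y) (f z) < e" if "y \<in> b" "z \<in> b" for y z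
      using dist_triangle_half_l[of "f y" "f x" e "f z"] b(3)[OF that(1)] b(3)[OF that(2)] by simp
    moreover have "b \<subseteq> X" using b(3) by blast
    ultimately have "b \<in> T" unfolding T_def mem_Collect_eq using b(1) by (intro conjI ballI)
    with b(2) show ?thesis by (rule UnionI[rotated])
  qed
  then have cover: "C \<subseteq> \<Union>T" by (rule subsetI)
  have op: "\<And>b. b \<in> T \<Longrightarrow> open b" by (simp add: T_def)
  obtain d where d: "d > 0" "\<And>x. x \<in> C \<Longrightarrow> \<exists>b\<in>T. ball x d \<subseteq> b"
    by (rule Heine_Borel_lemma[OF assms(1) cover]) (assumption | rule op that)+
  show thesis
  proof (rule that[OF d(1)])
    fix x y assume xy: "x \<in> C" "dist x y < d"
    then obtain b where b: "b \<in> T" "ball x d \<subseteq> b" using d by blast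
    have "x \<in> b" "y \<in> b" using b(2) xy d(1) by auto
    then show "y \<in> X \<and> dist (f y) (f x) < e" using b(1) by (auto simp: T_def)
  qed
qed

text \<open>Nothing but continuity is required while the curve is outside the domain \<open>U\<close> of the chart \<open>\<kappa>\<close>; for
  curves starting near a given one that stays in \<open>U\<close>, remaining in \<open>U\<close> is a conclusion.\<close>

definition ode_curve ::
  "'m::topological_space set \<Rightarrow> ('m \<Rightarrow> 'z::real_normed_vector) \<Rightarrow> ('z \<Rightarrow> 'z) \<Rightarrow> real \<Rightarrow> real \<Rightarrow>
   (real \<Rightarrow> 'm) \<Rightarrow> bool" where
  "ode_curve U \<kappa> f s t c \<longleftrightarrow> continuous_on {s..t} c \<and>
     (\<forall>\<tau>\<in>{s..t}. c \<tau> \<in> U \<longrightarrow>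
        ((\<lambda>\<sigma>. \<kappa> (c \<sigma>)) has_vector_derivative f (\<kappa> (c \<tau>))) (at \<tau> within {s..t}))"

lemma ode_curve_subset:
  assumes "ode_curve U \<kappa> f s t c" "s \<le> s'" "t' \<le> t"
  shows "ode_curve U \<kappa> f s' t' c"
proof -
  have "{s'..t'} \<subseteq> {s..t}" using assms by auto
  with assms(1) show ?thesis
    unfolding ode_curve_def
    by (auto intro: continuous_on_subset has_vector_derivative_within_subset[of _ _ _ "{s..t}"])
qed

text \<open>Used with \<open>A = 0\<close> for a Lipschitz bound and with \<open>A = f' x\<close> for the error of linearisation.\<close>

lemma C1_lipschitz_near:
  fixes f' :: "'z::real_normed_vector \<Rightarrow> 'z \<Rightarrow>\<^sub>L 'w::real_normed_vector"
  assumes f: "\<And>z. z \<in> ball x r \<Longrightarrow> (f has_derivative f' z) (at z)"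
    and b: "\<And>z. z \<in> ball x r \<Longrightarrow> norm (f' z - A) \<le> e"
    and z: "z \<in> ball x r"
  shows "norm (f z - f x - A (z - x)) \<le> e * norm (z - x)"
proof -
  have "norm ((f z - A z) - (f x - A x)) \<le> e * norm (z - x)"
  proof (rule differentiable_bound[of "ball x r" "\<lambda>z. f z - A z" "\<lambda>z v. (f' z - A) v"])
    show "((\<lambda>z. f z - A z) has_derivative (\<lambda>v. (f' y - A) v)) (at y within ball x r)"
      if "y \<in> ball x r" for y
      using has_derivative_diff[OF f[OF that] bounded_linear_imp_has_derivative[OF blinfun.bounded_linear_right]]
      by (simp add: blinfun.diff_left has_derivative_at_withinI)
    show "onorm (\<lambda>v. (f' y - A) v) \<le> e" if "y \<in> ball x r" for y
      using b[OF that] by (simp add: norm_blinfun.rep_eq)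
    show "x \<in> ball x r" using z by (auto intro: le_less_trans[OF zero_le_dist])
  qed (use z in auto)
  then show ?thesis by (simp add: blinfun.diff_right algebra_simps)
qed

text \<open>Leaving the chart is excluded by looking at the first bad time: up to that time Gronwall's
  estimate keeps the coordinates in a compact tube, whose preimage in the Hausdorff space \<open>'m\<close> is
  closed, so that the estimate persists at the bad time itself.\<close>

lemma ode_curve_tube:
  fixes \<kappa> :: "'m::t2_space \<Rightarrow> 'z::euclidean_space" and f' :: "'z \<Rightarrow> 'z \<Rightarrow>\<^sub>L 'z"
  assumes chart: "open U" "homeomorphism U X \<kappa> \<kappa>i" "open X"
    and f: "\<And>z. z \<in> X \<Longrightarrow> (f has_derivative f' z) (at z)" "continuous_on X f'"
    and st: "s \<le> t" and c0: "ode_curve U \<kappa> f s t c0" "c0 ` {s..t} \<subseteq> U"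
  obtains B d where "B > 0" "d > 0"
    "\<And>c \<tau>. ode_curve U \<kappa> f s t c \<Longrightarrow> c s \<in> U \<Longrightarrow> norm (\<kappa> (c s) - \<kappa> (c0 s)) < d \<Longrightarrow> \<tau> \<in> {s..t} \<Longrightarrow>
       c \<tau> \<in> U \<and> norm (\<kappa> (c \<tau>) - \<kappa> (c0 \<tau>)) \<le> B * norm (\<kappa> (c s) - \<kappa> (c0 s))"
proof -
  have \<kappa>cont: "continuous_on U \<kappa>" and \<kappa>icont: "continuous_on X \<kappa>i"
    and \<kappa>X: "\<And>m. m \<in> U \<Longrightarrow> \<kappa> m \<in> X" and \<kappa>i: "\<And>m. m \<in> U \<Longrightarrow> \<kappa>i (\<kappa> m) = m"
    and \<kappa>iU: "\<And>z. z \<in> X \<Longrightarrow> \<kappa>i z \<in> U" and \<kappa>\<kappa>i: "\<And>z. z \<in> X \<Longrightarrow> \<kappa> (\<kappa>i z) = z"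
    using chart(2) unfolding homeomorphism_def by auto
  define \<gamma> where "\<gamma> \<tau> = \<kappa> (c0 \<tau>)" for \<tau>
  have \<gamma>cont: "continuous_on {s..t} \<gamma>"
    unfolding \<gamma>_def using c0
    by (intro continuous_on_compose2[OF \<kappa>cont]) (auto simp: ode_curve_def)
  define C where "C = \<gamma> ` {s..t}"
  have C: "compact C" "C \<subseteq> X"
    unfolding C_def using \<gamma>cont c0(2) \<kappa>X by (auto intro!: compact_continuous_image simp: \<gamma>_def)
  obtain r where r: "r > 0" "\<And>x y. x \<in> C \<Longrightarrow> dist x y < r \<Longrightarrow> y \<in> X \<and> dist (f' y) (f' x) < 1"
    by (rule continuous_near_compact[OF C(1) chart(3) C(2) f(2), of 1]) auto
  have "compact (f' ` C)"
    by (rule compact_continuous_image[OF continuous_on_subset[OF f(2) C(2)] C(1)])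
  from compact_imp_bounded[OF this] obtain K where K: "K > 0" "\<forall>A\<in>f' ` C. norm A \<le> K"
    unfolding bounded_pos by blast
  define \<rho> where "\<rho> = r / 2"
  have \<rho>: "\<rho> > 0" "\<rho> < r" using r(1) by (auto simp: \<rho>_def)
  have lip: "norm (f z - f x) \<le> (K + 1) * norm (z - x)" if "x \<in> C" "norm (z - x) \<le> \<rho>" for x z
  proof -
    have "norm (f z - f x - (0 :: 'z \<Rightarrow>\<^sub>L 'z) (z - x)) \<le> (K + 1) * norm (z - x)"
    proof (rule C1_lipschitz_near[of x r f f'])
      fix y assume "y \<in> ball x r"
      then have y: "y \<in> X" "dist (f' y) (f' x) < 1" using r(2)[OF that(1), of y] by auto
      then show "(f has_derivative f' y) (at y)" using f by blast
      show "norm (f' y - 0) \<le> K + 1"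
        using y(2) K(2) that(1) norm_triangle_ineq2[of "f' y" "f' x"] by (force simp: dist_norm)
    qed (use that \<rho> in \<open>auto simp: dist_norm norm_minus_commute\<close>)
    then show ?thesis by simp
  qed
  define B where "B = exp ((K + 1 + 1/2) * (t - s))"
  have B: "B \<ge> 1" unfolding B_def using K(1) st by simp
  define d where "d = \<rho> / (2 * B)"
  have d: "d > 0" "B * d < \<rho>" "d < \<rho>" using B \<rho> by (auto simp: d_def field_simps)
  define N where "N = {x + y | x y. x \<in> C \<and> y \<in> cball 0 \<rho>}"
  have N: "compact N" "N \<subseteq> X"
  proof -
    show "compact N" unfolding N_def by (rule compact_sums[OF C(1) compact_cball])
    show "N \<subseteq> X" using r(2) \<rho> by (auto simp: N_def dist_norm)
  qed
  have NI: "z \<in> N" if "x \<in> C" "norm (z - x) \<le> \<rho>" for x z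
    unfolding N_def mem_Collect_eq
    by (rule exI[of _ x], rule exI[of _ "z - x"]) (use that in simp)
  have clN: "closed (\<kappa>i ` N)"
    by (rule compact_imp_closed[OF compact_continuous_image[OF continuous_on_subset[OF \<kappa>icont N(2)] N(1)]])
  show thesis
  proof (rule that[of B d])
    fix c \<tau>1
    assume c: "ode_curve U \<kappa> f s t c" and cs: "c s \<in> U" and small: "norm (\<kappa> (c s) - \<kappa> (c0 s)) < d"
      and \<tau>1: "\<tau>1 \<in> {s..t}"
    define u where "u \<tau> = \<kappa> (c \<tau>) - \<gamma> \<tau>" for \<tau>
    have ccont: "continuous_on {s..t} c" using c by (simp add: ode_curve_def)
    have grow: "norm (u \<tau>) \<le> B * norm (u s)"
      if \<tau>: "\<tau> \<in> {s..t}" and good: "\<And>\<sigma>. \<sigma> \<in> {s..\<tau>} \<Longrightarrow> c \<sigma> \<in> U \<and> norm (u \<sigma>) \<le> \<rho>" for \<tau>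
    proof -
      have "norm (u \<tau>) \<le> (norm (u s) + 0) * exp ((K + 1 + 1/2) * (t - s))"
      proof (rule gronwall_norm[where u' = "\<lambda>\<sigma>. f (\<kappa> (c \<sigma>)) - f (\<gamma> \<sigma>)"])
        fix \<sigma> assume \<sigma>: "\<sigma> \<in> {s..\<tau>}"
        then have \<sigma>': "\<sigma> \<in> {s..t}" using \<tau> by auto
        show "(u has_vector_derivative f (\<kappa> (c \<sigma>)) - f (\<gamma> \<sigma>)) (at \<sigma> within {s..\<tau>})"
          unfolding u_def \<gamma>_def
          using ode_curve_subset[OF c, of s \<tau>] ode_curve_subset[OF c0(1), of s \<tau>] \<tau> \<sigma> good[OF \<sigma>]
            c0(2)[THEN subsetD, OF imageI[OF \<sigma>']]
          by (intro has_vector_derivative_diff) (auto simp: ode_curve_def)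
        show "norm (f (\<kappa> (c \<sigma>)) - f (\<gamma> \<sigma>)) \<le> (K + 1) * norm (u \<sigma>) + 0"
          using lip[of "\<gamma> \<sigma>" "\<kappa> (c \<sigma>)"] good[OF \<sigma>] \<sigma>' by (simp add: C_def u_def)
      qed (use \<tau> K in auto)
      then show ?thesis by (simp add: B_def mult.commute)
    qed
    \<comment> \<open>The good times form a relatively open set, so the bad ones have a minimum if there are any.\<close>
    define W where "W = {\<tau> \<in> {\<tau> \<in> {s..t}. c \<tau> \<in> U}. norm (u \<tau>) < \<rho>}"
    have ucont: "continuous_on {\<tau> \<in> {s..t}. c \<tau> \<in> U} (\<lambda>\<tau>. norm (u \<tau>))"
      unfolding u_def
      by (intro continuous_intros continuous_on_compose2[OF \<kappa>cont] continuous_on_subset[OF ccont]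
          continuous_on_subset[OF \<gamma>cont]) auto
    have "openin (top_of_set {\<tau> \<in> {s..t}. c \<tau> \<in> U}) W"
    proof -
      have "W = {\<tau> \<in> {s..t}. c \<tau> \<in> U} \<inter> (\<lambda>\<tau>. norm (u \<tau>)) -` {..<\<rho>}" by (auto simp: W_def)
      then show ?thesis using continuous_openin_preimage_gen[OF ucont, of "{..<\<rho>}"] by simp
    qed
    moreover have "openin (top_of_set {s..t}) {\<tau> \<in> {s..t}. c \<tau> \<in> U}"
    proof -
      have "{\<tau> \<in> {s..t}. c \<tau> \<in> U} = {s..t} \<inter> c -` U" by auto
      then show ?thesis using continuous_openin_preimage_gen[OF ccont chart(1)] by simp
    qed
    ultimately have "openin (top_of_set {s..t}) W" by (rule openin_trans)
    then have "closedin (top_of_set {s..t}) ({s..t} - W)"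
      using closedin_diff closedin_topspace by (metis topspace_euclidean_subtopology)
    then have bad: "compact ({s..t} - W)"
      using closedin_compact compact_Icc by blast
    have sW: "s \<in> W" using cs small d st by (auto simp: W_def u_def \<gamma>_def)
    have "{s..t} - W = {}"
    proof (rule ccontr)
      assume "{s..t} - W \<noteq> {}"
      then obtain \<tau> where \<tau>: "\<tau> \<in> {s..t} - W" "\<And>\<sigma>. \<sigma> \<in> {s..t} - W \<Longrightarrow> \<tau> \<le> \<sigma>"
        using compact_attains_inf[OF bad] by blast
      then have "s < \<tau>" using sW by (metis DiffD1 DiffD2 atLeastAtMost_iff order_le_less)
      have pre: "\<sigma> \<in> W" if "\<sigma> \<in> {s..<\<tau>}" for \<sigma>
        using \<tau> that by force
      have sub: "{s..\<tau>} \<subseteq> {s..t}" using \<tau> by auto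
      have "closed ({s..\<tau>} \<inter> c -` (\<kappa>i ` N))"
        by (rule continuous_closed_preimage[OF continuous_on_subset[OF ccont sub] closed_atLeastAtMost clN])
      moreover have "{s..<\<tau>} \<subseteq> {s..\<tau>} \<inter> c -` (\<kappa>i ` N)"
      proof
        fix \<sigma> assume \<sigma>: "\<sigma> \<in> {s..<\<tau>}"
        then have "c \<sigma> \<in> U" "norm (\<kappa> (c \<sigma>) - \<gamma> \<sigma>) \<le> \<rho>" "\<gamma> \<sigma> \<in> C"
          using pre[OF \<sigma>] sub by (auto simp: W_def u_def C_def)
        then have "c \<sigma> \<in> \<kappa>i ` N" by (intro image_eqI[of _ \<kappa>i "\<kappa> (c \<sigma>)"] NI[of "\<gamma> \<sigma>"]) (simp_all add: \<kappa>i)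
        then show "\<sigma> \<in> {s..\<tau>} \<inter> c -` (\<kappa>i ` N)" using \<sigma> by auto
      qed
      ultimately have "closure {s..<\<tau>} \<subseteq> {s..\<tau>} \<inter> c -` (\<kappa>i ` N)" by (simp only: closure_minimal)
      then have "{s..\<tau>} \<subseteq> c -` (\<kappa>i ` N)" using \<open>s < \<tau>\<close> by simp
      then have inU: "\<And>\<sigma>. \<sigma> \<in> {s..\<tau>} \<Longrightarrow> c \<sigma> \<in> U" using N(2) by (auto dest!: subsetD intro!: \<kappa>iU)
      have "norm (u \<sigma>) \<le> \<rho>" if "\<sigma> \<in> {s..\<tau>}" for \<sigma>
      proof (rule continuous_le_on_closure[of "{s..<\<tau>}" "\<lambda>\<sigma>. norm (u \<sigma>)"])
        show "continuous_on (closure {s..<\<tau>}) (\<lambda>\<sigma>. norm (u \<sigma>))"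
          using \<open>s < \<tau>\<close> inU sub by (auto intro!: continuous_on_subset[OF ucont])
        show "\<sigma> \<in> closure {s..<\<tau>}" using \<open>s < \<tau>\<close> that by simp
        show "norm (u \<sigma>) \<le> \<rho>" if "\<sigma> \<in> {s..<\<tau>}" for \<sigma> using pre[OF that] by (simp add: W_def)
      qed
      then have "norm (u \<tau>) \<le> B * norm (u s)" using grow[of \<tau>] inU \<tau> by auto
      also have "\<dots> \<le> B * d" using small B by (auto simp: u_def \<gamma>_def)
      finally have "\<tau> \<in> W" using d(2) inU[of \<tau>] \<tau>(1) \<open>s < \<tau>\<close> by (auto simp: W_def)
      then show False using \<tau> by simp
    qed
    then have W: "\<And>\<sigma>. \<sigma> \<in> {s..t} \<Longrightarrow> \<sigma> \<in> W" by blast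
    have "norm (u \<tau>1) \<le> B * norm (u s)"
    proof (rule grow[OF \<tau>1])
      fix \<sigma> assume "\<sigma> \<in> {s..\<tau>1}"
      then have "\<sigma> \<in> W" using W \<tau>1 by auto
      then show "c \<sigma> \<in> U \<and> norm (u \<sigma>) \<le> \<rho>" by (simp add: W_def)
    qed
    moreover have "c \<tau>1 \<in> U" using W[OF \<tau>1] by (simp add: W_def)
    ultimately show "c \<tau>1 \<in> U \<and> norm (\<kappa> (c \<tau>1) - \<kappa> (c0 \<tau>1)) \<le> B * norm (\<kappa> (c s) - \<kappa> (c0 s))"
      by (simp add: u_def \<gamma>_def)
  qed (use B d in auto)
qed

lemma ode_curve_unique:
  fixes \<kappa> :: "'m::t2_space \<Rightarrow> 'z::euclidean_space" and f' :: "'z \<Rightarrow> 'z \<Rightarrow>\<^sub>L 'z"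
  assumes chart: "open U" "homeomorphism U X \<kappa> \<kappa>i" "open X"
    and f: "\<And>z. z \<in> X \<Longrightarrow> (f has_derivative f' z) (at z)" "continuous_on X f'"
    and st: "s \<le> t" and c0: "ode_curve U \<kappa> f s t c0" "c0 ` {s..t} \<subseteq> U"
    and c: "ode_curve U \<kappa> f s t c" "c s = c0 s" and \<tau>: "\<tau> \<in> {s..t}"
  shows "c \<tau> = c0 \<tau>"
proof -
  obtain B d where Bd: "B > 0" "d > 0"
    "\<And>c \<tau>. ode_curve U \<kappa> f s t c \<Longrightarrow> c s \<in> U \<Longrightarrow> norm (\<kappa> (c s) - \<kappa> (c0 s)) < d \<Longrightarrow> \<tau> \<in> {s..t} \<Longrightarrow>
       c \<tau> \<in> U \<and> norm (\<kappa> (c \<tau>) - \<kappa> (c0 \<tau>)) \<le> B * norm (\<kappa> (c s) - \<kappa> (c0 s))"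
    by (rule ode_curve_tube[OF assms(1-8)]) blast+
  have "s \<in> {s..t}" using st by simp
  then have "c s \<in> U" using c0(2) c(2) by auto
  then have "c \<tau> \<in> U" "\<kappa> (c \<tau>) = \<kappa> (c0 \<tau>)" using Bd(3)[OF c(1) _ _ \<tau>] c(2) Bd(2) by auto
  moreover have "c0 \<tau> \<in> U" using c0(2) \<tau> by auto
  ultimately show ?thesis using chart(2) unfolding homeomorphism_def by metis
qed

text \<open>Differentiating a family of solutions amounts to composing with the fundamental solution \<open>M\<close> of
  the linearised equation: subtracting the linear prediction leaves a function whose derivative is
  bounded by \<open>K\<bar>r\<bar>\<close> plus an error of higher order, and Gronwall applies.\<close>

lemma ode_curve_differentiable:
  fixes \<kappa> :: "'m::t2_space \<Rightarrow> 'z::euclidean_space" and f' :: "'z \<Rightarrow> 'z \<Rightarrow>\<^sub>L 'z"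
    and c :: "'p::real_normed_vector \<Rightarrow> real \<Rightarrow> 'm"
  assumes chart: "open U" "homeomorphism U X \<kappa> \<kappa>i" "open X"
    and f: "\<And>z. z \<in> X \<Longrightarrow> (f has_derivative f' z) (at z)" "continuous_on X f'"
    and st: "s \<le> t" and c: "\<And>x. ode_curve U \<kappa> f s t (c x)" and c0: "c x0 ` {s..t} \<subseteq> U"
    and init: "\<forall>\<^sub>F x in nhds x0. c x s \<in> U" "((\<lambda>x. \<kappa> (c x s)) has_derivative D) (at x0)"
  obtains M where "M s = id_blinfun"
    "\<And>\<tau>. \<tau> \<in> {s..t} \<Longrightarrow>
      (M has_vector_derivative (f' (\<kappa> (c x0 \<tau>)) o\<^sub>L M \<tau>)) (at \<tau> within {s..t})"
    "\<And>\<tau>. \<tau> \<in> {s..t} \<Longrightarrow> ((\<lambda>x. \<kappa> (c x \<tau>)) has_derivative (\<lambda>v. M \<tau> (D v))) (at x0)"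
    "\<And>\<tau>. \<tau> \<in> {s..t} \<Longrightarrow> \<forall>\<^sub>F x in nhds x0. c x \<tau> \<in> U"
proof -
  have \<kappa>cont: "continuous_on U \<kappa>" and \<kappa>X: "\<And>m. m \<in> U \<Longrightarrow> \<kappa> m \<in> X"
    using chart(2) unfolding homeomorphism_def by auto
  obtain B d where Bd: "B > 0" "d > 0"
    "\<And>c' \<tau>. ode_curve U \<kappa> f s t c' \<Longrightarrow> c' s \<in> U \<Longrightarrow> norm (\<kappa> (c' s) - \<kappa> (c x0 s)) < d \<Longrightarrow> \<tau> \<in> {s..t} \<Longrightarrow>
       c' \<tau> \<in> U \<and> norm (\<kappa> (c' \<tau>) - \<kappa> (c x0 \<tau>)) \<le> B * norm (\<kappa> (c' s) - \<kappa> (c x0 s))"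
    by (rule ode_curve_tube[OF assms(1-6) c c0]) blast+
  define \<gamma> where "\<gamma> \<tau> = \<kappa> (c x0 \<tau>)" for \<tau>
  have \<gamma>cont: "continuous_on {s..t} \<gamma>"
    unfolding \<gamma>_def using c[of x0] c0
    by (intro continuous_on_compose2[OF \<kappa>cont]) (auto simp: ode_curve_def)
  define C where "C = \<gamma> ` {s..t}"
  have C: "compact C" "C \<subseteq> X"
    unfolding C_def using \<gamma>cont c0 \<kappa>X by (auto intro!: compact_continuous_image simp: \<gamma>_def)
  have Acont: "continuous_on {s..t} (\<lambda>\<tau>. f' (\<gamma> \<tau>))"
    using C(2) unfolding C_def by (intro continuous_on_compose2[OF f(2) \<gamma>cont])
  obtain M where M: "M s = id_blinfun"
    "\<And>\<tau>. \<tau> \<in> {s..t} \<Longrightarrow> (M has_vector_derivative (f' (\<gamma> \<tau>) o\<^sub>L M \<tau>)) (at \<tau> within {s..t})"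
    using linear_ode[OF st Acont] by blast
  have "compact (f' ` C)"
    by (rule compact_continuous_image[OF continuous_on_subset[OF f(2) C(2)] C(1)])
  from compact_imp_bounded[OF this] obtain K where K: "K > 0" "\<forall>A\<in>f' ` C. norm A \<le> K"
    unfolding bounded_pos by blast
  define E where "E = exp ((K + 1/2) * (t - s))"
  have E: "E > 0" by (simp add: E_def)
  define \<Delta> where "\<Delta> x = \<kappa> (c x s) - \<gamma> s" for x
  have est: "\<exists>\<delta>>0. \<forall>x. c x s \<in> U \<and> norm (\<Delta> x) < \<delta> \<longrightarrow>
      norm (\<kappa> (c x \<tau>) - \<gamma> \<tau> - M \<tau> (\<Delta> x)) \<le> e * norm (\<Delta> x)" if e: "e > 0" and \<tau>: "\<tau> \<in> {s..t}" for e \<tau>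
  proof -
    define h where "h = e / (B * E)"
    have h: "h > 0" using e Bd(1) E by (simp add: h_def)
    obtain r where r: "r > 0" "\<And>x y. x \<in> C \<Longrightarrow> dist x y < r \<Longrightarrow> y \<in> X \<and> dist (f' y) (f' x) < h"
      by (rule continuous_near_compact[OF C(1) chart(3) C(2) f(2) h]) auto
    show ?thesis
    proof (intro exI[of _ "min d (r / B)"] conjI allI impI)
      show "0 < min d (r / B)" using Bd r by simp
      fix x assume x: "c x s \<in> U \<and> norm (\<Delta> x) < min d (r / B)"
      have near: "c x \<sigma> \<in> U" "norm (\<kappa> (c x \<sigma>) - \<gamma> \<sigma>) \<le> B * norm (\<Delta> x)" if "\<sigma> \<in> {s..t}" for \<sigma>
        using Bd(3)[OF c, of x, OF _ _ that] x by (auto simp: \<Delta>_def \<gamma>_def)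
      have "B * norm (\<Delta> x) < r" using x Bd(1) by (simp add: field_simps)
      define u where "u \<sigma> = \<kappa> (c x \<sigma>) - \<gamma> \<sigma> - M \<sigma> (\<Delta> x)" for \<sigma>
      have "norm (u \<tau>) \<le> (norm (u s) + h * (B * norm (\<Delta> x))) * exp ((K + 1/2) * (t - s))"
      proof (rule gronwall_norm[where u' = "\<lambda>\<sigma>. f (\<kappa> (c x \<sigma>)) - f (\<gamma> \<sigma>) - f' (\<gamma> \<sigma>) (M \<sigma> (\<Delta> x))"])
        fix \<sigma> assume \<sigma>: "\<sigma> \<in> {s..\<tau>}"
        then have \<sigma>': "\<sigma> \<in> {s..t}" using \<tau> by auto
        have sub: "{s..\<tau>} \<subseteq> {s..t}" using \<tau> by auto
        have m: "((\<lambda>\<sigma>. M \<sigma> (\<Delta> x)) has_vector_derivative (f' (\<gamma> \<sigma>) o\<^sub>L M \<sigma>) (\<Delta> x)) (at \<sigma> within {s..\<tau>})"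
          by (rule has_vector_derivative_within_subset[OF _ sub])
            (rule bounded_linear.has_vector_derivative[OF _ M(2)[OF \<sigma>']], rule blinfun.bounded_linear_left)
        have 1: "((\<lambda>\<sigma>. \<kappa> (c x \<sigma>)) has_vector_derivative f (\<kappa> (c x \<sigma>))) (at \<sigma> within {s..\<tau>})"
          using c[of x] near(1)[OF \<sigma>'] \<sigma>' sub has_vector_derivative_within_subset
          unfolding ode_curve_def by blast
        have 2: "(\<gamma> has_vector_derivative f (\<gamma> \<sigma>)) (at \<sigma> within {s..\<tau>})"
          using c[of x0] c0 \<sigma>' sub has_vector_derivative_within_subset
          unfolding ode_curve_def \<gamma>_def by blast
        show "(u has_vector_derivative f (\<kappa> (c x \<sigma>)) - f (\<gamma> \<sigma>) - f' (\<gamma> \<sigma>) (M \<sigma> (\<Delta> x)))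
            (at \<sigma> within {s..\<tau>})"
          unfolding u_def
          using has_vector_derivative_diff[OF has_vector_derivative_diff[OF 1 2] m] by simp
        have gC: "\<gamma> \<sigma> \<in> C" using \<sigma>' by (simp add: C_def)
        have "norm (f (\<kappa> (c x \<sigma>)) - f (\<gamma> \<sigma>) - f' (\<gamma> \<sigma>) (\<kappa> (c x \<sigma>) - \<gamma> \<sigma>)) \<le>
            h * norm (\<kappa> (c x \<sigma>) - \<gamma> \<sigma>)"
        proof (rule C1_lipschitz_near[of "\<gamma> \<sigma>" r f f'])
          show "\<kappa> (c x \<sigma>) \<in> ball (\<gamma> \<sigma>) r"
            using near(2)[OF \<sigma>'] \<open>B * norm (\<Delta> x) < r\<close> by (simp add: dist_norm norm_minus_commute)
        next
          fix y assume "y \<in> ball (\<gamma> \<sigma>) r"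
          then have "y \<in> X \<and> dist (f' y) (f' (\<gamma> \<sigma>)) < h" using r(2)[OF gC] by simp
          then show "(f has_derivative f' y) (at y)" "norm (f' y - f' (\<gamma> \<sigma>)) \<le> h"
            using f(1) by (auto simp: dist_norm)
        qed
        also have "\<dots> \<le> h * (B * norm (\<Delta> x))" using near(2)[OF \<sigma>'] h by (intro mult_left_mono) auto
        finally have a: "norm (f (\<kappa> (c x \<sigma>)) - f (\<gamma> \<sigma>) - f' (\<gamma> \<sigma>) (\<kappa> (c x \<sigma>) - \<gamma> \<sigma>)) \<le>
            h * (B * norm (\<Delta> x))" .
        have "norm (f' (\<gamma> \<sigma>) (u \<sigma>)) \<le> norm (f' (\<gamma> \<sigma>)) * norm (u \<sigma>)" by (rule norm_blinfun)
        also have "\<dots> \<le> K * norm (u \<sigma>)" using K(2) gC by (intro mult_right_mono) auto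
        finally have b: "norm (f' (\<gamma> \<sigma>) (u \<sigma>)) \<le> K * norm (u \<sigma>)" .
        have "f (\<kappa> (c x \<sigma>)) - f (\<gamma> \<sigma>) - f' (\<gamma> \<sigma>) (M \<sigma> (\<Delta> x)) =
            f' (\<gamma> \<sigma>) (u \<sigma>) + (f (\<kappa> (c x \<sigma>)) - f (\<gamma> \<sigma>) - f' (\<gamma> \<sigma>) (\<kappa> (c x \<sigma>) - \<gamma> \<sigma>))"
          by (simp add: u_def blinfun.diff_right)
        then show "norm (f (\<kappa> (c x \<sigma>)) - f (\<gamma> \<sigma>) - f' (\<gamma> \<sigma>) (M \<sigma> (\<Delta> x))) \<le>
            K * norm (u \<sigma>) + h * (B * norm (\<Delta> x))"
          using a b norm_triangle_le by (metis add_mono)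
      qed (use \<tau> K h Bd(1) in auto)
      moreover have "u s = 0" by (simp add: u_def M(1) \<Delta>_def)
      moreover have "h * (B * norm (\<Delta> x)) * E = e * norm (\<Delta> x)"
        using Bd(1) E by (simp add: h_def)
      ultimately show "norm (\<kappa> (c x \<tau>) - \<gamma> \<tau> - M \<tau> (\<Delta> x)) \<le> e * norm (\<Delta> x)"
        unfolding E_def[symmetric] u_def by (metis add_0 norm_zero)
    qed
  qed
  have bD: "bounded_linear D" using init(2) by (rule has_derivative_bounded_linear)
  have \<Delta>: "(\<Delta> has_derivative D) (at x0)"
    unfolding \<Delta>_def using has_derivative_diff[OF init(2) has_derivative_const] by simp
  have \<Delta>0: "\<Delta> x0 = 0" by (simp add: \<Delta>_def \<gamma>_def)
  have \<Delta>bd: "\<forall>\<^sub>F x in nhds x0. norm (\<Delta> x) \<le> (onorm D + 1) * norm (x - x0)"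
  proof -
    obtain \<delta> where "\<delta> > 0"
      "\<forall>y. norm (y - x0) < \<delta> \<longrightarrow> norm (\<Delta> y - \<Delta> x0 - D (y - x0)) \<le> 1 * norm (y - x0)"
      using \<Delta> unfolding has_derivative_at_alt by (metis zero_less_one)
    moreover have "norm (\<Delta> y) \<le> (onorm D + 1) * norm (y - x0)"
      if "norm (\<Delta> y - \<Delta> x0 - D (y - x0)) \<le> 1 * norm (y - x0)" for y
      using that onorm[OF bD, of "y - x0"] norm_triangle_sub[of "\<Delta> y" "D (y - x0)"]
      by (simp add: \<Delta>0 algebra_simps)
    ultimately show ?thesis unfolding eventually_nhds_metric dist_norm by blast
  qed
  have \<Delta>small: "\<forall>\<^sub>F x in nhds x0. norm (\<Delta> x) < \<delta>" if "\<delta> > 0" for \<delta>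
  proof -
    have "isCont \<Delta> x0" using \<Delta> by (rule has_derivative_continuous)
    then have "(\<Delta> \<longlongrightarrow> 0) (nhds x0)"
      unfolding isCont_def tendsto_at_iff_tendsto_nhds by (simp add: \<Delta>0)
    then show ?thesis using that by (auto dest: tendstoD)
  qed
  show thesis
  proof (rule that[of M, OF M(1)])
    fix \<tau> assume \<tau>: "\<tau> \<in> {s..t}"
    show "(M has_vector_derivative (f' (\<kappa> (c x0 \<tau>)) o\<^sub>L M \<tau>)) (at \<tau> within {s..t})"
      using M(2)[OF \<tau>] by (simp add: \<gamma>_def)
    show "\<forall>\<^sub>F x in nhds x0. c x \<tau> \<in> U"
      using init(1) \<Delta>small[OF Bd(2)]
      by eventually_elim (use Bd(3)[OF c _ _ \<tau>] in \<open>auto simp: \<Delta>_def \<gamma>_def\<close>)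
    define R where "R x = \<kappa> (c x \<tau>) - \<gamma> \<tau> - M \<tau> (\<Delta> x)" for x
    have R0: "R x0 = 0" by (simp add: R_def \<gamma>_def \<Delta>0)
    have "(R has_derivative (\<lambda>_. 0)) (at x0)"
      unfolding has_derivative_at_alt
    proof (intro conjI allI impI)
      fix e :: real assume "e > 0"
      define e' where "e' = e / (onorm D + 1)"
      have o: "onorm D + 1 > 0" using onorm_pos_le[OF bD] by simp
      have "e' > 0" using \<open>e > 0\<close> o by (simp add: e'_def)
      then obtain \<delta> where \<delta>: "\<delta> > 0" "\<And>x. c x s \<in> U \<Longrightarrow> norm (\<Delta> x) < \<delta> \<Longrightarrow> norm (R x) \<le> e' * norm (\<Delta> x)"
        using est[OF _ \<tau>] unfolding R_def by blast
      have "\<forall>\<^sub>F x in nhds x0. norm (R x - R x0 - 0) \<le> e * norm (x - x0)"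
        using init(1) \<Delta>small[OF \<delta>(1)] \<Delta>bd
      proof eventually_elim
        case (elim x)
        have "norm (R x) \<le> e' * norm (\<Delta> x)" using \<delta>(2) elim by blast
        also have "\<dots> \<le> e' * ((onorm D + 1) * norm (x - x0))"
          using elim \<open>e' > 0\<close> by (intro mult_left_mono) auto
        also have "\<dots> = e * norm (x - x0)" using o by (simp add: e'_def)
        finally show ?case by (simp add: R0)
      qed
      then show "\<exists>d>0. \<forall>y. norm (y - x0) < d \<longrightarrow> norm (R y - R x0 - 0) \<le> e * norm (y - x0)"
        unfolding eventually_nhds_metric dist_norm by blast
    qed simp
    from has_derivative_add[OF has_derivative_add[OF this has_derivative_const[of "\<gamma> \<tau>"]]
        bounded_linear.has_derivative[OF blinfun.bounded_linear_right[of "M \<tau>"] \<Delta>]]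
    show "((\<lambda>x. \<kappa> (c x \<tau>)) has_derivative (\<lambda>v. M \<tau> (D v))) (at x0)"
      by (simp add: R_def)
  qed
qed

section \<open>Derivatives in charts\<close>

definition good_chart :: "('m::t2_space, 'e::real_normed_vector) chart \<Rightarrow> bool" where
  "good_chart c \<longleftrightarrow> open (fst c) \<and> open (snd c ` fst c) \<and>
     homeomorphism (fst c) (snd c ` fst c) (snd c) (chart_inv c)"

text \<open>Unlike \<open>tangent_map\<close>, the two charts need not be centred at the points in question, which is
  what a curve moving through a fixed chart requires.\<close>

definition has_mderiv ::
  "('m::t2_space, 'e::real_normed_vector) chart \<Rightarrow> ('n::t2_space, 'f::real_normed_vector) chart \<Rightarrow>
   ('m \<Rightarrow> 'n) \<Rightarrow> 'm \<Rightarrow> ('e \<Rightarrow> 'f) \<Rightarrow> bool" where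
  "has_mderiv c d F x A \<longleftrightarrow> isCont F x \<and>
     ((\<lambda>y. snd d (F (chart_inv c y))) has_derivative A) (at (snd c x))"

lemma good_chartD:
  assumes "good_chart c"
  shows "open (fst c)" "open (snd c ` fst c)" "continuous_on (fst c) (snd c)"
    "continuous_on (snd c ` fst c) (chart_inv c)" "inj_on (snd c) (fst c)"
    "\<And>x. x \<in> fst c \<Longrightarrow> chart_inv c (snd c x) = x"
    "\<And>x. x \<in> fst c \<Longrightarrow> isCont (snd c) x"
    "\<And>x. x \<in> fst c \<Longrightarrow> isCont (chart_inv c) (snd c x)"
proof -
  show 1: "open (fst c)" "open (snd c ` fst c)" "continuous_on (fst c) (snd c)"
    "continuous_on (snd c ` fst c) (chart_inv c)"
    and 2: "\<And>x. x \<in> fst c \<Longrightarrow> chart_inv c (snd c x) = x"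
    using assms by (auto simp: good_chart_def homeomorphism_def)
  show "inj_on (snd c) (fst c)" by (metis 2 inj_onI)
  show "\<And>x. x \<in> fst c \<Longrightarrow> isCont (snd c) x"
    "\<And>x. x \<in> fst c \<Longrightarrow> isCont (chart_inv c) (snd c x)"
    using 1 by (auto simp: continuous_on_eq_continuous_at)
qed

lemma good_chartI:
  assumes "open (fst c)" "open (snd c ` fst c)" "continuous_on (fst c) (snd c)"
    "continuous_on (snd c ` fst c) (chart_inv c)" "inj_on (snd c) (fst c)"
  shows "good_chart c"
  using assms by (auto simp: good_chart_def homeomorphism_def chart_inv_def)

lemma eventually_in_open:
  "isCont F x \<Longrightarrow> open U \<Longrightarrow> F x \<in> U \<Longrightarrow> \<forall>\<^sub>F y in nhds x. F y \<in> U"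
  unfolding isCont_def tendsto_at_iff_tendsto_nhds by (rule topological_tendstoD)

lemma has_derivative_transform_nhds:
  assumes "(f has_derivative f') (at x)" "\<forall>\<^sub>F y in nhds x. f y = g y"
  shows "(g has_derivative f') (at x)"
proof (rule has_derivative_transform_eventually[OF assms(1)])
  show "\<forall>\<^sub>F y in at x. f y = g y" using assms(2) by (simp add: eventually_at_filter eventually_mono)
  show "f x = g x" using assms(2) by (rule eventually_nhds_x_imp_x)
qed simp

lemma mderiv_compose:
  assumes c: "good_chart c" "x \<in> fst c" and d: "good_chart d" "F x \<in> fst d"
    and F: "has_mderiv c d F x A" and H: "has_mderiv d e H (F x) B"
  shows "has_mderiv c e (\<lambda>x. H (F x)) x (\<lambda>v. B (A v))"
proof -
  have cx: "chart_inv c (snd c x) = x" and cc: "isCont (chart_inv c) (snd c x)"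
    using good_chartD[OF c(1)] c(2) by auto
  have FC: "isCont (\<lambda>y. F (chart_inv c y)) (snd c x)"
    by (rule isCont_o2[where f = "chart_inv c" and g = F, OF cc]) (use cx F in \<open>simp add: has_mderiv_def\<close>)
  have "((\<lambda>y. snd e (H (chart_inv d (snd d (F (chart_inv c y)))))) has_derivative (\<lambda>v. B (A v)))
      (at (snd c x))"
    using F H unfolding has_mderiv_def
    by (intro has_derivative_compose[of "\<lambda>y. snd d (F (chart_inv c y))" A "snd c x" UNIV
        "\<lambda>z. snd e (H (chart_inv d z))" B]) (auto simp: cx)
  moreover have "\<forall>\<^sub>F y in at (snd c x). snd e (H (chart_inv d (snd d (F (chart_inv c y))))) =
      snd e (H (F (chart_inv c y)))"
    using eventually_nhds_conv_at[THEN iffD1, THEN conjunct1,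
        OF eventually_in_open[OF FC good_chartD(1)[OF d(1)]]] d(2) cx
    by (auto elim!: eventually_mono simp: good_chartD(6)[OF d(1)])
  ultimately have "((\<lambda>y. snd e (H (F (chart_inv c y)))) has_derivative (\<lambda>v. B (A v))) (at (snd c x))"
    by (rule has_derivative_transform_eventually) (simp_all add: cx d good_chartD(6))
  moreover have "isCont (\<lambda>x. H (F x)) x"
    by (rule isCont_o2[where f = F and g = H]) (use F H in \<open>simp_all add: has_mderiv_def\<close>)
  ultimately show ?thesis by (simp add: has_mderiv_def)
qed

lemma mderiv_curve:
  assumes d: "good_chart d" "c t \<in> fst d" and t: "t \<in> T"
    and c: "continuous (at t within T) c" "((\<lambda>\<sigma>. snd d (c \<sigma>)) has_vector_derivative v) (at t within T)"
    and H: "has_mderiv d e H (c t) B"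
  shows "((\<lambda>\<sigma>. snd e (H (c \<sigma>))) has_vector_derivative B v) (at t within T)"
proof -
  have HB: "((\<lambda>z. snd e (H (chart_inv d z))) has_derivative B) (at (snd d (c t)))"
    using H by (simp add: has_mderiv_def)
  have "((\<lambda>\<sigma>. snd e (H (chart_inv d (snd d (c \<sigma>))))) has_derivative (\<lambda>h. B (h *\<^sub>R v))) (at t within T)"
    using has_derivative_compose[OF c(2)[unfolded has_vector_derivative_def] HB] .
  moreover have "\<forall>\<^sub>F \<sigma> in at t within T. c \<sigma> \<in> fst d"
    using c(1) unfolding continuous_within
    by (rule topological_tendstoD[OF _ good_chartD(1)[OF d(1)] d(2)])
  then have "\<forall>\<^sub>F \<sigma> in at t within T. snd e (H (chart_inv d (snd d (c \<sigma>)))) = snd e (H (c \<sigma>))"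
    by (rule eventually_mono) (simp add: good_chartD(6)[OF d(1)])
  ultimately have "((\<lambda>\<sigma>. snd e (H (c \<sigma>))) has_derivative (\<lambda>h. B (h *\<^sub>R v))) (at t within T)"
    by (rule has_derivative_transform_eventually) (simp_all add: t d good_chartD(6))
  moreover have "B (h *\<^sub>R v) = h *\<^sub>R B v" for h
    using linear_cmul[OF has_derivative_linear[OF HB]] .
  ultimately show ?thesis by (simp add: has_vector_derivative_def)
qed

lemma mderiv_unique:
  assumes "has_mderiv c d F x A" "has_mderiv c d F x B"
  shows "A = B"
  using assms has_derivative_unique unfolding has_mderiv_def by blast

abbreviation vs_chart :: "('v, 'v) chart" where "vs_chart \<equiv> (UNIV, \<lambda>y. y)"

lemma vs_chart_inv [simp]: "chart_inv vs_chart = (\<lambda>y. y)"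
  by (rule ext) (auto simp: chart_inv_def intro!: inv_into_f_eq)

lemma good_vs_chart: "good_chart vs_chart"
  by (rule good_chartI) auto

lemma mderiv_vs: "has_mderiv vs_chart vs_chart F x A \<longleftrightarrow> (F has_derivative A) (at x)"
  by (auto simp: has_mderiv_def dest: has_derivative_continuous)

definition prod_chart :: "('m, 'e) chart \<Rightarrow> ('n, 'f) chart \<Rightarrow> ('m \<times> 'n, 'e \<times> 'f) chart" where
  "prod_chart c d = (fst c \<times> fst d, map_prod (snd c) (snd d))"

lemma prod_chart_sel [simp]:
  "fst (prod_chart c d) = fst c \<times> fst d" "snd (prod_chart c d) = map_prod (snd c) (snd d)"
  by (simp_all add: prod_chart_def)

lemma prod_charts_eq: "prod_charts C D (x, y) = prod_chart (C x) (D y)"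
  by (simp add: prod_charts_def prod_chart_def)

lemma chart_inv_prod:
  assumes "good_chart c" "good_chart d" "y \<in> snd c ` fst c" "z \<in> snd d ` fst d"
  shows "chart_inv (prod_chart c d) (y, z) = (chart_inv c y, chart_inv d z)"
proof -
  obtain a b where ab: "a \<in> fst c" "b \<in> fst d" "y = snd c a" "z = snd d b" using assms by blast
  have "inj_on (map_prod (snd c) (snd d)) (fst c \<times> fst d)"
    using assms by (intro map_prod_inj_on good_chartD)
  then have "inv_into (fst c \<times> fst d) (map_prod (snd c) (snd d)) (map_prod (snd c) (snd d) (a, b)) = (a, b)"
    by (rule inv_into_f_f) (use ab in simp)
  then show ?thesis
    using ab assms(1,2) by (simp add: chart_inv_def[of "prod_chart c d"] good_chartD(6))
qed

lemma good_prod_chart: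
  assumes "good_chart c" "good_chart d"
  shows "good_chart (prod_chart c d)"
proof (rule good_chartI)
  have im: "snd (prod_chart c d) ` fst (prod_chart c d) = (snd c ` fst c) \<times> (snd d ` fst d)"
    by (simp add: map_prod_surj_on)
  show "open (fst (prod_chart c d))" using assms by (simp add: open_Times good_chartD)
  show "open (snd (prod_chart c d) ` fst (prod_chart c d))"
    unfolding im using assms by (simp add: open_Times good_chartD)
  have "continuous_on (fst c \<times> fst d) (\<lambda>p. (snd c (fst p), snd d (snd p)))"
    using assms by (intro continuous_intros continuous_on_compose2[OF good_chartD(3)[OF assms(1)]]
        continuous_on_compose2[OF good_chartD(3)[OF assms(2)]]) auto
  then show "continuous_on (fst (prod_chart c d)) (snd (prod_chart c d))"
    by (simp add: map_prod_def case_prod_beta')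
  have "continuous_on ((snd c ` fst c) \<times> (snd d ` fst d)) (\<lambda>p. (chart_inv c (fst p), chart_inv d (snd p)))"
    using assms by (intro continuous_intros continuous_on_compose2[OF good_chartD(4)[OF assms(1)]]
        continuous_on_compose2[OF good_chartD(4)[OF assms(2)]]) auto
  then show "continuous_on (snd (prod_chart c d) ` fst (prod_chart c d)) (chart_inv (prod_chart c d))"
    unfolding im by (rule continuous_on_eq) (auto simp: chart_inv_prod[OF assms imageI imageI])
  show "inj_on (snd (prod_chart c d)) (fst (prod_chart c d))"
    using assms by (auto intro!: map_prod_inj_on good_chartD)
qed

lemma eventually_chart_image:
  "good_chart c \<Longrightarrow> x \<in> fst c \<Longrightarrow> \<forall>\<^sub>F y in nhds (snd c x). y \<in> snd c ` fst c"
  by (intro eventually_nhds_in_open good_chartD) auto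

lemma mderiv_prod:
  assumes c: "good_chart c" "x \<in> fst c" and d: "good_chart d" "y \<in> fst d"
    and F: "has_mderiv c c' F x A" and H: "has_mderiv d d' H y B"
  shows "has_mderiv (prod_chart c d) (prod_chart c' d') (map_prod F H) (x, y) (map_prod A B)"
proof -
  let ?F = "\<lambda>z. snd c' (F (chart_inv c z))" and ?H = "\<lambda>z. snd d' (H (chart_inv d z))"
  have "((\<lambda>p. (?F (fst p), ?H (snd p))) has_derivative (\<lambda>p. (A (fst p), B (snd p)))) (at (snd c x, snd d y))"
  proof (rule has_derivative_Pair)
    show "((\<lambda>p. ?F (fst p)) has_derivative (\<lambda>p. A (fst p))) (at (snd c x, snd d y))"
      by (rule has_derivative_compose[of fst fst _ UNIV ?F A, OF has_derivative_fst[OF has_derivative_ident]])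
        (use F in \<open>simp add: has_mderiv_def\<close>)
    show "((\<lambda>p. ?H (snd p)) has_derivative (\<lambda>p. B (snd p))) (at (snd c x, snd d y))"
      by (rule has_derivative_compose[of snd snd _ UNIV ?H B, OF has_derivative_snd[OF has_derivative_ident]])
        (use H in \<open>simp add: has_mderiv_def\<close>)
  qed
  moreover have "\<forall>\<^sub>F p in nhds (snd c x, snd d y). p \<in> (snd c ` fst c) \<times> (snd d ` fst d)"
    using assms by (intro eventually_nhds_in_open open_Times good_chartD) auto
  then have "\<forall>\<^sub>F p in nhds (snd c x, snd d y). (?F (fst p), ?H (snd p)) =
      snd (prod_chart c' d') (map_prod F H (chart_inv (prod_chart c d) p))"
    by (rule eventually_mono) (use chart_inv_prod[OF c(1) d(1)] in auto)
  ultimately have "((\<lambda>p. snd (prod_chart c' d') (map_prod F H (chart_inv (prod_chart c d) p)))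
      has_derivative (\<lambda>p. (A (fst p), B (snd p)))) (at (snd c x, snd d y))"
    by (rule has_derivative_transform_nhds)
  moreover have "isCont (map_prod F H) (x, y)"
  proof -
    have "isCont (\<lambda>p. (F (fst p), H (snd p))) (x, y)"
      by (rule isCont_Pair; rule isCont_o2[where f = fst and g = F] isCont_o2[where f = snd and g = H];
          use F H in \<open>simp add: has_mderiv_def continuous_fst continuous_snd\<close>)
    then show ?thesis by (simp add: map_prod_def case_prod_beta')
  qed
  ultimately show ?thesis
    by (simp add: has_mderiv_def map_prod_def case_prod_beta')
qed

lemma mderiv_section:
  assumes c: "good_chart c" "x \<in> fst c" and d: "good_chart d" "y \<in> fst d"
    and F: "has_mderiv (prod_chart c d) e F (x, y) A"
  shows "has_mderiv d e (\<lambda>y. F (x, y)) y (\<lambda>v. A (0, v))"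
proof -
  have "((\<lambda>z. (snd c x, z)) has_derivative (\<lambda>v. (0, v))) (at (snd d y))"
    by (auto intro!: derivative_eq_intros)
  then have "((\<lambda>z. snd e (F (chart_inv (prod_chart c d) (snd c x, z)))) has_derivative (\<lambda>v. A (0, v)))
      (at (snd d y))"
    by (rule has_derivative_compose[where g = "\<lambda>p. snd e (F (chart_inv (prod_chart c d) p))"])
      (use F in \<open>simp add: has_mderiv_def\<close>)
  moreover have ev: "\<forall>\<^sub>F z in nhds (snd d y).
      snd e (F (chart_inv (prod_chart c d) (snd c x, z))) = snd e (F (x, chart_inv d z))"
    using eventually_chart_image[OF d]
    by (rule eventually_mono) (use chart_inv_prod[OF c(1) d(1)] c good_chartD(6)[OF c] in auto)
  ultimately have "((\<lambda>z. snd e (F (x, chart_inv d z))) has_derivative (\<lambda>v. A (0, v))) (at (snd d y))"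
    by (rule has_derivative_transform_nhds)
  moreover have "isCont (\<lambda>y. F (x, y)) y"
    by (rule isCont_o2[where f = "\<lambda>y. (x, y)" and g = F])
      (use F in \<open>simp_all add: has_mderiv_def isCont_Pair\<close>)
  ultimately show ?thesis by (simp add: has_mderiv_def)
qed

lemma smooth_manifold_good: "smooth_manifold C \<Longrightarrow> good_chart (C x)" "smooth_manifold C \<Longrightarrow> x \<in> fst (C x)"
  by (auto simp: smooth_manifold_def good_chart_def)

lemma smooth_map_mderiv:
  assumes "smooth_map C D (f :: 'm::t2_space \<Rightarrow> 'n::t2_space)" "good_chart (C p)" "x \<in> fst (C p)" "f x \<in> fst (D q)"
  obtains A where "has_mderiv (C p) (D q) f x A"
proof -
  have "smooth_on (snd (C p) ` (fst (C p) \<inter> f -` fst (D q))) (snd (D q) \<circ> f \<circ> chart_inv (C p))"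
    using assms(1) by (simp add: smooth_map_def)
  from smooth_on_differentiable[OF this, of "snd (C p) x"] assms(3,4)
  have "has_mderiv (C p) (D q) f x (frechet_derivative (snd (D q) \<circ> f \<circ> chart_inv (C p)) (at (snd (C p) x)))"
    using assms(1) by (simp add: has_mderiv_def o_def smooth_map_def continuous_on_eq_continuous_at)
  then show thesis by (rule that)
qed

lemma manifold_differentiable_iff:
  "manifold_differentiable_at C D f x \<longleftrightarrow> has_mderiv (C x) (D (f x)) f x (tangent_map C D f x)"
  unfolding manifold_differentiable_at_def has_mderiv_def tangent_map_def
  by (auto simp: o_def frechet_derivative_works dest: differentiableI)

lemma mderiv_tangent_map:
  assumes "has_mderiv (C x) (D (f x)) f x A"
  shows "manifold_differentiable_at C D f x" "tangent_map C D f x = A"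
proof -
  show "tangent_map C D f x = A"
    using assms frechet_derivative_at unfolding tangent_map_def has_mderiv_def o_def by metis
  then show "manifold_differentiable_at C D f x"
    using assms by (simp add: manifold_differentiable_iff)
qed

section \<open>Left-invariant fields in the chart at the identity\<close>

lemma (in lie_group) in_carrier [simp]: "x \<in> carrier G"
  by (simp add: carrier_UNIV)

context lie_group
begin

abbreviation "one_chart \<equiv> charts G \<one>"
abbreviation "one_dom \<equiv> fst one_chart"
abbreviation "ch \<equiv> snd one_chart"
abbreviation "one_image \<equiv> ch ` one_dom"
abbreviation "e0 \<equiv> ch \<one>"

lemma good: "good_chart (charts G x)" and mem: "x \<in> fst (charts G x)"
  using smooth_manifold_good[OF smooth_manifold_charts] by auto

lemmas ci [simp] = good_chartD(6)[OF good]

lemma open_one_dom: "open one_dom" and open_one_image: "open one_image"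
  using good_chartD(1,2)[OF good] by blast+

lemma continuous_mult: "continuous_on UNIV (\<lambda>p. fst p \<otimes> snd p)"
  using smooth_mult by (simp add: smooth_map_def case_prod_beta')

definition loc_mult :: "'e \<times> 'e \<Rightarrow> 'e" where
  "loc_mult p = ch (chart_inv one_chart (fst p) \<otimes> chart_inv one_chart (snd p))"

definition loc_mult_dom :: "('e \<times> 'e) set" where
  "loc_mult_dom = {(ch a, ch b) | a b. a \<in> one_dom \<and> b \<in> one_dom \<and> a \<otimes> b \<in> one_dom}"

lemma loc_mult_ch: "a \<in> one_dom \<Longrightarrow> b \<in> one_dom \<Longrightarrow> loc_mult (ch a, ch b) = ch (a \<otimes> b)"
  by (simp add: loc_mult_def)

lemma loc_mult_dom_iff: "a \<in> one_dom \<Longrightarrow> b \<in> one_dom \<Longrightarrow> (ch a, ch b) \<in> loc_mult_dom \<longleftrightarrow> a \<otimes> b \<in> one_dom"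
  unfolding loc_mult_dom_def using inj_onD[OF good_chartD(5)[OF good]] by blast

lemma loc_mult_dom_e0: "z \<in> one_image \<Longrightarrow> (z, e0) \<in> loc_mult_dom" "z \<in> one_image \<Longrightarrow> (e0, z) \<in> loc_mult_dom"
  using mem[of \<one>] by (auto simp: loc_mult_dom_iff)

lemma loc_mult_e0: "z \<in> one_image \<Longrightarrow> loc_mult (z, e0) = z" "z \<in> one_image \<Longrightarrow> loc_mult (e0, z) = z"
  using mem[of \<one>] by (auto simp: loc_mult_ch)

lemma smooth_loc_mult: "open loc_mult_dom" "smooth_on loc_mult_dom loc_mult"
proof -
  let ?P = "prod_chart one_chart one_chart" and ?m = "\<lambda>p. fst p \<otimes> snd p"
  have P: "good_chart ?P" by (intro good_prod_chart good)
  have dom: "loc_mult_dom = snd ?P ` (fst ?P \<inter> ?m -` one_dom)"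
    by (force simp: loc_mult_dom_def)
  have "open (?m -` one_dom)"
    using continuous_mult open_one_dom by (simp add: continuous_on_open_vimage[OF open_UNIV])
  then have "openin (top_of_set (fst ?P)) (fst ?P \<inter> ?m -` one_dom)"
    by (rule openin_open_Int)
  then have "openin (top_of_set (snd ?P ` fst ?P)) loc_mult_dom"
    unfolding dom using P homeomorphism_imp_open_map unfolding good_chart_def by blast
  then show o: "open loc_mult_dom"
    using good_chartD(2)[OF P] openin_open_trans by blast
  let ?Q = "prod_charts (charts G) (charts G)"
  have "smooth_map ?Q (charts G) ?m" using smooth_mult by (simp add: case_prod_beta')
  then have "smooth_on (snd (?Q (\<one>, \<one>)) ` (fst (?Q (\<one>, \<one>)) \<inter> ?m -` one_dom)) (ch \<circ> ?m \<circ> chart_inv (?Q (\<one>, \<one>)))"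
    unfolding smooth_map_def by blast
  then have "smooth_on loc_mult_dom (ch \<circ> ?m \<circ> chart_inv ?P)"
    unfolding prod_charts_eq dom .
  then show "smooth_on loc_mult_dom loc_mult"
    by (rule smooth_on_cong[OF o, rotated])
      (use chart_inv_prod[OF good good] in \<open>auto simp: loc_mult_dom_def loc_mult_def\<close>)
qed

abbreviation "loc_mult' \<equiv> total_derivative loc_mult"

lemmas loc_mult' = smooth_total_derivative[OF smooth_loc_mult]

definition inr_blinfun :: "'e \<Rightarrow>\<^sub>L ('e \<times> 'e)" where "inr_blinfun = Blinfun (\<lambda>v. (0, v))"

lemma inr_blinfun [simp]: "inr_blinfun v = (0, v)"
  unfolding inr_blinfun_def by (subst bounded_linear_Blinfun_apply) (auto intro!: bounded_linear_intros)

text \<open>\<open>left_field y \<eta>\<close> is the left-invariant vector field with value \<open>\<eta>\<close> at the identity.\<close>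

definition left_field :: "'e \<Rightarrow> 'e \<Rightarrow>\<^sub>L 'e" where "left_field y = loc_mult' (y, e0) o\<^sub>L inr_blinfun"

lemma left_field_apply: "left_field y \<eta> = loc_mult' (y, e0) (0, \<eta>)"
  by (simp add: left_field_def)

lemma smooth_left_field: "smooth_on one_image left_field"
proof -
  have "smooth_on one_image (\<lambda>y. loc_mult' ((0, e0) + (y, 0)))"
    by (rule smooth_on_affine[OF smooth_loc_mult(1) _ _ open_one_image loc_mult'(2)])
      (auto intro!: bounded_linear_intros loc_mult_dom_e0)
  then have "smooth_on one_image (\<lambda>y. loc_mult' (y, e0))" by simp
  then show ?thesis
    unfolding left_field_def
    by (rule smooth_on_linear[OF open_one_image bounded_bilinear.bounded_linear_left[OF bounded_bilinear_blinfun_compose]])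
qed

abbreviation "left_field_deriv \<equiv> total_derivative left_field"

lemmas left_field_deriv = smooth_total_derivative[OF open_one_image smooth_left_field]

lemma loc_mult_section:
  assumes "(z, y) \<in> loc_mult_dom"
  shows "((\<lambda>w. loc_mult (z, w)) has_derivative (\<lambda>v. loc_mult' (z, y) (0, v))) (at y)"
proof -
  have "((\<lambda>w. (z, w)) has_derivative (\<lambda>v. (0, v))) (at y)" by (auto intro!: derivative_eq_intros)
  from has_derivative_compose[OF this loc_mult'(1)[OF assms]] show ?thesis .
qed

lemma loc_mult_dom_image: "(z, y) \<in> loc_mult_dom \<Longrightarrow> z \<in> one_image \<and> y \<in> one_image \<and> loc_mult (z, y) \<in> one_image"
  by (auto simp: loc_mult_dom_def loc_mult_ch)

lemma left_field_e0: "left_field e0 \<eta> = \<eta>"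
proof -
  have e: "e0 \<in> one_image" using mem by auto
  have "((\<lambda>w. loc_mult (e0, w)) has_derivative (\<lambda>v. left_field e0 v)) (at e0)"
    using loc_mult_section[OF loc_mult_dom_e0(1)[OF e]] by (simp add: left_field_apply)
  then have "((\<lambda>w. w) has_derivative (\<lambda>v. left_field e0 v)) (at e0)"
    by (rule has_derivative_transform_within_open[OF _ open_one_image e]) (simp add: loc_mult_e0)
  from has_derivative_unique[OF this has_derivative_ident] show ?thesis by meson
qed

text \<open>Associativity, differentiated in the last factor at the identity.\<close>

lemma left_field_equivariant:
  assumes zy: "(z, y) \<in> loc_mult_dom"
  shows "loc_mult' (z, y) (0, left_field y \<eta>) = left_field (loc_mult (z, y)) \<eta>"
proof -
  obtain a b where ab: "z = ch a" "y = ch b" "a \<in> one_dom" "b \<in> one_dom" "a \<otimes> b \<in> one_dom"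
    using zy by (auto simp: loc_mult_dom_def)
  have y: "y \<in> one_image" and zyS: "loc_mult (z, y) \<in> one_image" using loc_mult_dom_image[OF zy] by auto
  define V where "V = (\<lambda>w. (y, w)) -` loc_mult_dom"
  have V: "open V" "e0 \<in> V"
    unfolding V_def using loc_mult_dom_e0[OF y]
    by (auto intro!: open_vimage[OF smooth_loc_mult(1)] continuous_intros)
  have "((\<lambda>w. loc_mult (z, loc_mult (y, w))) has_derivative (\<lambda>v. loc_mult' (z, y) (0, loc_mult' (y, e0) (0, v)))) (at e0)"
    by (rule has_derivative_compose[OF loc_mult_section[OF loc_mult_dom_e0(1)[OF y]]])
      (use loc_mult_section[OF zy] in \<open>simp add: loc_mult_e0[OF y]\<close>)
  moreover have "loc_mult (z, loc_mult (y, w)) = loc_mult (loc_mult (z, y), w)" if w: "w \<in> V" for w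
  proof -
    obtain c where c: "w = ch c" "c \<in> one_dom" "b \<otimes> c \<in> one_dom"
      using w ab(2,4) loc_mult_dom_image[of y w] by (auto simp: V_def loc_mult_dom_iff)
    then show ?thesis using ab by (simp add: loc_mult_ch m_assoc)
  qed
  ultimately have "((\<lambda>w. loc_mult (loc_mult (z, y), w)) has_derivative
      (\<lambda>v. loc_mult' (z, y) (0, loc_mult' (y, e0) (0, v)))) (at e0)"
    by (rule has_derivative_transform_within_open[OF _ V])
  from has_derivative_unique[OF this loc_mult_section[OF loc_mult_dom_e0(1)[OF zyS]]]
  show ?thesis unfolding left_field_apply by meson
qed

definition bracket :: "'e \<Rightarrow> 'e \<Rightarrow> 'e" where "bracket \<xi> \<eta> = left_field_deriv e0 \<xi> \<eta> - left_field_deriv e0 \<eta> \<xi>"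

lemma left_field_flow:
  assumes h: "(h has_derivative h') (at x within T)" and hx: "h x \<in> one_image"
  shows "((\<lambda>x. left_field (h x)) has_derivative (\<lambda>v. left_field_deriv (h x) (h' v))) (at x within T)"
  using has_derivative_compose[OF h left_field_deriv(1)[OF hx]] .

text \<open>The commutator of two left-invariant fields is the left-invariant field of their bracket:
  differentiating \<open>left_field_equivariant\<close> at \<open>y = e0\<close> produces a term with a second derivative of \<open>loc_mult\<close> in the
  second factor, which is symmetric and cancels.\<close>

lemma left_field_commutator:
  assumes z: "z \<in> one_image"
  shows "left_field_deriv z (left_field z \<xi>) \<eta> - left_field_deriv z (left_field z \<eta>) \<xi> = left_field z (bracket \<xi> \<eta>)"
proof -
  have ze: "(z, e0) \<in> loc_mult_dom" and e: "e0 \<in> one_image" using loc_mult_dom_e0[OF z] mem by auto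
  define loc_mult'' where "loc_mult'' = total_derivative loc_mult'"
  have loc_mult'': "\<And>p. p \<in> loc_mult_dom \<Longrightarrow> (loc_mult' has_derivative blinfun_apply (loc_mult'' p)) (at p)"
    unfolding loc_mult''_def by (rule smooth_total_derivative[OF smooth_loc_mult(1) loc_mult'(2)])
  define V where "V = (\<lambda>w. (z, w)) -` loc_mult_dom"
  have V: "open V" "e0 \<in> V"
    unfolding V_def using ze by (auto intro!: open_vimage[OF smooth_loc_mult(1)] continuous_intros)
  have key: "left_field_deriv z (left_field z \<xi>) \<eta> = loc_mult'' (z, e0) (0, \<xi>) (0, \<eta>) + left_field z (left_field_deriv e0 \<xi> \<eta>)" for \<xi> \<eta>
  proof -
    have p: "((\<lambda>w. (z, w)) has_derivative (\<lambda>v. (0, v))) (at e0)" by (auto intro!: derivative_eq_intros)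
    have m: "((\<lambda>y. loc_mult' (z, y)) has_derivative (\<lambda>v. loc_mult'' (z, e0) (0, v))) (at e0)"
      using has_derivative_compose[OF p loc_mult''[OF ze]] .
    have l: "((\<lambda>y. (0, left_field y \<eta>)) has_derivative (\<lambda>v. (0, left_field_deriv e0 v \<eta>))) (at e0)"
      by (intro has_derivative_Pair has_derivative_const
          bounded_linear.has_derivative[OF blinfun.bounded_linear_left left_field_deriv(1)[OF e]])
    have 1: "((\<lambda>y. loc_mult' (z, y) (0, left_field y \<eta>)) has_derivative
        (\<lambda>v. loc_mult' (z, e0) (0, left_field_deriv e0 v \<eta>) + loc_mult'' (z, e0) (0, v) (0, left_field e0 \<eta>))) (at e0)"
      by (rule bounded_bilinear.FDERIV[OF bounded_bilinear_blinfun_apply m l])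
    have "((\<lambda>y. left_field (loc_mult (z, y)) \<eta>) has_derivative (\<lambda>v. left_field_deriv (loc_mult (z, e0)) (loc_mult' (z, e0) (0, v)) \<eta>)) (at e0)"
      by (rule bounded_linear.has_derivative[OF blinfun.bounded_linear_left]; rule left_field_flow[OF loc_mult_section[OF ze]])
        (simp add: loc_mult_e0 z)
    then have 2: "((\<lambda>y. left_field (loc_mult (z, y)) \<eta>) has_derivative (\<lambda>v. left_field_deriv z (left_field z v) \<eta>)) (at e0)"
      by (simp add: loc_mult_e0 z left_field_apply)
    have "((\<lambda>y. left_field (loc_mult (z, y)) \<eta>) has_derivative
        (\<lambda>v. loc_mult' (z, e0) (0, left_field_deriv e0 v \<eta>) + loc_mult'' (z, e0) (0, v) (0, left_field e0 \<eta>))) (at e0)"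
      by (rule has_derivative_transform_within_open[OF 1 V]) (auto simp: V_def left_field_equivariant)
    from has_derivative_unique[OF this 2] have
      "loc_mult' (z, e0) (0, left_field_deriv e0 \<xi> \<eta>) + loc_mult'' (z, e0) (0, \<xi>) (0, left_field e0 \<eta>) = left_field_deriv z (left_field z \<xi>) \<eta>"
      by meson
    then show ?thesis unfolding left_field_e0 by (simp add: left_field_apply add.commute)
  qed
  have "loc_mult'' (z, e0) (0, \<xi>) (0, \<eta>) = loc_mult'' (z, e0) (0, \<eta>) (0, \<xi>)"
    by (rule second_derivative_symmetric[OF smooth_loc_mult(1) ze loc_mult'(1) loc_mult''[OF ze]])
  then show ?thesis unfolding key bracket_def by (simp add: blinfun.diff_right)
qed

lemma bracket_add_left: "bracket (x + y) z = bracket x z + bracket y z"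
  and bracket_add_right: "bracket z (x + y) = bracket z x + bracket z y"
  and bracket_diff_left: "bracket (x - y) z = bracket x z - bracket y z"
  and bracket_diff_right: "bracket z (x - y) = bracket z x - bracket z y"
  and bracket_scaleR_left: "bracket (r *\<^sub>R x) z = r *\<^sub>R bracket x z"
  and bracket_scaleR_right: "bracket z (r *\<^sub>R x) = r *\<^sub>R bracket z x"
  and bracket_antisym: "bracket y x = - bracket x y"
  by (simp_all add: bracket_def blinfun.bilinear_simps algebra_simps)

lemma bounded_bilinear_bracket: "bounded_bilinear bracket"
proof -
  have 1: "bounded_bilinear (\<lambda>x y. left_field_deriv e0 x y)"
    by (rule bounded_bilinear.comp1[OF bounded_bilinear_blinfun_apply blinfun.bounded_linear_right])
  have 2: "bounded_bilinear (\<lambda>x y. left_field_deriv e0 y x)"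
    using bounded_bilinear.flip[OF 1] .
  obtain K1 where K1: "\<And>a b. norm (left_field_deriv e0 a b) \<le> norm a * norm b * K1"
    using bounded_bilinear.bounded[OF 1] by blast
  obtain K2 where K2: "\<And>a b. norm (left_field_deriv e0 b a) \<le> norm a * norm b * K2"
    using bounded_bilinear.bounded[OF 2] by blast
  show ?thesis
  proof
    show "\<exists>K. \<forall>a b. norm (bracket a b) \<le> norm a * norm b * K"
    proof (intro exI[of _ "K1 + K2"] allI)
      fix a b show "norm (bracket a b) \<le> norm a * norm b * (K1 + K2)"
        using norm_triangle_ineq4[of "left_field_deriv e0 a b" "left_field_deriv e0 b a"] K1[where a = a and b = b] K2[where a = a and b = b]
        by (simp add: bracket_def algebra_simps)
    qed
  qed (simp_all add: bracket_add_left bracket_add_right bracket_scaleR_left bracket_scaleR_right)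
qed

text \<open>The Jacobi identity is the derivative at the identity of the commutator identity; the second
  derivatives of \<open>left_field\<close> cancel in the cyclic sum.\<close>

lemma jacobi: "bracket \<zeta> (bracket \<xi> \<eta>) + bracket \<xi> (bracket \<eta> \<zeta>) + bracket \<eta> (bracket \<zeta> \<xi>) = 0"
proof -
  have e: "e0 \<in> one_image" using mem by auto
  define D2 where "D2 = total_derivative left_field_deriv"
  have D2: "\<And>y. y \<in> one_image \<Longrightarrow> (left_field_deriv has_derivative blinfun_apply (D2 y)) (at y)"
    unfolding D2_def by (rule smooth_total_derivative[OF open_one_image left_field_deriv(2)])
  let ?B = "\<lambda>x y. left_field_deriv e0 x y" and ?D = "\<lambda>x y z. D2 e0 x y z"
  have g: "((\<lambda>z. left_field_deriv z (left_field z \<xi>) \<eta>) has_derivative (\<lambda>\<zeta>. ?B (?B \<zeta> \<xi>) \<eta> + ?D \<zeta> \<xi> \<eta>)) (at e0)" for \<xi> \<eta>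
  proof -
    have "((\<lambda>z. left_field_deriv z (left_field z \<xi>)) has_derivative (\<lambda>\<zeta>. left_field_deriv e0 (left_field_deriv e0 \<zeta> \<xi>) + D2 e0 \<zeta> (left_field e0 \<xi>))) (at e0)"
      by (rule bounded_bilinear.FDERIV[OF bounded_bilinear_blinfun_apply D2[OF e]
            bounded_linear.has_derivative[OF blinfun.bounded_linear_left left_field_deriv(1)[OF e]]])
    from bounded_linear.has_derivative[OF blinfun.bounded_linear_left this, of \<eta>]
    show ?thesis by (simp add: left_field_e0 blinfun.add_left)
  qed
  have m: "?B (?B \<zeta> \<xi>) \<eta> + ?D \<zeta> \<xi> \<eta> - (?B (?B \<zeta> \<eta>) \<xi> + ?D \<zeta> \<eta> \<xi>) = ?B \<zeta> (bracket \<xi> \<eta>)" for \<zeta> \<xi> \<eta>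
  proof -
    have "((\<lambda>z. left_field z (bracket \<xi> \<eta>)) has_derivative
        (\<lambda>\<zeta>. ?B (?B \<zeta> \<xi>) \<eta> + ?D \<zeta> \<xi> \<eta> - (?B (?B \<zeta> \<eta>) \<xi> + ?D \<zeta> \<eta> \<xi>))) (at e0)"
      by (rule has_derivative_transform_within_open[OF has_derivative_diff[OF g g] open_one_image e])
        (simp add: left_field_commutator)
    moreover have "((\<lambda>z. left_field z (bracket \<xi> \<eta>)) has_derivative (\<lambda>\<zeta>. ?B \<zeta> (bracket \<xi> \<eta>))) (at e0)"
      by (rule bounded_linear.has_derivative[OF blinfun.bounded_linear_left left_field_deriv(1)[OF e]])
    ultimately have "(\<lambda>\<zeta>. ?B (?B \<zeta> \<xi>) \<eta> + ?D \<zeta> \<xi> \<eta> - (?B (?B \<zeta> \<eta>) \<xi> + ?D \<zeta> \<eta> \<xi>)) = (\<lambda>\<zeta>. ?B \<zeta> (bracket \<xi> \<eta>))"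
      by (rule has_derivative_unique)
    then show ?thesis by (rule fun_cong)
  qed
  have s: "?D x y z = ?D y x z" for x y z
    using second_derivative_symmetric[OF open_one_image e left_field_deriv(1) D2[OF e], of x y] by simp
  have b: "bracket x (bracket y z) = ?B x (bracket y z) - (?B (?B y z) x - ?B (?B z y) x)" for x y z
    by (simp add: bracket_def[of x] bracket_def[of y z] blinfun.bilinear_simps)
  show ?thesis
    unfolding b m[symmetric] using s[of \<zeta> \<xi> \<eta>] s[of \<xi> \<eta> \<zeta>] s[of \<eta> \<zeta> \<xi>] by simp
qed

lemma mderiv_left_mult:
  assumes "x \<in> fst (charts G p)" "a \<otimes> x \<in> fst (charts G q)"
  obtains A where "has_mderiv (charts G p) (charts G q) (\<lambda>h. a \<otimes> h) x A"
proof -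
  have "smooth_map (prod_charts (charts G) (charts G)) (charts G) (\<lambda>p. fst p \<otimes> snd p)"
    using smooth_mult by (simp add: case_prod_beta')
  then obtain A where "has_mderiv (prod_charts (charts G) (charts G) (a, p)) (charts G q)
      (\<lambda>p. fst p \<otimes> snd p) (a, x) A"
    by (rule smooth_map_mderiv[where p = "(a, p)" and x = "(a, x)" and q = q])
      (use assms mem in \<open>auto simp: prod_charts_eq intro!: good_prod_chart good\<close>)
  from mderiv_section[OF good mem good assms(1) this[unfolded prod_charts_eq]]
  show thesis by (intro that) simp
qed

lemma mderiv_left_field:
  assumes "k \<in> one_dom"
  shows "has_mderiv one_chart one_chart (\<lambda>h. k \<otimes> h) \<one> (left_field (ch k))"
proof -
  obtain A where A: "has_mderiv one_chart one_chart (\<lambda>h. k \<otimes> h) \<one> A"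
    by (rule mderiv_left_mult[of \<one> \<one> k \<one>]) (use mem assms in auto)
  moreover have "((\<lambda>w. ch (k \<otimes> chart_inv one_chart w)) has_derivative (\<lambda>v. left_field (ch k) v)) (at e0)"
    using loc_mult_section[OF loc_mult_dom_e0(1), of "ch k"] assms by (simp add: left_field_apply loc_mult_def)
  ultimately show ?thesis by (simp add: has_mderiv_def)
qed

lemma mderiv_left_mult_G: "has_mderiv one_chart (charts G g) (\<lambda>h. g \<otimes> h) \<one> (left_mult G g)"
proof -
  obtain A where A: "has_mderiv one_chart (charts G g) (\<lambda>h. g \<otimes> h) \<one> A"
    by (rule mderiv_left_mult[of \<one> \<one> g g]) (use mem in auto)
  then have "left_mult G g = A"
    unfolding left_mult_def by (intro mderiv_tangent_map(2)) simp
  with A show ?thesis by simp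
qed

lemma mderiv_left_triv: "has_mderiv (charts G g) one_chart (\<lambda>h. inv g \<otimes> h) g (left_triv G g)"
proof -
  obtain A where A: "has_mderiv (charts G g) one_chart (\<lambda>h. inv g \<otimes> h) g A"
    by (rule mderiv_left_mult[of g g "inv g" \<one>]) (use mem in auto)
  then have "left_triv G g = A"
    unfolding left_triv_def by (intro mderiv_tangent_map(2)) simp
  with A show ?thesis by simp
qed

lemma mderiv_id: "has_mderiv c c (\<lambda>h. h) x (\<lambda>v. v)" if "good_chart c" "x \<in> fst c"
proof -
  have "((\<lambda>y. snd c (chart_inv c y)) has_derivative (\<lambda>v. v)) (at (snd c x))"
    by (rule has_derivative_transform_nhds[OF has_derivative_ident])
      (use eventually_chart_image[OF that] in \<open>auto elim!: eventually_mono simp: good_chartD(6)[OF that(1)]\<close>)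
  then show ?thesis by (simp add: has_mderiv_def)
qed

text \<open>Left translation by any \<open>b\<close> that moves \<open>g\<close> into the chart at the identity turns the left
  trivialisation at \<open>g\<close> into \<open>left_field\<close>.\<close>

lemma mderiv_translation:
  assumes "b \<otimes> g \<in> one_dom" "has_mderiv (charts G g) one_chart (\<lambda>h. b \<otimes> h) g B"
  shows "B v = left_field (ch (b \<otimes> g)) (left_triv G g v)" "B (left_mult G g \<xi>) = left_field (ch (b \<otimes> g)) \<xi>"
proof -
  have "has_mderiv (charts G g) one_chart (\<lambda>h. (b \<otimes> g) \<otimes> (inv g \<otimes> h)) g
      (\<lambda>v. left_field (ch (b \<otimes> g)) (left_triv G g v))"
    by (rule mderiv_compose[OF good mem good _ mderiv_left_triv]) (use assms mem mderiv_left_field in auto)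
  moreover have "(\<lambda>h. (b \<otimes> g) \<otimes> (inv g \<otimes> h)) = (\<lambda>h. b \<otimes> h)"
    by (simp add: fun_eq_iff m_assoc flip: m_assoc[of g "inv g"])
  ultimately show "B v = left_field (ch (b \<otimes> g)) (left_triv G g v)"
    using mderiv_unique[OF assms(2)] by metis
  have "has_mderiv one_chart one_chart (\<lambda>h. b \<otimes> (g \<otimes> h)) \<one> (\<lambda>v. B (left_mult G g v))"
    by (rule mderiv_compose[OF good mem good _ mderiv_left_mult_G]) (use assms mem in auto)
  moreover have "(\<lambda>h. b \<otimes> (g \<otimes> h)) = (\<lambda>h. (b \<otimes> g) \<otimes> h)" by (simp add: m_assoc)
  ultimately show "B (left_mult G g \<xi>) = left_field (ch (b \<otimes> g)) \<xi>"
    using mderiv_unique[OF mderiv_left_field[OF assms(1)]] by metis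
qed

lemma left_mult_one: "left_mult G \<one> \<xi> = \<xi>"
  using mderiv_unique[OF mderiv_left_mult_G[of \<one>] mderiv_left_field[OF mem]] by (simp add: left_field_e0)

lemma lie_bracket_eq: "lie_bracket G = bracket"
proof (intro ext)
  fix \<xi> \<eta>
  have e: "e0 \<in> one_image" using mem by auto
  have lf: "frechet_derivative (local_field (charts G) \<one> (\<lambda>g. left_mult G g \<eta>)) (at e0) \<xi> = left_field_deriv e0 \<xi> \<eta>" for \<xi> \<eta>
  proof -
    have "local_field (charts G) \<one> (\<lambda>g. left_mult G g \<eta>) y = left_field y \<eta>" if yS: "y \<in> one_image" for y
    proof -
      obtain x where x: "y = ch x" "x \<in> one_dom" using yS by blast
      obtain B where B: "has_mderiv (charts G x) one_chart (\<lambda>h. \<one> \<otimes> h) x B"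
        by (rule mderiv_left_mult[of x x \<one> \<one>]) (use mem x in auto)
      have "frechet_derivative (ch \<circ> chart_inv (charts G x)) (at (snd (charts G x) x)) = B"
        using frechet_derivative_at[OF B[unfolded has_mderiv_def, THEN conjunct2]] by (simp add: o_def)
      then show ?thesis
        using mderiv_translation(2)[OF _ B] x by (simp add: local_field_def Let_def)
    qed
    then have "(local_field (charts G) \<one> (\<lambda>g. left_mult G g \<eta>) has_derivative (\<lambda>v. left_field_deriv e0 v \<eta>)) (at e0)"
      by (intro has_derivative_transform_within_open[OF bounded_linear.has_derivative[OF
              blinfun.bounded_linear_left left_field_deriv(1)[OF e]] open_one_image e]) simp
    then show ?thesis using frechet_derivative_at by metis
  qed
  show "lie_bracket G \<xi> \<eta> = bracket \<xi> \<eta>"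
    by (simp add: lie_bracket_def field_bracket_def left_mult_one lf bracket_def)
qed

end

section \<open>The reduced Lagrangian and the Hamiltonian vector field\<close>

text \<open>Covectors are identified with vectors through the inner product, because the estimates for
  differential equations are stated for Euclidean state spaces.\<close>

definition riesz :: "('e::euclidean_space \<Rightarrow>\<^sub>L real) \<Rightarrow> 'e" where
  "riesz \<nu> = (\<Sum>b\<in>Basis. \<nu> b *\<^sub>R b)"

lemma riesz_inner [simp]: "riesz \<nu> \<bullet> v = \<nu> v"
proof -
  have "riesz \<nu> \<bullet> v = (\<Sum>b\<in>Basis. (v \<bullet> b) * \<nu> b)"
    by (simp add: riesz_def inner_sum_left inner_commute[of v] mult.commute)
  also have "\<dots> = \<nu> (\<Sum>b\<in>Basis. (v \<bullet> b) *\<^sub>R b)"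
    by (simp add: blinfun.bilinear_simps blinfun.sum_right)
  finally show ?thesis by (simp add: euclidean_representation)
qed

lemma riesz_blinfun_inner [simp]: "riesz (blinfun_inner_right w) = w"
  by (simp add: riesz_def euclidean_representation)

lemma blinfun_inner_riesz [simp]: "blinfun_inner_right (riesz \<nu>) = \<nu>"
  by (rule blinfun_eqI) simp

lemma bounded_linear_riesz: "bounded_linear riesz"
  unfolding riesz_def
  by (intro bounded_linear_sum bounded_linear_scaleR_const[OF blinfun.bounded_linear_left])

lemma riesz_inject: "riesz \<mu> = riesz \<nu> \<longleftrightarrow> \<mu> = \<nu>"
  by (metis blinfun_inner_riesz)

lemma linear_sum_basis_inner:
  fixes f :: "'e::euclidean_space \<Rightarrow> real"
  assumes "linear f"
  shows "(\<Sum>b\<in>Basis. f b *\<^sub>R b) \<bullet> v = f v"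
proof -
  have "(\<Sum>b\<in>Basis. f b *\<^sub>R b) \<bullet> v = (\<Sum>b\<in>Basis. (v \<bullet> b) * f b)"
    by (simp add: inner_sum_left inner_commute[of v] mult.commute)
  also have "\<dots> = f (\<Sum>b\<in>Basis. (v \<bullet> b) *\<^sub>R b)"
    by (simp add: linear_sum[OF assms] linear_cmul[OF assms])
  finally show ?thesis by (simp add: euclidean_representation)
qed

locale regular_lagrangian = lie_group G
  for G :: "('g::{t2_space,second_countable_topology}, 'e::euclidean_space) lie_group_data"
    (structure) +
  fixes L :: "(real \<Rightarrow> 'g) set \<Rightarrow> real" and l :: "'e \<times> 'e \<Rightarrow> real"
  assumes smooth_L: "smooth_lagrangian G L"
    and l_def: "l = reduced_lagrangian G L"
    and regular: "hyper_regular G l"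
begin

lemma vector_space_chart [simp]: "vector_space_charts x = vs_chart"
  by (simp add: vector_space_charts_def)

lemma smooth_l: "smooth_on UNIV l"
proof -
  let ?P = "prod_chart one_chart vs_chart :: ('g \<times> 'e \<times> 'e, 'e \<times> 'e \<times> 'e) chart"
  let ?T = "trivialised_lagrangian G L"
  have e: "e0 \<in> one_image" using mem by auto
  have "smooth_on (snd (prod_charts (charts G) vector_space_charts (\<one>, 0)) `
      (fst (prod_charts (charts G) vector_space_charts (\<one>, 0)) \<inter> ?T -` fst (vector_space_charts (0::real))))
      (snd (vector_space_charts (0::real)) \<circ> ?T \<circ> chart_inv (prod_charts (charts G) vector_space_charts (\<one>, 0)))"
    using smooth_L unfolding smooth_lagrangian_def smooth_map_def by blast
  then have s: "smooth_on (snd ?P ` fst ?P) (\<lambda>p. ?T (chart_inv ?P p))"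
    by (simp add: prod_charts_eq o_def del: prod_chart_sel)
  have "smooth_on UNIV (\<lambda>p. ?T (chart_inv ?P ((e0, 0) + (0, p))))"
  proof (rule smooth_on_affine[OF good_chartD(2) _ _ open_UNIV s])
    show "good_chart ?P" by (intro good_prod_chart good good_vs_chart)
    show "bounded_linear (Pair (0::'e) :: 'e \<times> 'e \<Rightarrow> _)" by (intro bounded_linear_intros)
    show "(e0, 0) + (0, p) \<in> snd ?P ` fst ?P" for p
      using mem[of \<one>] by (auto intro!: image_eqI[of _ _ "(\<one>, p)"])
  qed
  moreover have "chart_inv ?P ((e0, 0) + (0, p)) = (\<one>, p)" for p
    using chart_inv_prod[OF good good_vs_chart e, of p] mem by simp
  ultimately have "smooth_on UNIV (\<lambda>p. ?T (\<one>, p))" by simp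
  moreover have "(\<lambda>p. ?T (\<one>, p)) = l" by (auto simp: l_def reduced_lagrangian_def)
  ultimately show ?thesis by simp
qed

abbreviation "l' \<equiv> total_derivative l"
abbreviation "l'' \<equiv> total_derivative l'"

lemmas l' = smooth_total_derivative[OF open_UNIV smooth_l, simplified]
lemmas l'' = smooth_total_derivative[OF open_UNIV l'(2), simplified]

lemma l''_symmetric: "l'' z v w = l'' z w v"
  by (rule second_derivative_symmetric[OF open_UNIV UNIV_I l'(1) l''(1)])

lemma d_xi_apply: "d_xi l \<xi> u v = l' (\<xi>, u) (v, 0)"
proof -
  have p: "((\<lambda>x. (x, u)) has_derivative (\<lambda>v. (v, 0))) (at \<xi>)" by (auto intro!: derivative_eq_intros)
  have d: "((\<lambda>x. l (x, u)) has_derivative (\<lambda>v. l' (\<xi>, u) (v, 0))) (at \<xi>)"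
    using has_derivative_compose[OF p l'(1)] .
  show ?thesis
    unfolding d_xi_def frechet_derivative_at[OF d, symmetric]
    by (simp add: bounded_linear_Blinfun_apply has_derivative_bounded_linear[OF d])
qed

lemma d_u_apply: "d_u l \<xi> u v = l' (\<xi>, u) (0, v)"
proof -
  have p: "((\<lambda>x. (\<xi>, x)) has_derivative (\<lambda>v. (0, v))) (at u)" by (auto intro!: derivative_eq_intros)
  have d: "((\<lambda>x. l (\<xi>, x)) has_derivative (\<lambda>v. l' (\<xi>, u) (0, v))) (at u)"
    using has_derivative_compose[OF p l'(1)] .
  show ?thesis
    unfolding d_u_def frechet_derivative_at[OF d, symmetric]
    by (simp add: bounded_linear_Blinfun_apply has_derivative_bounded_linear[OF d])
qed

text \<open>The solution \<open>u\<close> of the Legendre relation \<open>\<nu> = \<delta>\<ell>/\<delta>u\<close>, a function of \<open>\<xi>\<close> and \<open>\<nu>\<close> alone, read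
  off from \<open>phi_inv\<close> over the point with \<open>g = \<one>\<close> and \<open>\<mu> = 0\<close>.\<close>

definition accel :: "'e \<times> 'e \<Rightarrow> 'e" where
  "accel = (\<lambda>(\<xi>, q). fst (snd (snd
     (phi_inv l (\<one>, \<xi>, 0, blinfun_inner_right q) :: ('g, 'e) pontryagin2))))"

lemma phi_bij: "bij_betw (phi :: ('g, 'e) pontryagin2 \<Rightarrow> _) (W_c l) UNIV"
  using regular by (simp add: hyper_regular_def)

lemma phi_phi_inv: "phi (phi_inv l x :: ('g, 'e) pontryagin2) = x"
  and phi_inv_W_c: "(phi_inv l x :: ('g, 'e) pontryagin2) \<in> W_c l"
  using phi_bij bij_betw_inv_into_right[OF phi_bij, of x] inv_into_into[of x phi "W_c l"]
  unfolding phi_inv_def bij_betw_def by auto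

lemma phi_inv_phi: "p \<in> W_c l \<Longrightarrow> phi_inv l (phi (p :: ('g, 'e) pontryagin2)) = p"
  unfolding phi_inv_def using bij_betw_inv_into_left[OF phi_bij] .

lemma accel_unique:
  assumes "\<nu> = d_u l \<xi> u"
  shows "accel (\<xi>, riesz \<nu>) = u"
proof -
  have "((\<one>, \<xi>, u, 0, \<nu>) :: ('g, 'e) pontryagin2) \<in> W_c l" using assms by (simp add: W_c_def)
  from phi_inv_phi[OF this] show ?thesis by (simp add: accel_def phi_def)
qed

lemma d_u_accel: "d_u l \<xi> (accel (\<xi>, q)) = blinfun_inner_right q"
proof -
  obtain g \<xi>' u \<mu> \<nu> where p: "phi_inv l (\<one>, \<xi>, 0, blinfun_inner_right q) = ((g, \<xi>', u, \<mu>, \<nu>) :: ('g, 'e) pontryagin2)"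
    by (metis prod_cases5)
  have "phi ((g, \<xi>', u, \<mu>, \<nu>) :: ('g, 'e) pontryagin2) = (\<one>, \<xi>, 0, blinfun_inner_right q)"
    using phi_phi_inv p by metis
  moreover have "((g, \<xi>', u, \<mu>, \<nu>) :: ('g, 'e) pontryagin2) \<in> W_c l" using phi_inv_W_c p by metis
  moreover have "accel (\<xi>, q) = u" by (simp add: accel_def p)
  ultimately show ?thesis by (simp add: phi_def W_c_def)
qed

lemma smooth_accel: "smooth_on UNIV accel"
proof -
  let ?C = "cotangent_TG_charts G (\<one>, 0)" and ?D = "pontryagin2_charts G (\<one>, 0)"
  let ?P = "prod_chart one_chart vs_chart :: (('g, 'e) cotangent_TG, ('e, 'e) cotangent_TG) chart"
  have e: "e0 \<in> one_image" using mem by auto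
  have "smooth_map (cotangent_TG_charts G) (pontryagin2_charts G) (phi_inv l)"
    using regular by (simp add: hyper_regular_def)
  then have s: "smooth_on (snd ?C ` (fst ?C \<inter> phi_inv l -` fst ?D)) (snd ?D \<circ> phi_inv l \<circ> chart_inv ?C)"
    unfolding smooth_map_def by blast
  have "fst (phi_inv l x :: ('g, 'e) pontryagin2) = fst x" for x
    using phi_phi_inv[of x] by (auto simp: phi_def split: prod.splits)
  then have "fst ?C \<inter> phi_inv l -` fst ?D = fst ?P"
    by (auto simp: prod_charts_eq mem_Times_iff)
  with s have s: "smooth_on (snd ?P ` fst ?P) (\<lambda>p. snd ?D (phi_inv l (chart_inv ?P p)))"
    by (simp add: prod_charts_eq o_def del: prod_chart_sel)
  let ?H = "\<lambda>z::'e \<times> 'e. (0::'e, fst z, 0::'e \<Rightarrow>\<^sub>L real, blinfun_inner_right (snd z))"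
  have "smooth_on UNIV (\<lambda>z. snd ?D (phi_inv l (chart_inv ?P ((e0, 0) + ?H z))))"
  proof (rule smooth_on_affine[OF good_chartD(2) _ _ open_UNIV s])
    show "good_chart ?P" by (intro good_prod_chart good good_vs_chart)
    show "bounded_linear ?H"
      by (intro bounded_linear_intros bounded_linear_compose[OF bounded_linear_blinfun_inner_right])
    show "(e0, 0) + ?H p \<in> snd ?P ` fst ?P" for p
      using mem[of \<one>] by (auto intro!: image_eqI[of _ _ "(\<one>, snd (?H p))"])
  qed
  moreover have "chart_inv ?P ((e0, 0) + ?H z) = (\<one>, snd (?H z))" for z
    using chart_inv_prod[OF good good_vs_chart e, of "snd (?H z)"] mem by simp
  ultimately have "smooth_on UNIV (\<lambda>z. snd ?D (phi_inv l (\<one>, snd (?H z))))" by simp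
  from smooth_on_linear[OF open_UNIV _ this, of "\<lambda>p. fst (snd (snd p))"]
  have "smooth_on UNIV (\<lambda>z. fst (snd (snd (snd ?D (phi_inv l (\<one>, snd (?H z)))))))"
    using bounded_linear_compose[OF bounded_linear_fst bounded_linear_compose[OF bounded_linear_snd bounded_linear_snd]]
    by simp
  moreover have "(\<lambda>z. fst (snd (snd (snd ?D (phi_inv l (\<one>, snd (?H z))))))) = accel"
    by (auto simp: prod_charts_eq accel_def fun_eq_iff)
  ultimately show ?thesis by simp
qed

abbreviation "accel' \<equiv> total_derivative accel"

lemmas accel' = smooth_total_derivative[OF open_UNIV smooth_accel, simplified]

lemma l'_accel: "l' (\<xi>, accel (\<xi>, q)) (0, v) = q \<bullet> v"
  using d_u_accel[of \<xi> q] d_u_apply[of \<xi> "accel (\<xi>, q)" v] by simp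

text \<open>The linearised Legendre relation, obtained by differentiating \<open>l'_accel\<close>.  It replaces a formula
  for the derivative of \<open>accel\<close>.\<close>

lemma l''_accel:
  "l'' (\<xi>, accel (\<xi>, q)) (a, accel' (\<xi>, q) (a, c)) (0, v) = c \<bullet> v"
proof -
  have p: "((\<lambda>z. (fst z, accel z)) has_derivative (\<lambda>h. (fst h, accel' (\<xi>, q) h))) (at (\<xi>, q))"
    by (intro has_derivative_Pair has_derivative_fst has_derivative_ident accel'(1))
  have "((\<lambda>z. l' (fst z, accel z) (0, v)) has_derivative
      (\<lambda>h. l'' (\<xi>, accel (\<xi>, q)) (fst h, accel' (\<xi>, q) h) (0, v))) (at (\<xi>, q))"
    using bounded_linear.has_derivative[OF blinfun.bounded_linear_left has_derivative_compose[OF p l''(1)]]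
    by simp
  moreover have "(\<lambda>z. l' (fst z, accel z) (0, v)) = (\<lambda>z. snd z \<bullet> v)"
    by (auto simp: fun_eq_iff l'_accel)
  ultimately have 1: "((\<lambda>z. snd z \<bullet> v) has_derivative
      (\<lambda>h. l'' (\<xi>, accel (\<xi>, q)) (fst h, accel' (\<xi>, q) h) (0, v))) (at (\<xi>, q))"
    by simp
  have 2: "((\<lambda>z. snd z \<bullet> v) has_derivative (\<lambda>h. snd h \<bullet> v)) (at (\<xi>, q))"
    by (auto intro!: derivative_eq_intros)
  have "(\<lambda>h. l'' (\<xi>, accel (\<xi>, q)) (fst h, accel' (\<xi>, q) h) (0, v)) = (\<lambda>h. snd h \<bullet> v)"
    by (rule has_derivative_unique[OF 1 2])
  from fun_cong[OF this, of "(a, c)"] show ?thesis by simp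
qed

text \<open>The coadjoint action \<open>ad*\<close>, transported to vectors.\<close>

definition coad :: "'e \<Rightarrow> 'e \<Rightarrow> 'e" where
  "coad \<xi> p = (\<Sum>b\<in>Basis. (p \<bullet> bracket \<xi> b) *\<^sub>R b)"

lemma coad_inner [simp]: "coad \<xi> p \<bullet> v = p \<bullet> bracket \<xi> v"
  unfolding coad_def
  by (rule linear_sum_basis_inner) (auto intro!: linearI simp: bracket_add_right bracket_scaleR_right inner_right_distrib)

lemma riesz_ad_star: "riesz (ad_star G \<xi> \<mu>) = coad \<xi> (riesz \<mu>)"
proof (rule euclidean_eqI)
  fix b :: 'e
  have "bounded_linear (\<lambda>\<eta>. \<mu> (bracket \<xi> \<eta>))"
    by (intro bounded_linear_compose[OF blinfun.bounded_linear_right]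
        bounded_bilinear.bounded_linear_right[OF bounded_bilinear_bracket])
  then show "riesz (ad_star G \<xi> \<mu>) \<bullet> b = coad \<xi> (riesz \<mu>) \<bullet> b"
    by (simp add: ad_star_def lie_bracket_eq bounded_linear_Blinfun_apply)
qed

lemma bounded_bilinear_coad: "bounded_bilinear coad"
proof -
  have add: "coad (x + y) p = coad x p + coad y p" "coad x (p + q) = coad x p + coad x q" for x y p q
    by (simp_all add: coad_def bracket_add_left inner_right_distrib inner_left_distrib scaleR_add_left sum.distrib)
  have scale: "coad (r *\<^sub>R x) p = r *\<^sub>R coad x p" "coad x (r *\<^sub>R p) = r *\<^sub>R coad x p" for r x p
    by (simp_all add: coad_def bracket_scaleR_left scaleR_sum_right)
  obtain K where K: "\<And>a b. norm (bracket a b) \<le> norm a * norm b * K" "K \<ge> 0"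
    using bounded_bilinear.nonneg_bounded[OF bounded_bilinear_bracket] by blast
  show ?thesis
  proof
    show "\<exists>K. \<forall>x p. norm (coad x p) \<le> norm x * norm p * K"
    proof (intro exI[of _ "K * DIM('e)"] allI)
      fix x p :: 'e
      have "norm (coad x p) \<le> (\<Sum>b\<in>(Basis::'e set). norm ((p \<bullet> bracket x b) *\<^sub>R b))"
        unfolding coad_def by (rule norm_sum)
      also have "\<dots> \<le> (\<Sum>b\<in>(Basis::'e set). norm x * norm p * K)"
      proof (rule sum_mono)
        fix b :: 'e assume b: "b \<in> Basis"
        have "\<bar>p \<bullet> bracket x b\<bar> \<le> norm p * norm (bracket x b)" by (rule Cauchy_Schwarz_ineq2)
        also have "\<dots> \<le> norm p * (norm x * K)"
          using K(1)[of x b] b by (intro mult_left_mono) auto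
        finally show "norm ((p \<bullet> bracket x b) *\<^sub>R b) \<le> norm x * norm p * K"
          using b by (simp add: mult_ac)
      qed
      finally show "norm (coad x p) \<le> norm x * norm p * (K * DIM('e))" by (simp add: mult_ac)
    qed
  qed (use add scale in auto)
qed

definition riesz_fst :: "(('e \<times> 'e) \<Rightarrow>\<^sub>L real) \<Rightarrow> 'e" where
  "riesz_fst A = (\<Sum>b\<in>Basis. A (b, 0) *\<^sub>R b)"

lemma riesz_fst_inner [simp]: "riesz_fst A \<bullet> v = A (v, 0)"
proof -
  have "linear (\<lambda>v. A (v, 0))"
    using blinfun.add_right[of A "(_, 0)" "(_, 0)"] blinfun.scaleR_right[of A _ "(_, 0)"]
    by (intro linearI) simp_all
  then show ?thesis unfolding riesz_fst_def by (rule linear_sum_basis_inner)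
qed

lemma bounded_linear_riesz_fst: "bounded_linear riesz_fst"
  unfolding riesz_fst_def
  by (intro bounded_linear_sum bounded_linear_scaleR_const[OF blinfun.bounded_linear_left])

lemma riesz_d_xi: "riesz (d_xi l \<xi> u) = riesz_fst (l' (\<xi>, u))"
  by (rule euclidean_eqI) (simp add: d_xi_apply)

text \<open>The HOHP equations as a vector field on coordinates \<open>(y, \<xi>, p, q)\<close> of \<open>(g, \<xi>, \<mu>, \<nu>)\<close>.\<close>

definition hohp_field :: "'e \<times> 'e \<times> 'e \<times> 'e \<Rightarrow> 'e \<times> 'e \<times> 'e \<times> 'e" where
  "hohp_field z = (left_field (fst z) (fst (snd z)), accel (fst (snd z), snd (snd (snd z))),
     coad (fst (snd z)) (fst (snd (snd z))),
     riesz_fst (l' (fst (snd z), accel (fst (snd z), snd (snd (snd z))))) - fst (snd (snd z)))"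

definition hohp_field_lin :: "'e \<times> 'e \<times> 'e \<times> 'e \<Rightarrow> 'e \<times> 'e \<times> 'e \<times> 'e \<Rightarrow> 'e \<times> 'e \<times> 'e \<times> 'e" where
  "hohp_field_lin z h =
     (left_field (fst z) (fst (snd h)) + left_field_deriv (fst z) (fst h) (fst (snd z)),
      accel' (fst (snd z), snd (snd (snd z))) (fst (snd h), snd (snd (snd h))),
      coad (fst (snd z)) (fst (snd (snd h))) + coad (fst (snd h)) (fst (snd (snd z))),
      riesz_fst (l'' (fst (snd z), accel (fst (snd z), snd (snd (snd z))))
        (fst (snd h), accel' (fst (snd z), snd (snd (snd z))) (fst (snd h), snd (snd (snd h)))))
      - fst (snd (snd h)))"

lemma hohp_field_has_derivative:
  assumes "z \<in> one_image \<times> UNIV"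
  shows "(hohp_field has_derivative hohp_field_lin z) (at z)"
proof -
  have y: "fst z \<in> one_image" using assms by auto
  have q: "((\<lambda>z. (fst (snd z), snd (snd (snd z)))) has_derivative (\<lambda>h. (fst (snd h), snd (snd (snd h))))) (at z)"
    for z :: "'e \<times> 'e \<times> 'e \<times> 'e"
    by (intro has_derivative_Pair has_derivative_fst has_derivative_snd has_derivative_ident)
  note a = has_derivative_compose[OF q accel'(1)]
  have x: "((\<lambda>z. fst (snd z)) has_derivative (\<lambda>h. fst (snd h))) (at z)" for z :: "'e \<times> 'e \<times> 'e \<times> 'e"
    by (intro has_derivative_fst has_derivative_snd has_derivative_ident)
  have p: "((\<lambda>z. fst (snd (snd z))) has_derivative (\<lambda>h. fst (snd (snd h)))) (at z)" for z :: "'e \<times> 'e \<times> 'e \<times> 'e"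
    by (intro has_derivative_fst has_derivative_snd has_derivative_ident)
  note lx = has_derivative_compose[OF has_derivative_Pair[OF x a] l''(1)]
  show ?thesis
    unfolding hohp_field_def[abs_def] hohp_field_lin_def[abs_def]
    by (intro has_derivative_Pair has_derivative_diff a p
        bounded_bilinear.FDERIV[OF bounded_bilinear_coad x p]
        bounded_linear.has_derivative[OF bounded_linear_riesz_fst lx]
        bounded_bilinear.FDERIV[OF bounded_bilinear_blinfun_apply
          left_field_flow[OF has_derivative_fst[OF has_derivative_ident] y] x])
qed

definition hohp_field' :: "'e \<times> 'e \<times> 'e \<times> 'e \<Rightarrow> (('e \<times> 'e \<times> 'e \<times> 'e) \<Rightarrow>\<^sub>L ('e \<times> 'e \<times> 'e \<times> 'e))" where
  "hohp_field' z = Blinfun (hohp_field_lin z)"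

lemma hohp_field'_apply: "z \<in> one_image \<times> UNIV \<Longrightarrow> blinfun_apply (hohp_field' z) = hohp_field_lin z"
  unfolding hohp_field'_def using bounded_linear_Blinfun_apply has_derivative_bounded_linear[OF hohp_field_has_derivative] by blast

lemma hohp_field': "z \<in> one_image \<times> UNIV \<Longrightarrow> (hohp_field has_derivative hohp_field' z) (at z)"
  using hohp_field_has_derivative hohp_field'_apply by metis

lemma continuous_hohp_field': "continuous_on (one_image \<times> UNIV) hohp_field'"
proof (rule continuous_on_blinfun_componentwise)
  fix h :: "'e \<times> 'e \<times> 'e \<times> 'e"
  let ?X = "one_image \<times> (UNIV :: ('e \<times> 'e \<times> 'e) set)"
  note blin = bounded_bilinear.continuous_on[OF bounded_bilinear_blinfun_apply]
  note bcoad = bounded_bilinear.continuous_on[OF bounded_bilinear_coad]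
  have cL: "continuous_on ?X (\<lambda>z. left_field (fst z))" "continuous_on ?X (\<lambda>z. left_field_deriv (fst z))"
    by (rule continuous_on_compose2[OF smooth_on_continuous[OF smooth_left_field]]
        continuous_on_compose2[OF smooth_on_continuous[OF left_field_deriv(2)]]; auto intro!: continuous_intros)+
  have cq: "continuous_on ?X (\<lambda>z. (fst (snd z), snd (snd (snd z))))" by (intro continuous_intros)
  have ca: "continuous_on ?X (\<lambda>z. accel (fst (snd z), snd (snd (snd z))))"
    "continuous_on ?X (\<lambda>z. accel' (fst (snd z), snd (snd (snd z))))"
    using continuous_on_compose2[OF smooth_on_continuous[OF smooth_accel] cq]
      continuous_on_compose2[OF smooth_on_continuous[OF accel'(2)] cq] by auto
  have cl: "continuous_on ?X (\<lambda>z. l'' (fst (snd z), accel (fst (snd z), snd (snd (snd z)))))"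
    by (rule continuous_on_compose2[OF smooth_on_continuous[OF l''(2)]])
      (auto intro!: continuous_intros ca)
  have "continuous_on ?X (\<lambda>z. hohp_field_lin z h)"
    unfolding hohp_field_lin_def
    by (intro continuous_on_Pair continuous_on_add continuous_on_diff blin bcoad cL ca cl
        bounded_linear.continuous_on[OF bounded_linear_riesz_fst]
        continuous_on_const continuous_on_fst continuous_on_snd continuous_on_id)
  then show "continuous_on ?X (\<lambda>z. hohp_field' z h)"
    by (rule continuous_on_eq) (simp add: hohp_field'_apply)
qed

text \<open>The symplectic form in left-trivialised tangent vectors \<open>(\<eta>, \<delta>\<xi>, \<delta>p, \<delta>q)\<close>; of the base point
  only \<open>p\<close> enters.\<close>

definition triv_form :: "'e \<Rightarrow> 'e \<times> 'e \<times> 'e \<times> 'e \<Rightarrow> 'e \<times> 'e \<times> 'e \<times> 'e \<Rightarrow> real" where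
  "triv_form p v w = - (fst (snd (snd v)) \<bullet> fst w) - snd (snd (snd v)) \<bullet> fst (snd w)
     + fst (snd (snd w)) \<bullet> fst v + snd (snd (snd w)) \<bullet> fst (snd v) + p \<bullet> bracket (fst v) (fst w)"

text \<open>The linearised equations in the trivialisation: the \<open>\<eta>\<close>-component satisfies
  \<open>d\<eta>/dt = \<delta>\<xi> - [\<xi>, \<eta>]\<close>.\<close>

definition triv_lin :: "'e \<times> 'e \<times> 'e \<times> 'e \<Rightarrow> 'e \<times> 'e \<times> 'e \<times> 'e \<Rightarrow> 'e \<times> 'e \<times> 'e \<times> 'e" where
  "triv_lin z h = (fst (snd h) - bracket (fst (snd z)) (fst h), snd (hohp_field_lin z h))"

text \<open>Infinitesimal invariance.  The terms in \<open>\<mu>\<close> cancel by the Jacobi identity, those in the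
  Lagrangian by the symmetry of its second derivative together with the linearised Legendre
  relation.\<close>

lemma triv_form_invariant:
  "triv_form p (triv_lin (y, \<xi>, p, q) v) w + triv_form p v (triv_lin (y, \<xi>, p, q) w) + coad \<xi> p \<bullet> bracket (fst v) (fst w) = 0"
proof -
  obtain \<eta>1 a1 b1 c1 where v: "v = (\<eta>1, a1, b1, c1)" by (metis prod_cases4)
  obtain \<eta>2 a2 b2 c2 where w: "w = (\<eta>2, a2, b2, c2)" by (metis prod_cases4)
  define x where "x = (\<xi>, accel (\<xi>, q))"
  define u1 where "u1 = accel' (\<xi>, q) (a1, c1)"
  define u2 where "u2 = accel' (\<xi>, q) (a2, c2)"
  have c1: "c1 \<bullet> k = l'' x (a1, u1) (0, k)" and c2: "c2 \<bullet> k = l'' x (a2, u2) (0, k)" for k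
    unfolding x_def u1_def u2_def by (simp_all add: l''_accel)
  have split: "l'' x A (s, t) = l'' x A (s, 0) + l'' x A (0, t)" for A s t
    using blinfun.add_right[of "l'' x A" "(s, 0)" "(0, t)"] by simp
  have sym: "l'' x (a1, u1) (a2, 0) + c1 \<bullet> u2 = l'' x (a2, u2) (a1, 0) + c2 \<bullet> u1"
    unfolding c1 c2 split[symmetric] by (rule l''_symmetric)
  have jac: "p \<bullet> bracket \<xi> (bracket \<eta>1 \<eta>2) = p \<bullet> bracket (bracket \<xi> \<eta>1) \<eta>2 + p \<bullet> bracket \<eta>1 (bracket \<xi> \<eta>2)"
  proof -
    have a: "bracket \<eta>1 (bracket \<eta>2 \<xi>) = - bracket \<eta>1 (bracket \<xi> \<eta>2)"
      using bracket_scaleR_right[of \<eta>1 "-1" "bracket \<xi> \<eta>2"] by (simp add: bracket_antisym[where y = \<eta>2 and x = \<xi>])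
    have b: "bracket \<eta>2 (bracket \<xi> \<eta>1) = - bracket (bracket \<xi> \<eta>1) \<eta>2" by (rule bracket_antisym)
    have "bracket \<xi> (bracket \<eta>1 \<eta>2) - bracket \<eta>1 (bracket \<xi> \<eta>2) - bracket (bracket \<xi> \<eta>1) \<eta>2 = 0"
      using jacobi[of \<xi> \<eta>1 \<eta>2] unfolding a b by simp
    then have "bracket \<xi> (bracket \<eta>1 \<eta>2) = bracket (bracket \<xi> \<eta>1) \<eta>2 + bracket \<eta>1 (bracket \<xi> \<eta>2)"
      by (simp add: algebra_simps)
    then show ?thesis by (simp add: inner_right_distrib)
  qed
  have tv: "triv_lin (y, \<xi>, p, q) v = (a1 - bracket \<xi> \<eta>1, u1, coad \<xi> b1 + coad a1 p, riesz_fst (l'' x (a1, u1)) - b1)"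
    and tw: "triv_lin (y, \<xi>, p, q) w = (a2 - bracket \<xi> \<eta>2, u2, coad \<xi> b2 + coad a2 p, riesz_fst (l'' x (a2, u2)) - b2)"
    by (simp_all add: triv_lin_def hohp_field_lin_def v w x_def u1_def u2_def)
  have an: "p \<bullet> bracket a2 \<eta>1 = - (p \<bullet> bracket \<eta>1 a2)"
    by (subst bracket_antisym) simp
  show ?thesis
    unfolding tv tw
    using sym jac an
    by (simp add: v w triv_form_def inner_diff_left inner_diff_right inner_left_distrib inner_right_distrib
        bracket_diff_left bracket_diff_right)
qed

end

section \<open>Invariance of the symplectic form along the flow\<close>

text \<open>Product rule for \<open>h = A\<^sup>-\<^sup>1 w\<close>.  The lower bound on \<open>A\<close> replaces differentiability of the inverse: up
  to the factor \<open>1/c\<close>, the remainder of \<open>h\<close> is bounded by \<open>w \<sigma> - A \<sigma> (h t + (\<sigma> - t) d)\<close>, which has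
  derivative \<open>0\<close> at \<open>t\<close>.\<close>

lemma vector_derivative_of_inverse_image:
  fixes A :: "real \<Rightarrow> 'e::real_normed_vector \<Rightarrow>\<^sub>L 'f::real_normed_vector"
  assumes A: "(A has_vector_derivative A') (at t within T)"
    and w: "(w has_vector_derivative w') (at t within T)"
    and eq: "\<And>\<sigma>. \<sigma> \<in> T \<Longrightarrow> A \<sigma> (h \<sigma>) = w \<sigma>"
    and c: "c > 0" "\<And>\<sigma> v. \<sigma> \<in> T \<Longrightarrow> c * norm v \<le> norm (A \<sigma> v)"
    and t: "t \<in> T" and d: "A t d = w' - A' (h t)"
  shows "(h has_vector_derivative d) (at t within T)"
proof -
  define r where "r \<sigma> = w \<sigma> - A \<sigma> (h t) - A \<sigma> ((\<sigma> - t) *\<^sub>R d)" for \<sigma>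
  have "((\<lambda>\<sigma>. (\<sigma> - t) *\<^sub>R d) has_vector_derivative d) (at t within T)"
    by (auto simp: has_vector_derivative_def intro!: derivative_eq_intros)
  from has_vector_derivative_diff[OF has_vector_derivative_diff[OF w
        bounded_linear.has_vector_derivative[OF blinfun.bounded_linear_left[of "h t"] A]]
      bounded_bilinear.has_vector_derivative[OF bounded_bilinear_blinfun_apply A this]]
  have r: "(r has_derivative (\<lambda>_. 0)) (at t within T)"
    unfolding r_def by (simp add: has_vector_derivative_def d)
  have r0: "r t = 0" using eq[OF t] by (simp add: r_def)
  have bound: "norm (h \<sigma> - h t - (\<sigma> - t) *\<^sub>R d) \<le> norm (r \<sigma>) / c" if "\<sigma> \<in> T" for \<sigma>
  proof -
    have "A \<sigma> (h \<sigma> - h t - (\<sigma> - t) *\<^sub>R d) = r \<sigma>"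
      using eq[OF that] by (simp add: r_def blinfun.diff_right)
    then show ?thesis using c(2)[OF that, of "h \<sigma> - h t - (\<sigma> - t) *\<^sub>R d"] c(1)
      by (simp add: field_simps)
  qed
  show ?thesis
    unfolding has_vector_derivative_def has_derivative_within_alt
  proof (intro conjI allI impI)
    show "bounded_linear (\<lambda>x. x *\<^sub>R d)" by (intro bounded_linear_intros)
    fix e :: real assume "e > 0"
    then have "e * c > 0" using c by simp
    then obtain \<delta> where \<delta>: "\<delta> > 0" "\<And>y. y \<in> T \<Longrightarrow> norm (y - t) < \<delta> \<Longrightarrow> norm (r y - r t - 0) \<le> e * c * norm (y - t)"
      using r unfolding has_derivative_within_alt by blast
    show "\<exists>d'>0. \<forall>y\<in>T. norm (y - t) < d' \<longrightarrow> norm (h y - h t - (y - t) *\<^sub>R d) \<le> e * norm (y - t)"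
    proof (intro exI[of _ \<delta>] conjI ballI impI \<delta>(1))
      fix y assume y: "y \<in> T" "norm (y - t) < \<delta>"
      have "norm (h y - h t - (y - t) *\<^sub>R d) \<le> norm (r y) / c" by (rule bound[OF y(1)])
      also have "\<dots> \<le> (e * c * norm (y - t)) / c"
        using \<delta>(2)[OF y] c(1) by (intro divide_right_mono) (auto simp: r0)
      finally show "norm (h y - h t - (y - t) *\<^sub>R d) \<le> e * norm (y - t)" using c(1) by simp
    qed
  qed
qed

text \<open>Differentiability of the coordinate expression forces continuity of the map itself, provided that
  the values stay in the target chart.\<close>

lemma mderivI:
  assumes c: "good_chart c" "x \<in> fst c" and d: "good_chart d"
    and ev: "\<forall>\<^sub>F k in nhds (snd c x). F (chart_inv c k) \<in> fst d"
    and A: "((\<lambda>k. snd d (F (chart_inv c k))) has_derivative A) (at (snd c x))"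
  shows "has_mderiv c d F x A"
proof -
  have Fx: "F x \<in> fst d" using eventually_nhds_x_imp_x[OF ev] good_chartD(6)[OF c(1)] c(2) by simp
  have "isCont (\<lambda>k. snd d (F (chart_inv c k))) (snd c x)" using A by (rule has_derivative_continuous)
  then have 1: "isCont (\<lambda>k. chart_inv d (snd d (F (chart_inv c k)))) (snd c x)"
    by (rule isCont_o2[where g = "chart_inv d"]) (use good_chartD(6,8)[OF d] Fx c good_chartD(6)[OF c(1)] in simp)
  have "\<forall>\<^sub>F k in nhds (snd c x). chart_inv d (snd d (F (chart_inv c k))) = F (chart_inv c k)"
    using ev by eventually_elim (simp add: good_chartD(6)[OF d])
  with 1 have 2: "isCont (\<lambda>k. F (chart_inv c k)) (snd c x)"
    using isCont_cong by fast
  have 3: "isCont (\<lambda>x. F (chart_inv c (snd c x))) x"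
    by (rule isCont_o2[where f = "snd c" and g = "\<lambda>k. F (chart_inv c k)", OF good_chartD(7)[OF c] 2])
  have "\<forall>\<^sub>F y in nhds x. F (chart_inv c (snd c y)) = F y"
    using eventually_nhds_in_open[OF good_chartD(1)[OF c(1)] c(2)]
    by eventually_elim (simp add: good_chartD(6)[OF c(1)])
  then have "isCont F x" using 3 isCont_cong by fast
  with A show ?thesis by (simp add: has_mderiv_def)
qed

context regular_lagrangian
begin

abbreviation "ctg_chart g \<equiv> prod_chart (charts G g) (vs_chart :: ('e \<times> ('e \<Rightarrow>\<^sub>L real) \<times> ('e \<Rightarrow>\<^sub>L real), _) chart)"
abbreviation "state_chart \<equiv> prod_chart one_chart (vs_chart :: ('e \<times> 'e \<times> 'e, _) chart)"

lemma good_ctg: "good_chart (ctg_chart g)" and good_state: "good_chart state_chart"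
  by (intro good_prod_chart good good_vs_chart)+

lemma mem_ctg: "x \<in> fst (ctg_chart (fst x))"
  using mem by (simp add: mem_Times_iff)

lemma state_chart_image: "snd state_chart ` fst state_chart = one_image \<times> UNIV"
  by (simp add: map_prod_surj_on)

definition riesz3 :: "'e \<times> ('e \<Rightarrow>\<^sub>L real) \<times> ('e \<Rightarrow>\<^sub>L real) \<Rightarrow> 'e \<times> 'e \<times> 'e" where
  "riesz3 v = (fst v, riesz (fst (snd v)), riesz (snd (snd v)))"

definition riesz3_inv :: "'e \<times> 'e \<times> 'e \<Rightarrow> 'e \<times> ('e \<Rightarrow>\<^sub>L real) \<times> ('e \<Rightarrow>\<^sub>L real)" where
  "riesz3_inv v = (fst v, blinfun_inner_right (fst (snd v)), blinfun_inner_right (snd (snd v)))"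

lemma riesz3_inv [simp]: "riesz3_inv (riesz3 v) = v"
  by (simp add: riesz3_def riesz3_inv_def)

lemma riesz3_derivative: "(riesz3 has_derivative riesz3) (at x)" "(riesz3_inv has_derivative riesz3_inv) (at y)"
  unfolding riesz3_def[abs_def] riesz3_inv_def[abs_def]
  by (intro has_derivative_Pair has_derivative_fst has_derivative_snd has_derivative_ident
      bounded_linear.has_derivative[OF bounded_linear_riesz]
      bounded_linear.has_derivative[OF bounded_linear_blinfun_inner_right])+

definition translate :: "'g \<Rightarrow> ('g, 'e) cotangent_TG \<Rightarrow> 'g \<times> 'e \<times> 'e \<times> 'e" where
  "translate b = map_prod (\<lambda>h. b \<otimes> h) riesz3"

definition translate_inv :: "'g \<Rightarrow> 'g \<times> 'e \<times> 'e \<times> 'e \<Rightarrow> ('g, 'e) cotangent_TG" where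
  "translate_inv b = map_prod (\<lambda>h. inv b \<otimes> h) riesz3_inv"

lemma translate_inv [simp]: "translate_inv b (translate b x) = x"
  by (cases x) (simp add: translate_def translate_inv_def flip: m_assoc)

lemma mem_state: "translate b x \<in> one_dom \<times> UNIV \<longleftrightarrow> b \<otimes> fst x \<in> one_dom"
  by (cases x) (simp add: translate_def)

definition left_trivialise :: "'g \<Rightarrow> ('e, 'e) cotangent_TG \<Rightarrow> 'e \<times> 'e \<times> 'e \<times> 'e" where
  "left_trivialise g v = (left_triv G g (fst v), riesz3 (snd v))"

lemma canonical_symplectic_form_trivialised:
  "canonical_symplectic_form G x v w =
     triv_form (riesz (fst (snd (snd x)))) (left_trivialise (fst x) v) (left_trivialise (fst x) w)"
  by (cases x; cases v; cases w)
    (simp add: canonical_symplectic_form_def Let_def triv_form_def left_trivialise_def riesz3_def lie_bracket_eq)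

lemma mderiv_translate:
  assumes "b \<otimes> fst x \<in> one_dom"
  shows "has_mderiv (ctg_chart (fst x)) state_chart (translate b) x
    (\<lambda>v. map_prod (left_field (ch (b \<otimes> fst x))) id (left_trivialise (fst x) v))"
proof -
  obtain B where B: "has_mderiv (charts G (fst x)) one_chart (\<lambda>h. b \<otimes> h) (fst x) B"
    by (rule mderiv_left_mult[of "fst x" "fst x" b \<one>]) (use mem assms in auto)
  have "has_mderiv (ctg_chart (fst x)) state_chart (translate b) (fst x, snd x) (map_prod B riesz3)"
    unfolding translate_def
    by (rule mderiv_prod[OF good mem good_vs_chart _ B]) (simp_all add: mderiv_vs riesz3_derivative)
  moreover have "map_prod B riesz3 = (\<lambda>v. map_prod (left_field (ch (b \<otimes> fst x))) id (left_trivialise (fst x) v))"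
    using mderiv_translation(1)[OF assms B] by (auto simp: left_trivialise_def fun_eq_iff)
  ultimately show ?thesis by simp
qed

lemma mderiv_translate_inv:
  assumes "b \<otimes> fst x \<in> one_dom"
  obtains A where "has_mderiv state_chart (ctg_chart (fst x)) (translate_inv b) (translate b x) A"
proof -
  obtain B where B: "has_mderiv one_chart (charts G (fst x)) (\<lambda>h. inv b \<otimes> h) (b \<otimes> fst x) B"
    by (rule mderiv_left_mult[of "b \<otimes> fst x" \<one> "inv b" "fst x"])
      (use mem assms in \<open>auto simp flip: m_assoc\<close>)
  have "has_mderiv state_chart (ctg_chart (fst x)) (translate_inv b) (b \<otimes> fst x, riesz3 (snd x))
      (map_prod B riesz3_inv)"
    unfolding translate_inv_def
    by (rule mderiv_prod[OF good assms good_vs_chart _ B]) (simp_all add: mderiv_vs riesz3_derivative)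
  moreover have "translate b x = (b \<otimes> fst x, riesz3 (snd x))" by (cases x) (simp add: translate_def)
  ultimately show thesis using that by simp
qed

lemma isCont_left_mult: "isCont (\<lambda>h. b \<otimes> h) x"
  using mderiv_left_mult[of x x b "b \<otimes> x"] mem unfolding has_mderiv_def by metis

definition traj :: "real \<Rightarrow> (real \<Rightarrow> ('g, 'e) cotangent_TG) \<Rightarrow> bool" where
  "traj a c \<longleftrightarrow> (\<exists>\<gamma>. hohp_solution G l a \<gamma> \<and> c = (\<lambda>t. phi (\<gamma> t)))"

text \<open>By left-invariance the trivialised equations have the same coordinate expression after any left
  translation, so the single chart at the identity suffices.\<close>

lemma traj_ode_curve:
  assumes "traj a c"
  shows "ode_curve (fst state_chart) (snd state_chart) hohp_field 0 a (\<lambda>\<tau>. translate b (c \<tau>))"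
proof -
  obtain \<gamma> where \<gamma>: "hohp_solution G l a \<gamma>" "c = (\<lambda>t. phi (\<gamma> t))"
    using assms unfolding traj_def by blast
  obtain g \<xi> u \<mu> \<nu> \<nu>' where \<gamma>_eq: "\<gamma> = (\<lambda>t. (g t, \<xi> t, u t, \<mu> t, \<nu> t))"
    and eqs0: "\<forall>t\<in>{0..a}.
        (\<mu> has_vector_derivative ad_star G (\<xi> t) (\<mu> t)) (at t within {0..a}) \<and>
        (\<nu> has_vector_derivative \<nu>' t) (at t within {0..a}) \<and>
        \<mu> t = d_xi l (\<xi> t) (u t) - \<nu>' t \<and>
        \<nu> t = d_u l (\<xi> t) (u t) \<and>
        has_velocity (charts G) g (left_mult G (g t) (\<xi> t)) t {0..a} \<and>
        (\<xi> has_vector_derivative u t) (at t within {0..a})"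
    using \<gamma>(1) unfolding hohp_solution_def by blast
  note eqs = eqs0[THEN bspec]
  have c: "c = (\<lambda>t. (g t, \<xi> t, \<mu> t, \<nu> t))" by (simp add: \<gamma>(2) \<gamma>_eq phi_def)
  have tr: "(\<lambda>\<tau>. translate b (c \<tau>)) = (\<lambda>\<tau>. (b \<otimes> g \<tau>, \<xi> \<tau>, riesz (\<mu> \<tau>), riesz (\<nu> \<tau>)))"
    by (simp add: c translate_def riesz3_def)
  have d: "((\<lambda>\<sigma>. riesz (\<mu> \<sigma>)) has_vector_derivative coad (\<xi> \<tau>) (riesz (\<mu> \<tau>))) (at \<tau> within {0..a})"
    "((\<lambda>\<sigma>. riesz (\<nu> \<sigma>)) has_vector_derivative riesz_fst (l' (\<xi> \<tau>, u \<tau>)) - riesz (\<mu> \<tau>)) (at \<tau> within {0..a})"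
    "(\<xi> has_vector_derivative accel (\<xi> \<tau>, riesz (\<nu> \<tau>))) (at \<tau> within {0..a})"
    "accel (\<xi> \<tau>, riesz (\<nu> \<tau>)) = u \<tau>"
    "continuous (at \<tau> within {0..a}) g"
    if \<tau>: "\<tau> \<in> {0..a}" for \<tau>
  proof -
    show "((\<lambda>\<sigma>. riesz (\<mu> \<sigma>)) has_vector_derivative coad (\<xi> \<tau>) (riesz (\<mu> \<tau>))) (at \<tau> within {0..a})"
      using bounded_linear.has_vector_derivative[OF bounded_linear_riesz] eqs[OF \<tau>] riesz_ad_star by metis
    have "riesz (\<nu>' \<tau>) = riesz_fst (l' (\<xi> \<tau>, u \<tau>)) - riesz (\<mu> \<tau>)"
      using eqs[OF \<tau>] linear_diff[OF bounded_linear.linear[OF bounded_linear_riesz], of "d_xi l (\<xi> \<tau>) (u \<tau>)" "\<nu>' \<tau>"]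
      by (simp add: riesz_d_xi)
    then show "((\<lambda>\<sigma>. riesz (\<nu> \<sigma>)) has_vector_derivative riesz_fst (l' (\<xi> \<tau>, u \<tau>)) - riesz (\<mu> \<tau>)) (at \<tau> within {0..a})"
      using bounded_linear.has_vector_derivative[OF bounded_linear_riesz] eqs[OF \<tau>] by metis
    show ac: "accel (\<xi> \<tau>, riesz (\<nu> \<tau>)) = u \<tau>" using eqs[OF \<tau>] accel_unique by blast
    show "(\<xi> has_vector_derivative accel (\<xi> \<tau>, riesz (\<nu> \<tau>))) (at \<tau> within {0..a})"
      unfolding ac using eqs[OF \<tau>] by blast
    show "continuous (at \<tau> within {0..a}) g" using eqs[OF \<tau>] by (simp add: has_velocity_def)
  qed
  show ?thesis
    unfolding ode_curve_def
  proof (intro conjI ballI impI)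
    show "continuous_on {0..a} (\<lambda>\<tau>. translate b (c \<tau>))"
      unfolding tr continuous_on_eq_continuous_within
      using d has_vector_derivative_continuous
      by (intro ballI continuous_Pair continuous_within_compose3[OF isCont_left_mult]) blast+
    fix \<tau> assume \<tau>: "\<tau> \<in> {0..a}" and "translate b (c \<tau>) \<in> fst state_chart"
    then have U: "b \<otimes> g \<tau> \<in> one_dom" by (simp add: mem_state c)
    obtain B where B: "has_mderiv (charts G (g \<tau>)) one_chart (\<lambda>h. b \<otimes> h) (g \<tau>) B"
      by (rule mderiv_left_mult[of "g \<tau>" "g \<tau>" b \<one>]) (use mem U in auto)
    have "((\<lambda>\<sigma>. ch (b \<otimes> g \<sigma>)) has_vector_derivative B (left_mult G (g \<tau>) (\<xi> \<tau>))) (at \<tau> within {0..a})"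
      by (rule mderiv_curve[where c = g and t = \<tau> and d = "charts G (g \<tau>)" and e = one_chart and H = "\<lambda>h. b \<otimes> h",
            OF good mem \<tau> _ _ B])
        (use eqs[OF \<tau>] in \<open>auto simp: has_velocity_def o_def\<close>)
    then have "((\<lambda>\<sigma>. ch (b \<otimes> g \<sigma>)) has_vector_derivative left_field (ch (b \<otimes> g \<tau>)) (\<xi> \<tau>)) (at \<tau> within {0..a})"
      by (simp add: mderiv_translation(2)[OF U B])
    from has_vector_derivative_Pair[OF this has_vector_derivative_Pair[OF d(3)[OF \<tau>]
          has_vector_derivative_Pair[OF d(1,2)[OF \<tau>]]]]
    show "((\<lambda>\<sigma>. snd state_chart (translate b (c \<sigma>))) has_vector_derivative
        hohp_field (snd state_chart (translate b (c \<tau>)))) (at \<tau> within {0..a})"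
      by (simp add: c translate_def riesz3_def hohp_field_def d(4)[OF \<tau>])
  qed
qed

lemma traj_near:
  assumes c: "traj a c" and t0: "t0 \<in> {0..a}" and V: "open V" "translate b (c t0) \<in> V"
  obtains d where "d > 0" "\<And>\<tau>. \<tau> \<in> {0..a} \<Longrightarrow> \<bar>\<tau> - t0\<bar> < d \<Longrightarrow> translate b (c \<tau>) \<in> V"
proof -
  have "continuous_on {0..a} (\<lambda>\<tau>. translate b (c \<tau>))"
    using traj_ode_curve[OF c] by (simp add: ode_curve_def)
  then have "((\<lambda>\<tau>. translate b (c \<tau>)) \<longlongrightarrow> translate b (c t0)) (at t0 within {0..a})"
    using t0 by (simp add: continuous_on_def)
  from topological_tendstoD[OF this V]
  obtain d where "d > 0" "\<And>\<tau>. \<tau> \<in> {0..a} \<Longrightarrow> \<tau> \<noteq> t0 \<Longrightarrow> dist \<tau> t0 < d \<Longrightarrow> translate b (c \<tau>) \<in> V"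
    unfolding eventually_at by blast
  then show thesis using V(2) by (intro that[of d]) (metis dist_real_def)+
qed

lemmas hohp_field_chart = good_chartD(1)[OF good_state]
  good_state[unfolded good_chart_def state_chart_image, THEN conjunct2, THEN conjunct2]
  open_Times[OF open_one_image open_UNIV] hohp_field' continuous_hohp_field'

text \<open>In a chart around the first trajectory this is \<open>ode_curve_unique\<close>; bisection globalises it.\<close>

lemma traj_unique:
  assumes c: "traj a c1" "traj a c2" "c1 0 = c2 0" and t: "t \<in> {0..a}"
  shows "c1 t = c2 t"
proof -
  have "(0::real) \<le> 0 \<and> t \<le> a \<longrightarrow> c1 0 = c2 0 \<longrightarrow> c1 t = c2 t"
  proof (rule Bolzano[where P = "\<lambda>s t. 0 \<le> s \<and> t \<le> a \<longrightarrow> c1 s = c2 s \<longrightarrow> c1 t = c2 t"])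
    show "0 \<le> t" using t by simp
    fix t0 assume "0 \<le> t0" "t0 \<le> t"
    then have t0: "t0 \<in> {0..a}" using t by simp
    define b where "b = inv (fst (c1 t0))"
    have "translate b (c1 t0) \<in> fst state_chart" using mem by (simp add: mem_state b_def)
    from traj_near[OF c(1) t0 good_chartD(1)[OF good_state] this]
    obtain d where d: "d > 0" "\<And>\<tau>. \<tau> \<in> {0..a} \<Longrightarrow> \<bar>\<tau> - t0\<bar> < d \<Longrightarrow> translate b (c1 \<tau>) \<in> fst state_chart"
      by blast
    show "\<exists>d>0. \<forall>s t. s \<le> t0 \<and> t0 \<le> t \<and> t - s < d \<longrightarrow> 0 \<le> s \<and> t \<le> a \<longrightarrow> c1 s = c2 s \<longrightarrow> c1 t = c2 t"
    proof (intro exI[of _ d] conjI allI impI d(1))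
      fix s t assume st: "s \<le> t0 \<and> t0 \<le> t \<and> t - s < d" "0 \<le> s \<and> t \<le> a" and eq: "c1 s = c2 s"
      have im: "(\<lambda>\<tau>. translate b (c1 \<tau>)) ` {s..t} \<subseteq> fst state_chart"
      proof (rule image_subsetI)
        fix \<tau> assume "\<tau> \<in> {s..t}"
        then show "translate b (c1 \<tau>) \<in> fst state_chart" using st by (intro d(2)) auto
      qed
      have o: "ode_curve (fst state_chart) (snd state_chart) hohp_field s t (\<lambda>\<tau>. translate b (c \<tau>))" if "traj a c" for c
        by (rule ode_curve_subset[OF traj_ode_curve[OF that]]) (use st in auto)
      have sle: "s \<le> t" using st by simp
      have "translate b (c2 t) = translate b (c1 t)"
        by (rule ode_curve_unique[where \<tau> = t, OF hohp_field_chart sle o[OF c(1)] im o[OF c(2)]]) (simp_all add: eq sle)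
      then show "c1 t = c2 t" by (metis translate_inv)
    qed
  qed auto
  then show ?thesis using c(3) t by simp
qed

lemma triv_form_has_vector_derivative:
  assumes p: "(p has_vector_derivative p') (at t within T)"
    and v: "(v has_vector_derivative v') (at t within T)"
    and w: "(w has_vector_derivative w') (at t within T)"
  shows "((\<lambda>\<sigma>. triv_form (p \<sigma>) (v \<sigma>) (w \<sigma>)) has_vector_derivative
    triv_form (p t) v' (w t) + triv_form (p t) (v t) w' + p' \<bullet> bracket (fst (v t)) (fst (w t))) (at t within T)"
proof -
  note inn = bounded_bilinear.has_vector_derivative[OF bounded_bilinear_inner]
  note f = bounded_linear.has_vector_derivative[OF bounded_linear_fst]
  note s = bounded_linear.has_vector_derivative[OF bounded_linear_snd]
  have "((\<lambda>\<sigma>. - (fst (snd (snd (v \<sigma>))) \<bullet> fst (w \<sigma>)) - snd (snd (snd (v \<sigma>))) \<bullet> fst (snd (w \<sigma>))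
     + fst (snd (snd (w \<sigma>))) \<bullet> fst (v \<sigma>) + snd (snd (snd (w \<sigma>))) \<bullet> fst (snd (v \<sigma>))
     + p \<sigma> \<bullet> bracket (fst (v \<sigma>)) (fst (w \<sigma>))) has_vector_derivative
     - (fst (snd (snd (v t))) \<bullet> fst w' + fst (snd (snd v')) \<bullet> fst (w t))
     - (snd (snd (snd (v t))) \<bullet> fst (snd w') + snd (snd (snd v')) \<bullet> fst (snd (w t)))
     + (fst (snd (snd (w t))) \<bullet> fst v' + fst (snd (snd w')) \<bullet> fst (v t))
     + (snd (snd (snd (w t))) \<bullet> fst (snd v') + snd (snd (snd w')) \<bullet> fst (snd (v t)))
     + (p t \<bullet> (bracket (fst (v t)) (fst w') + bracket (fst v') (fst (w t))) + p' \<bullet> bracket (fst (v t)) (fst (w t))))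
     (at t within T)"
    by (intro has_vector_derivative_add has_vector_derivative_diff has_vector_derivative_minus inn f s p v w
        bounded_bilinear.has_vector_derivative[OF bounded_bilinear_bracket])
  then show ?thesis
    unfolding triv_form_def by (rule has_vector_derivative_eq_rhs) (simp add: inner_add_right algebra_simps)
qed

text \<open>A solution of the linearised equation in the chart, left-trivialised, satisfies the trivialised
  linearised equations; hence the symplectic form of two of them is constant in time.  The two
  solutions are indexed by \<open>bool\<close>, so that each step is carried out once for both.\<close>

lemma linearised_form_constant:
  assumes st: "s \<le> t"
    and z: "\<And>\<tau>. \<tau> \<in> {s..t} \<Longrightarrow> z \<tau> \<in> one_image \<times> UNIV"
      "\<And>\<tau>. \<tau> \<in> {s..t} \<Longrightarrow> (z has_vector_derivative hohp_field (z \<tau>)) (at \<tau> within {s..t})"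
    and near: "\<And>\<tau>. \<tau> \<in> {s..t} \<Longrightarrow> norm (left_field (fst (z \<tau>)) - id_blinfun) < 1/2"
    and M: "\<And>\<tau>. \<tau> \<in> {s..t} \<Longrightarrow> (M has_vector_derivative (hohp_field' (z \<tau>) o\<^sub>L M \<tau>)) (at \<tau> within {s..t})"
    and hs: "\<And>i::bool. M s (v i) = map_prod (left_field (fst (z s))) id (hs i)"
    and ht: "\<And>i. M t (v i) = map_prod (left_field (fst (z t))) id (ht i)"
  shows "triv_form (fst (snd (snd (z s)))) (hs True) (hs False) = triv_form (fst (snd (snd (z t)))) (ht True) (ht False)"
proof -
  \<comment> \<open>Close to the identity the left-invariant frame is invertible with a uniform bound.\<close>
  have coer: "(1/2) * norm k \<le> norm (left_field (fst (z \<tau>)) k)" if "\<tau> \<in> {s..t}" for \<tau> k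
  proof -
    have "norm ((left_field (fst (z \<tau>)) - id_blinfun) k) \<le> (1/2) * norm k"
      using near[OF that] norm_blinfun[of "left_field (fst (z \<tau>)) - id_blinfun" k]
      by (meson less_imp_le mult_right_mono norm_ge_zero order_trans)
    then show ?thesis
      using norm_triangle_ineq3[of "left_field (fst (z \<tau>)) k" k] by (simp add: blinfun.diff_left)
  qed
  have inj: "inj (left_field (fst (z \<tau>)))" if "\<tau> \<in> {s..t}" for \<tau>
  proof (rule injI)
    fix x y assume "left_field (fst (z \<tau>)) x = left_field (fst (z \<tau>)) y"
    then show "x = y" using coer[OF that, of "x - y"] by (simp add: blinfun.diff_right)
  qed
  have surj: "surj (left_field (fst (z \<tau>)))" if "\<tau> \<in> {s..t}" for \<tau>
    by (rule linear_injective_imp_surjective[OF bounded_linear.linear[OF blinfun.bounded_linear_right] inj[OF that]]) simp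
  define h where
    "h i \<tau> = (inv_into UNIV (left_field (fst (z \<tau>))) (fst (M \<tau> (v i))), snd (M \<tau> (v i)))" for i \<tau>
  have hL: "left_field (fst (z \<tau>)) (fst (h i \<tau>)) = fst (M \<tau> (v i))" if "\<tau> \<in> {s..t}" for i \<tau>
    unfolding h_def fst_conv by (rule f_inv_into_f) (simp add: surj[OF that])
  have h_eq: "h i \<tau> = k" if "\<tau> \<in> {s..t}" "M \<tau> (v i) = map_prod (left_field (fst (z \<tau>))) id k" for i \<tau> k
  proof -
    have "left_field (fst (z \<tau>)) (fst (h i \<tau>)) = left_field (fst (z \<tau>)) (fst k)"
      unfolding hL[OF that(1)] that(2) by (cases k) simp
    then have "fst (h i \<tau>) = fst k" using injD[OF inj[OF that(1)]] by blast
    moreover have "snd (h i \<tau>) = snd k" by (cases k) (simp add: h_def that(2))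
    ultimately show ?thesis by (rule prod_eqI)
  qed
  have h': "(h i has_vector_derivative triv_lin (z \<tau>) (h i \<tau>)) (at \<tau> within {s..t})"
    if \<tau>: "\<tau> \<in> {s..t}" for i \<tau>
  proof -
    obtain y \<xi> p q where zt: "z \<tau> = (y, \<xi>, p, q)" by (metis prod_cases4)
    have y: "y \<in> one_image" using z(1)[OF \<tau>] zt by simp
    have m: "((\<lambda>\<sigma>. M \<sigma> (v i)) has_vector_derivative hohp_field_lin (z \<tau>) (M \<tau> (v i))) (at \<tau> within {s..t})"
      using bounded_linear.has_vector_derivative[OF blinfun.bounded_linear_left M[OF \<tau>], of "v i"]
      by (simp add: hohp_field'_apply[OF z(1)[OF \<tau>]])
    have "((\<lambda>\<sigma>. fst (z \<sigma>)) has_vector_derivative left_field y \<xi>) (at \<tau> within {s..t})"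
      using bounded_linear.has_vector_derivative[OF bounded_linear_fst z(2)[OF \<tau>]] by (simp add: hohp_field_def zt)
    then have "((\<lambda>\<sigma>. left_field (fst (z \<sigma>))) has_derivative (\<lambda>k. left_field_deriv (fst (z \<tau>)) (k *\<^sub>R left_field y \<xi>))) (at \<tau> within {s..t})"
      unfolding has_vector_derivative_def by (rule left_field_flow) (use y zt in simp)
    then have A: "((\<lambda>\<sigma>. left_field (fst (z \<sigma>))) has_vector_derivative left_field_deriv y (left_field y \<xi>)) (at \<tau> within {s..t})"
      by (simp add: has_vector_derivative_def zt blinfun.scaleR_right)
    have 1: "((\<lambda>\<sigma>. fst (h i \<sigma>)) has_vector_derivative fst (snd (h i \<tau>)) - bracket \<xi> (fst (h i \<tau>))) (at \<tau> within {s..t})"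
    proof (rule vector_derivative_of_inverse_image[OF A
          bounded_linear.has_vector_derivative[OF bounded_linear_fst m] hL _ coer \<tau>])
      have "fst (hohp_field_lin (z \<tau>) (M \<tau> (v i))) = left_field y (fst (snd (h i \<tau>))) + left_field_deriv y (left_field y (fst (h i \<tau>))) \<xi>"
        using hL[OF \<tau>, of i] by (simp add: hohp_field_lin_def zt h_def)
      then show "left_field (fst (z \<tau>)) (fst (snd (h i \<tau>)) - bracket \<xi> (fst (h i \<tau>))) =
          fst (hohp_field_lin (z \<tau>) (M \<tau> (v i))) - left_field_deriv y (left_field y \<xi>) (fst (h i \<tau>))"
        using left_field_commutator[OF y, of \<xi> "fst (h i \<tau>)"] by (simp add: zt blinfun.diff_right algebra_simps)
    qed simp_all
    have 2: "((\<lambda>\<sigma>. snd (h i \<sigma>)) has_vector_derivative snd (hohp_field_lin (z \<tau>) (h i \<tau>))) (at \<tau> within {s..t})"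
      using bounded_linear.has_vector_derivative[OF bounded_linear_snd m] by (simp add: h_def hohp_field_lin_def)
    show ?thesis
      using has_vector_derivative_Pair[OF 1 2] by (simp add: triv_lin_def zt)
  qed
  have zero: "((\<lambda>\<tau>. triv_form (fst (snd (snd (z \<tau>)))) (h True \<tau>) (h False \<tau>)) has_derivative (\<lambda>_. 0)) (at \<tau> within {s..t})"
    if \<tau>: "\<tau> \<in> {s..t}" for \<tau>
  proof -
    obtain y \<xi> p q where zt: "z \<tau> = (y, \<xi>, p, q)" by (metis prod_cases4)
    have "((\<lambda>\<tau>. fst (snd (snd (z \<tau>)))) has_vector_derivative coad \<xi> p) (at \<tau> within {s..t})"
      using bounded_linear.has_vector_derivative[OF bounded_linear_compose[OF bounded_linear_fst
            bounded_linear_compose[OF bounded_linear_snd bounded_linear_snd]] z(2)[OF \<tau>]]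
      by (simp add: hohp_field_def zt)
    from triv_form_has_vector_derivative[OF this h'[OF \<tau>, of True] h'[OF \<tau>, of False]]
    show ?thesis
      using triv_form_invariant[of p y \<xi> q "h True \<tau>" "h False \<tau>"]
      by (simp add: has_vector_derivative_def zt)
  qed
  have "\<exists>k. \<forall>\<tau>\<in>{s..t}. triv_form (fst (snd (snd (z \<tau>)))) (h True \<tau>) (h False \<tau>) = k"
    by (rule has_derivative_zero_constant[OF _ zero]) simp
  then have "triv_form (fst (snd (snd (z s)))) (h True s) (h False s) = triv_form (fst (snd (snd (z t)))) (h True t) (h False t)"
    using st by force
  moreover have "h i s = hs i" "h i t = ht i" for i
    using h_eq hs ht st by simp_all
  ultimately show ?thesis by simp
qed

text \<open>Differentiability belongs to the property: it is propagated in time together with invariance.\<close>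

definition preserved_at :: "(('g, 'e) cotangent_TG \<Rightarrow> ('g, 'e) cotangent_TG) \<Rightarrow> ('g, 'e) cotangent_TG \<Rightarrow> bool" where
  "preserved_at F x \<longleftrightarrow> (\<exists>A. has_mderiv (ctg_chart (fst x)) (ctg_chart (fst (F x))) F x A \<and>
     (\<forall>v w. canonical_symplectic_form G (F x) (A v) (A w) = canonical_symplectic_form G x v w))"

text \<open>After translating \<open>C x t0\<close> to the identity, the trajectory stays on a short time interval in the part
  \<open>V\<close> of the chart where the left-invariant frame is close to the identity matrix.  There the
  derivative at time \<open>t\<close> is \<open>M t\<close> composed with the one at time \<open>s\<close>.\<close>

lemma preserved_at_step:
  assumes C: "\<And>x. traj a (C x)" and t0: "t0 \<in> {0..a}"
  obtains d where "d > 0"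
    "\<And>s t. 0 \<le> s \<Longrightarrow> s \<le> t0 \<Longrightarrow> t0 \<le> t \<Longrightarrow> t \<le> a \<Longrightarrow> t - s < d \<Longrightarrow>
      preserved_at (\<lambda>x. C x s) x \<Longrightarrow> preserved_at (\<lambda>x. C x t) x"
proof -
  define b where "b = inv (fst (C x t0))"
  define V where "V = (one_dom \<inter> ch -` (one_image \<inter> (\<lambda>y. norm (left_field y - id_blinfun)) -` {..<1/2})) \<times> (UNIV :: ('e \<times> 'e \<times> 'e) set)"
  have "open (one_image \<inter> (\<lambda>y. norm (left_field y - id_blinfun)) -` {..<1/2})"
    by (intro continuous_open_preimage[OF _ open_one_image] continuous_intros smooth_on_continuous[OF smooth_left_field])
  then have V: "open V"
    unfolding V_def
    by (intro open_Times open_UNIV continuous_open_preimage[OF good_chartD(3)[OF good] open_one_dom])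
  have "left_field e0 = id_blinfun" by (rule blinfun_eqI) (simp add: left_field_e0)
  then have "translate b (C x t0) \<in> V"
    using mem[of \<one>] by (cases "C x t0") (simp add: V_def translate_def b_def)
  from traj_near[OF C t0 V this]
  obtain d where d: "d > 0" "\<And>\<tau>. \<tau> \<in> {0..a} \<Longrightarrow> \<bar>\<tau> - t0\<bar> < d \<Longrightarrow> translate b (C x \<tau>) \<in> V" by blast
  show thesis
  proof (rule that[OF d(1)])
    fix s t assume st: "0 \<le> s" "s \<le> t0" "t0 \<le> t" "t \<le> a" "t - s < d" and P: "preserved_at (\<lambda>x. C x s) x"
    have inV: "translate b (C x \<tau>) \<in> V" if "\<tau> \<in> {s..t}" for \<tau>
      using d(2)[of \<tau>] st that by auto
    have U: "b \<otimes> fst (C x \<tau>) \<in> one_dom" if "\<tau> \<in> {s..t}" for \<tau>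
      using inV[OF that] by (cases "C x \<tau>") (simp add: V_def translate_def)
    let ?c = "ctg_chart (fst x)" and ?k0 = "snd (ctg_chart (fst x)) x"
    let ?T = "\<lambda>\<tau> x. translate b (C x \<tau>)"
    define z where "z \<tau> = snd state_chart (?T \<tau> x)" for \<tau>
    have zS: "z \<tau> \<in> one_image \<times> UNIV" and zch: "fst (z \<tau>) = ch (b \<otimes> fst (C x \<tau>))"
      and zp: "fst (snd (snd (z \<tau>))) = riesz (fst (snd (snd (C x \<tau>))))" if "\<tau> \<in> {s..t}" for \<tau>
      using U[OF that] by (cases "C x \<tau>"; simp add: z_def translate_def riesz3_def)+
    obtain A where A: "has_mderiv ?c (ctg_chart (fst (C x s))) (\<lambda>x. C x s) x A"
      "\<And>v w. canonical_symplectic_form G (C x s) (A v) (A w) = canonical_symplectic_form G x v w"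
      using P unfolding preserved_at_def by blast
    define D where "D v = map_prod (left_field (ch (b \<otimes> fst (C x s)))) id (left_trivialise (fst (C x s)) (A v))" for v
    have Us: "b \<otimes> fst (C x s) \<in> one_dom" and Ut: "b \<otimes> fst (C x t) \<in> one_dom" using U st by auto
    have Ds: "has_mderiv ?c state_chart (?T s) x D"
      unfolding D_def
      by (rule mderiv_compose[OF good_ctg mem_ctg good_ctg mem_ctg A(1) mderiv_translate[OF Us]])
    have cx: "chart_inv ?c ?k0 = x" by (rule good_chartD(6)[OF good_ctg mem_ctg])
    let ?F = "\<lambda>k \<tau>. ?T \<tau> (chart_inv ?c k)"
    have curves: "ode_curve (fst state_chart) (snd state_chart) hohp_field s t (?F k)" for k
      by (rule ode_curve_subset[OF traj_ode_curve[OF C]]) (use st in auto)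
    have in0: "?F ?k0 ` {s..t} \<subseteq> fst state_chart"
    proof (rule image_subsetI)
      fix \<tau> assume "\<tau> \<in> {s..t}"
      then show "?F ?k0 \<tau> \<in> fst state_chart" unfolding cx using U by (simp add: mem_state)
    qed
    have "isCont (\<lambda>k. ?F k s) ?k0"
      by (rule isCont_o2[where f = "chart_inv ?c" and g = "?T s", OF good_chartD(8)[OF good_ctg mem_ctg]])
        (use Ds cx in \<open>simp add: has_mderiv_def\<close>)
    then have ev: "\<forall>\<^sub>F k in nhds ?k0. ?F k s \<in> fst state_chart"
      by (rule eventually_in_open[OF _ good_chartD(1)[OF good_state]])
        (use Us cx in \<open>simp add: mem_state\<close>)
    have Ds': "((\<lambda>k. snd state_chart (?F k s)) has_derivative D) (at ?k0)"
      using Ds by (simp add: has_mderiv_def)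
    have sle: "s \<le> t" using st by simp
    have zF: "snd state_chart (?F ?k0 \<tau>) = z \<tau>" for \<tau> unfolding cx z_def ..
    obtain M where M: "M s = id_blinfun"
      "\<And>\<tau>. \<tau> \<in> {s..t} \<Longrightarrow>
        (M has_vector_derivative (hohp_field' (snd state_chart (?F ?k0 \<tau>)) o\<^sub>L M \<tau>)) (at \<tau> within {s..t})"
      "\<And>\<tau>. \<tau> \<in> {s..t} \<Longrightarrow> ((\<lambda>k. snd state_chart (?F k \<tau>)) has_derivative (\<lambda>v. M \<tau> (D v))) (at ?k0)"
      "\<And>\<tau>. \<tau> \<in> {s..t} \<Longrightarrow> \<forall>\<^sub>F k in nhds ?k0. ?F k \<tau> \<in> fst state_chart"
      by (rule ode_curve_differentiable[OF hohp_field_chart sle curves in0 ev Ds']) blast+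
    have "t \<in> {s..t}" using st by simp
    then have Dt: "has_mderiv ?c state_chart (?T t) x (\<lambda>v. M t (D v))"
      by (intro mderivI[OF good_ctg mem_ctg good_state] M(3,4))
    obtain I where I: "has_mderiv state_chart (ctg_chart (fst (C x t))) (translate_inv b) (?T t x) I"
      by (rule mderiv_translate_inv[OF Ut])
    have At: "has_mderiv ?c (ctg_chart (fst (C x t))) (\<lambda>x. C x t) x (\<lambda>v. I (M t (D v)))"
      using mderiv_compose[OF good_ctg mem_ctg good_state _ Dt I] Ut
      by (simp add: mem_state)
    \<comment> \<open>Translating back and forth identifies \<open>M t (D v)\<close> as the chart expression of a trivialised vector.\<close>
    have Dt2: "(\<lambda>v. M t (D v)) =
        (\<lambda>v. map_prod (left_field (ch (b \<otimes> fst (C x t)))) id (left_trivialise (fst (C x t)) (I (M t (D v)))))"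
      by (rule mderiv_unique[OF Dt
            mderiv_compose[OF good_ctg mem_ctg good_ctg mem_ctg At mderiv_translate[OF Ut]]])
    show "preserved_at (\<lambda>x. C x t) x"
      unfolding preserved_at_def
    proof (intro exI[of _ "\<lambda>v. I (M t (D v))"] conjI allI At)
      fix v w :: "('e, 'e) cotangent_TG"
      define vw where "vw i = (if i then v else w)" for i :: bool
      have "triv_form (fst (snd (snd (z s)))) (left_trivialise (fst (C x s)) (A (vw True))) (left_trivialise (fst (C x s)) (A (vw False))) =
        triv_form (fst (snd (snd (z t)))) (left_trivialise (fst (C x t)) (I (M t (D (vw True)))))
          (left_trivialise (fst (C x t)) (I (M t (D (vw False)))))"
      proof (rule linearised_form_constant[where M = M and v = "\<lambda>i. D (vw i)" and z = z and s = s and t = t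
            and hs = "\<lambda>i. left_trivialise (fst (C x s)) (A (vw i))" and ht = "\<lambda>i. left_trivialise (fst (C x t)) (I (M t (D (vw i))))"])
        show "s \<le> t" using st by simp
        show "z \<tau> \<in> one_image \<times> UNIV" if "\<tau> \<in> {s..t}" for \<tau> by (rule zS[OF that])
        show "(z has_vector_derivative hohp_field (z \<tau>)) (at \<tau> within {s..t})" if "\<tau> \<in> {s..t}" for \<tau>
          using curves[of ?k0] that in0 unfolding ode_curve_def cx z_def by blast
        show "norm (left_field (fst (z \<tau>)) - id_blinfun) < 1/2" if "\<tau> \<in> {s..t}" for \<tau>
          using inV[OF that] by (cases "C x \<tau>") (simp add: V_def translate_def z_def)
        show "(M has_vector_derivative (hohp_field' (z \<tau>) o\<^sub>L M \<tau>)) (at \<tau> within {s..t})" if "\<tau> \<in> {s..t}" for \<tau>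
          using M(2)[OF that] unfolding zF .
        show "M s (D (vw i)) = map_prod (left_field (fst (z s))) id (left_trivialise (fst (C x s)) (A (vw i)))" for i
          using st by (simp add: M(1) D_def zch)
        show "M t (D (vw i)) = map_prod (left_field (fst (z t))) id (left_trivialise (fst (C x t)) (I (M t (D (vw i)))))" for i
          using fun_cong[OF Dt2, of "vw i"] st by (simp add: zch)
      qed
      then show "canonical_symplectic_form G (C x t) (I (M t (D v))) (I (M t (D w))) =
          canonical_symplectic_form G x v w"
        unfolding A(2)[symmetric] unfolding canonical_symplectic_form_trivialised using st by (simp add: zp vw_def)
    qed
  qed
qed

lemma preserved:
  assumes C: "\<And>x. traj a (C x)" "\<And>x. C x 0 = x" and t: "t \<in> {0..a}"
  shows "preserved_at (\<lambda>x. C x t) x"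
proof -
  have "(0::real) \<le> 0 \<and> t \<le> a \<longrightarrow> preserved_at (\<lambda>x. C x 0) x \<longrightarrow> preserved_at (\<lambda>x. C x t) x"
  proof (rule Bolzano[where P = "\<lambda>s t. 0 \<le> s \<and> t \<le> a \<longrightarrow> preserved_at (\<lambda>x. C x s) x \<longrightarrow> preserved_at (\<lambda>x. C x t) x"])
    show "0 \<le> t" using t by simp
    fix t0 assume "0 \<le> t0" "t0 \<le> t"
    then have "t0 \<in> {0..a}" using t by simp
    then obtain d where "d > 0"
      "\<And>s t. 0 \<le> s \<Longrightarrow> s \<le> t0 \<Longrightarrow> t0 \<le> t \<Longrightarrow> t \<le> a \<Longrightarrow> t - s < d \<Longrightarrow>
        preserved_at (\<lambda>x. C x s) x \<Longrightarrow> preserved_at (\<lambda>x. C x t) x"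
      using preserved_at_step[of a C, OF C(1)] by metis
    then show "\<exists>d>0. \<forall>s t. s \<le> t0 \<and> t0 \<le> t \<and> t - s < d \<longrightarrow> 0 \<le> s \<and> t \<le> a \<longrightarrow>
        preserved_at (\<lambda>x. C x s) x \<longrightarrow> preserved_at (\<lambda>x. C x t) x"
      by (intro exI[of _ d]) blast
  qed auto
  moreover have "preserved_at (\<lambda>x. C x 0) x"
    unfolding preserved_at_def C(2) using mderiv_id[OF good_ctg mem_ctg] by (intro exI[of _ "\<lambda>v. v"]) simp
  ultimately show ?thesis using t by simp
qed

lemma hohp_flow_preserves:
  assumes flow: "\<And>x :: ('g, 'e) cotangent_TG. \<exists>\<gamma>. hohp_solution G l a \<gamma> \<and> \<gamma> 0 = phi_inv l x"
    and t: "t \<in> {0..a}"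
  shows "preserved_at (hohp_flow G l a t) x"
proof -
  obtain \<Gamma> where \<Gamma>: "\<And>x :: ('g, 'e) cotangent_TG. hohp_solution G l a (\<Gamma> x) \<and> \<Gamma> x 0 = phi_inv l x"
    using flow by metis
  define C where "C x \<tau> = phi (\<Gamma> x \<tau>)" for x \<tau>
  have C: "traj a (C x)" "C x 0 = x" for x
    using \<Gamma>[of x] phi_phi_inv[of x] by (auto simp: traj_def C_def[abs_def])
  have "hohp_flow G l a t x = C x t" for x
    unfolding hohp_flow_def
  proof (rule the_equality)
    show "\<exists>\<gamma>. hohp_solution G l a \<gamma> \<and> \<gamma> 0 = phi_inv l x \<and> C x t = phi (\<gamma> t)"
      using \<Gamma>[of x] C_def by blast
    fix y assume "\<exists>\<gamma>. hohp_solution G l a \<gamma> \<and> \<gamma> 0 = phi_inv l x \<and> y = phi (\<gamma> t)"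
    then obtain \<gamma> where \<gamma>: "hohp_solution G l a \<gamma>" "\<gamma> 0 = phi_inv l x" "y = phi (\<gamma> t)" by blast
    have "traj a (\<lambda>\<tau>. phi (\<gamma> \<tau>))" using \<gamma>(1) by (auto simp: traj_def)
    from traj_unique[OF this C(1)[of x] _ t] show "y = C x t"
      using \<gamma>(2,3) C(2)[of x] phi_phi_inv[of x] by simp
  qed
  then have "hohp_flow G l a t = (\<lambda>x. C x t)" by (rule ext)
  then show ?thesis using preserved[of a C, OF C t] by simp
qed

end

theorem mainTheorem2:
  fixes G :: "('g::{t2_space,second_countable_topology}, 'e::euclidean_space) lie_group_data"
    and L :: "(real \<Rightarrow> 'g) set \<Rightarrow> real"
    and l :: "'e \<times> 'e \<Rightarrow> real"
    and a :: real
  assumes "lie_group G"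
    and "a > 0"
    and "smooth_lagrangian G L"
    and "left_invariant_lagrangian G L"
    and "l = reduced_lagrangian G L"
    and "hyper_regular G l"
    and "\<And>x :: ('g, 'e) cotangent_TG. \<exists>\<gamma>. hohp_solution G l a \<gamma> \<and> \<gamma> 0 = phi_inv l x"
  shows "\<forall>t\<in>{0..a}.
    (\<forall>x. manifold_differentiable_at (cotangent_TG_charts G) (cotangent_TG_charts G)
           (hohp_flow G l a t) x) \<and>
    pullback_2form (cotangent_TG_charts G) (cotangent_TG_charts G) (hohp_flow G l a t)
      (canonical_symplectic_form G) = canonical_symplectic_form G"
proof -
  interpret regular_lagrangian G L l
    using assms by (simp add: regular_lagrangian_def regular_lagrangian_axioms_def)
  have charts: "cotangent_TG_charts G x = ctg_chart (fst x)" for x :: "('g, 'e) cotangent_TG"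
    by (cases x) (simp add: prod_charts_eq)
  show ?thesis
  proof (intro ballI conjI allI ext)
    fix t x v w assume t: "t \<in> {0..a}"
    let ?C = "cotangent_TG_charts G" and ?F = "hohp_flow G l a t"
    obtain A where A: "has_mderiv (cotangent_TG_charts G x)
          (cotangent_TG_charts G (hohp_flow G l a t x)) (hohp_flow G l a t) x A"
      "\<And>v w. canonical_symplectic_form G (hohp_flow G l a t x) (A v) (A w) = canonical_symplectic_form G x v w"
      using hohp_flow_preserves[OF assms(7) t, of x] unfolding preserved_at_def charts by blast
    show "manifold_differentiable_at (cotangent_TG_charts G) (cotangent_TG_charts G) (hohp_flow G l a t) x"
      by (rule mderiv_tangent_map(1)[where C = ?C and D = ?C and f = ?F, OF A(1)])
    show "pullback_2form (cotangent_TG_charts G) (cotangent_TG_charts G) (hohp_flow G l a t)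
      (canonical_symplectic_form G) x v w = canonical_symplectic_form G x v w"
      by (simp add: pullback_2form_def mderiv_tangent_map(2)[where C = ?C and D = ?C and f = ?F, OF A(1)] A(2))
  qed
qed

end
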